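(* There is a function $g' \colon \mathbb{N} \to \mathbb{N}$ such that the following holds. For every $t$-vertex forest $F$ and every $R \subseteq V(F)$, for every graph $G$ and every $S \subseteq V(G)$, and for every positive integer $k$, either there are $k$ vertex-disjoint models of $(F,R)$ in $(G,S)$, or there is a set $X \subseteq V(G)$ of size at most $g'(t)\cdot k$ such that there is no model of $(F,R)$ in $(G-X, S \setminus X)$.
   Context: All graphs are finite, simple and undirected. A model of a graph $H$ in a graph $G$ is a family $(B_x \mid x\in V(H))$ of pairwise disjoint nonempty subsets of $V(G)$, called branch sets, each inducing a connected subgraph of $G$, such that for every $xy\in E(H)$ there is an edge of $G$ with one endpoint in $B_x$ and one endpoint in $B_y$. For graphs $G,H$ and sets $S\subseteq V(G)$, $R\subseteq V(H)$, a model of $(H,R)$ in $(G,S)$ is a model $(B_x\mid x\in V(H))$ of $H$ in $G$ such that $B_x\cap S\neq\emptyset$ for every $x\in R$. Models are vertex-disjoint if the unions of their branch sets are pairwise disjoint. $G-X$ is the graph obtained from $G$ by deleting the vertices in $X$. *)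

theory Defs
  imports "Graph_Theory.Graph_Theory" "HOL-Library.Disjoint_Sets"
begin

text \<open>
  Finite simple undirected graphs are \<^locale>\<open>pair_graph\<close>s: a finite vertex set with a symmetric
  irreflexive adjacency relation. The notions below are defined on \<^typ>\<open>('a, 'b) pre_digraph\<close>
  because \<^const>\<open>induce_subgraph\<close> returns one, and are applied to \<^const>\<open>with_proj\<close> of a pair graph.
\<close>

text \<open>
  The constant \<^const>\<open>forest\<close> cannot be used for symmetric digraphs: there an edge between
  \<open>a\<close> and \<open>b\<close> already yields the directed cycle \<open>a, b, a\<close>. In a symmetric digraph without loops
  and parallel arcs, the cycles of the undirected graph are the directed ones of length at least 3.
\<close>

definition undirected_forest :: "('a, 'b) pre_digraph \<Rightarrow> bool" where
  "undirected_forest G \<longleftrightarrow> \<not> (\<exists>p. pre_digraph.cycle G p \<and> 3 \<le> length p)"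

text \<open>Only the values of \<open>B\<close> on \<open>verts H\<close> are relevant.\<close>

definition graph_model ::
  "('v, 'e) pre_digraph \<Rightarrow> ('a, 'b) pre_digraph \<Rightarrow> ('v \<Rightarrow> 'a set) \<Rightarrow> bool" where
  "graph_model H G B \<longleftrightarrow>
     (\<forall>x\<in>verts H. B x \<subseteq> verts G \<and> B x \<noteq> {} \<and> Digraph_Component.connected (G \<restriction> B x)) \<and>
     disjoint_family_on B (verts H) \<and>
     (\<forall>(x, y)\<in>arcs_ends H. \<exists>u\<in>B x. \<exists>v\<in>B y. (u, v) \<in> arcs_ends G)"

definition rooted_model ::
  "('v, 'e) pre_digraph \<Rightarrow> 'v set \<Rightarrow> ('a, 'b) pre_digraph \<Rightarrow> 'a set \<Rightarrow> ('v \<Rightarrow> 'a set) \<Rightarrow> bool" where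
  "rooted_model H R G S B \<longleftrightarrow> graph_model H G B \<and> (\<forall>x\<in>R. B x \<inter> S \<noteq> {})"

definition has_disjoint_rooted_models ::
  "nat \<Rightarrow> ('v, 'e) pre_digraph \<Rightarrow> 'v set \<Rightarrow> ('a, 'b) pre_digraph \<Rightarrow> 'a set \<Rightarrow> bool" where
  "has_disjoint_rooted_models k H R G S \<longleftrightarrow>
     (\<exists>B :: nat \<Rightarrow> 'v \<Rightarrow> 'a set.
        (\<forall>i<k. rooted_model H R G S (B i)) \<and>
        disjoint_family_on (\<lambda>i. \<Union>x\<in>verts H. B i x) {..<k})"

definition delete_verts :: "('a, 'b) pre_digraph \<Rightarrow> 'a set \<Rightarrow> ('a, 'b) pre_digraph" where
  "delete_verts G X = G \<restriction> (verts G - X)"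

end

theory Submission
  imports Defs
begin

text \<open>
  A connected set has rank \<open>0\<close> if it contains a terminal, and rank \<open>h + 1\<close> if it contains three disjoint
  sets of rank \<open>h\<close> and a further connected set adjacent to all three. A set of rank \<open>h\<close> hosts every
  rooted tree on at most \<open>h + 1\<close> vertices, because a set of rank \<open>h + 1\<close> can be rerooted at any of its
  vertices while two branches survive. Conversely, by Menger's theorem, a vertex set without a set of
  rank \<open>h\<close> is narrow: it has a linear layout with boundaries and increments bounded in terms of \<open>h\<close>.

  The core is an Erdos-Posa theorem for ranks, by induction on \<open>h\<close>: if at most \<open>p\<close> sets of rank \<open>h\<close>
  can be packed, then deleting \<open>O(p)\<close> vertices leaves a narrow set. Hence either all copies of all
  components of the forest can be placed in a packing, or the graph becomes narrow after a
  deletion of the permitted size; in a narrow graph the components are placed greedily, each time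
  at the earliest place of the layout where one fits, at the cost of a bounded number of vertices.
  Components without roots are treated in the same way, with every vertex as a terminal.
\<close>

subsection \<open>Menger's theorem\<close>

text \<open>A direct induction on the rank fails: few disjoint sets of rank \<open>h + 1\<close> do
  not bound the number of disjoint sets of rank \<open>h\<close>, since a long chain of the latter
  may contain none of the former. Such chains are therefore treated by hand. They are narrow, being
  laid out from both ends at once, and the induction hypothesis is applied only to a region meeting
  \<open>O(p)\<close> members of a maximum packing of rank \<open>h\<close>; by exchange, such a
  region packs no more than it meets.

  Sets of rank \<open>h + 1\<close> may be arbitrarily large, which would spoil linear bounds. Each
  contains one that is covered by boundedly many paths. If many disjoint routes leave a path, their
  starting vertices can be grouped in threes along it with at most two left over, and three routes
  to distinct sets of rank \<open>h\<close> are what one more level of rank requires.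

  Layouts count the terminals of an increment and not its vertices, because a part of the graph
  without terminals can be arbitrarily complicated and still host no rooted tree.\<close>

definition walk :: "('a \<times> 'a) set \<Rightarrow> 'a list \<Rightarrow> bool" where
  "walk r p \<longleftrightarrow> successively (\<lambda>x y. (x, y) \<in> r) p"

lemma walk_simps [simp]: "walk r []" "walk r [x]"
    "walk r (x # y # p) \<longleftrightarrow> (x, y) \<in> r \<and> walk r (y # p)"
  by (auto simp: walk_def)

lemma walk_append:
  "walk r (p @ q) \<longleftrightarrow> walk r p \<and> walk r q \<and> (p = [] \<or> q = [] \<or> (last p, hd q) \<in> r)"
  by (auto simp: walk_def successively_append_iff)

lemma walk_mono: "walk r p \<Longrightarrow> r \<subseteq> r' \<Longrightarrow> walk r' p"
  unfolding walk_def by (erule successively_mono) auto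

lemma walk_Cons: "walk r (x # p) \<longleftrightarrow> walk r p \<and> (p = [] \<or> (x, hd p) \<in> r)"
  by (cases p) auto

text \<open>A later vertex in \<open>A\<close> starts, and an earlier vertex in \<open>B\<close>
  ends, a strictly shorter walk of the same kind.\<close>

lemma walk_trim:
  assumes "walk r p" "p \<noteq> []" "hd p \<in> A" "last p \<in> B"
  obtains q where "walk r q" "q \<noteq> []" "hd q \<in> A" "last q \<in> B" "set q \<subseteq> set p"
    "set (tl q) \<inter> A = {}" "set (butlast q) \<inter> B = {}"
  using assms
proof (induction "length p" arbitrary: p thesis rule: less_induct)
  case less
  show ?case
  proof (cases "set (tl p) \<inter> A = {} \<and> set (butlast p) \<inter> B = {}")
    case True
    then show ?thesis using less.prems(1)[of p] less.prems by auto
  next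
    case False
    then consider (a) x where "x \<in> set (tl p)" "x \<in> A" | (b) x where "x \<in> set (butlast p)" "x \<in> B"
      by blast
    then show ?thesis
    proof cases
      case a
      then obtain u v where uv: "tl p = u @ x # v" by (auto dest: split_list)
      then have p: "p = (hd p # u) @ (x # v)" using less.prems by (cases p) auto
      have "walk r (x # v)" using less.prems(2) p by (metis walk_append)
      moreover have "last (x # v) = last p"
        using arg_cong[OF p, of last] unfolding last_append by simp
      moreover have "set (x # v) \<subseteq> set p" using arg_cong[OF p, of set] by auto
      moreover have "length (x # v) < length p" using arg_cong[OF p, of length] by simp
      ultimately show ?thesis using less.hyps[of "x # v"] less.prems a
        by (metis list.distinct(1) list.sel(1) subset_trans)
    next
      case b
      then obtain u v where uv: "butlast p = u @ x # v" by (auto dest: split_list)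
      then have p: "p = (u @ [x]) @ (v @ [last p])" using less.prems
        by (metis append.assoc append_Cons append_Nil append_butlast_last_id)
      have "walk r (u @ [x])" using less.prems(2) p by (metis walk_append)
      moreover have "hd (u @ [x]) = hd p"
        using arg_cong[OF p, of hd] by (cases u) auto
      moreover have "set (u @ [x]) \<subseteq> set p" using arg_cong[OF p, of set] by auto
      moreover have "length (u @ [x]) < length p" using arg_cong[OF p, of length] by simp
      ultimately show ?thesis using less.hyps[of "u @ [x]"] less.prems b
        by (metis snoc_eq_iff_butlast subset_trans)
    qed
  qed
qed

definition separates :: "('a \<times> 'a) set \<Rightarrow> 'a set \<Rightarrow> 'a set \<Rightarrow> 'a set \<Rightarrow> bool" where
  "separates r A B D \<longleftrightarrow>
     (\<forall>p. walk r p \<longrightarrow> p \<noteq> [] \<longrightarrow> hd p \<in> A \<longrightarrow> last p \<in> B \<longrightarrow> set p \<inter> D \<noteq> {})"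

text \<open>The members are trimmed at both ends so that two linkages can be glued along a common
  separator. A member may revisit its own vertices; only different members must be disjoint.\<close>

definition linkage :: "('a \<times> 'a) set \<Rightarrow> 'a set \<Rightarrow> 'a set \<Rightarrow> 'a list set \<Rightarrow> bool" where
  "linkage r A B P \<longleftrightarrow> finite P \<and>
     (\<forall>p\<in>P. walk r p \<and> p \<noteq> [] \<and> hd p \<in> A \<and> last p \<in> B \<and>
        set (tl p) \<inter> A = {} \<and> set (butlast p) \<inter> B = {}) \<and>
     (\<forall>p\<in>P. \<forall>q\<in>P. p \<noteq> q \<longrightarrow> set p \<inter> set q = {})"

lemma linkage_if_walks:
  assumes "finite P"
    and "\<And>p. p \<in> P \<Longrightarrow> walk r p \<and> p \<noteq> [] \<and> hd p \<in> A \<and> last p \<in> B"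
    and "\<And>p q. p \<in> P \<Longrightarrow> q \<in> P \<Longrightarrow> p \<noteq> q \<Longrightarrow> set p \<inter> set q = {}"
  shows "\<exists>Q. linkage r A B Q \<and> card Q = card P"
proof -
  have "\<forall>p\<in>P. \<exists>q. walk r q \<and> q \<noteq> [] \<and> hd q \<in> A \<and> last q \<in> B \<and> set q \<subseteq> set p \<and>
    set (tl q) \<inter> A = {} \<and> set (butlast q) \<inter> B = {}"
    using walk_trim assms(2) by metis
  then obtain f where f: "\<And>p. p \<in> P \<Longrightarrow> walk r (f p) \<and> f p \<noteq> [] \<and> hd (f p) \<in> A \<and> last (f p) \<in> B
      \<and> set (f p) \<subseteq> set p \<and> set (tl (f p)) \<inter> A = {} \<and> set (butlast (f p)) \<inter> B = {}"
    by metis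
  have dj: "set (f p) \<inter> set (f q) = {}" if "p \<in> P" "q \<in> P" "p \<noteq> q" for p q
    using that f assms(3) by blast
  have "inj_on f P"
  proof (rule inj_onI)
    fix p q assume "p \<in> P" "q \<in> P" "f p = f q"
    then show "p = q" using dj[of p q] f[of p] by (metis inf.idem set_empty)
  qed
  then have "card (f ` P) = card P" by (rule card_image)
  moreover have "linkage r A B (f ` P)"
    unfolding linkage_def using assms(1) f dj by fastforce
  ultimately show ?thesis by blast
qed

lemma linkage_ends:
  assumes "linkage r A B P"
  shows "inj_on hd P" "inj_on last P"
proof -
  have "set p \<inter> set q \<noteq> {}" if "p \<in> P" "q \<in> P" "hd p = hd q \<or> last p = last q" for p q
  proof -
    have ne: "p \<noteq> []" "q \<noteq> []" using that assms by (auto simp: linkage_def)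
    then show ?thesis using that hd_in_set[OF ne(1)] hd_in_set[OF ne(2)]
      last_in_set[OF ne(1)] last_in_set[OF ne(2)] by fastforce
  qed
  then have "p = q" if "p \<in> P" "q \<in> P" "hd p = hd q \<or> last p = last q" for p q
    using assms that unfolding linkage_def by metis
  then show "inj_on hd P" "inj_on last P"
    unfolding inj_on_def by metis+
qed

text \<open>In the second case \<open>u\<close> is the part before the first use of the arc and
  \<open>v\<close> the part after its last use.\<close>

lemma walk_remove_arc:
  assumes "walk r p" "p \<noteq> []"
  shows "walk (r - {(x, y)}) p \<or>
    (\<exists>u v. u \<noteq> [] \<and> v \<noteq> [] \<and> walk (r - {(x, y)}) u \<and> walk (r - {(x, y)}) v \<and>
       hd u = hd p \<and> last u = x \<and> hd v = y \<and> last v = last p \<and> set u \<subseteq> set p \<and> set v \<subseteq> set p)"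
  using assms
proof (induction p)
  case Nil
  then show ?case by simp
next
  case (Cons a p)
  show ?case
  proof (cases "p = []")
    case True
    then show ?thesis by simp
  next
    case False
    have w: "walk r p" "(a, hd p) \<in> r" using Cons.prems False by (auto simp: walk_Cons)
    let ?r = "r - {(x, y)}"
    from Cons.IH[OF w(1) False] show ?thesis
    proof
      assume p: "walk ?r p"
      show ?thesis
      proof (cases "(a, hd p) = (x, y)")
        case True
        have "[a] \<noteq> [] \<and> p \<noteq> [] \<and> walk ?r [a] \<and> walk ?r p \<and> hd [a] = hd (a # p) \<and> last [a] = x \<and>
            hd p = y \<and> last p = last (a # p) \<and> set [a] \<subseteq> set (a # p) \<and> set p \<subseteq> set (a # p)"
          using p False True by auto
        then show ?thesis by blast
      next
        case ne: False
        then show ?thesis using p w False by (auto simp: walk_Cons)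
      qed
    next
      assume "\<exists>u v. u \<noteq> [] \<and> v \<noteq> [] \<and> walk ?r u \<and> walk ?r v \<and>
       hd u = hd p \<and> last u = x \<and> hd v = y \<and> last v = last p \<and> set u \<subseteq> set p \<and> set v \<subseteq> set p"
      then obtain u v where uv: "u \<noteq> []" "v \<noteq> []" "walk ?r u" "walk ?r v"
       "hd u = hd p" "last u = x" "hd v = y" "last v = last p" "set u \<subseteq> set p" "set v \<subseteq> set p"
        by blast
      show ?thesis
      proof (cases "(a, hd p) = (x, y)")
        case True
        have "[a] \<noteq> [] \<and> v \<noteq> [] \<and> walk ?r [a] \<and> walk ?r v \<and> hd [a] = hd (a # p) \<and> last [a] = x \<and>
            hd v = y \<and> last v = last (a # p) \<and> set [a] \<subseteq> set (a # p) \<and> set v \<subseteq> set (a # p)"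
          using uv True False by auto
        then show ?thesis by blast
      next
        case ne: False
        have "(a # u) \<noteq> [] \<and> v \<noteq> [] \<and> walk ?r (a # u) \<and> walk ?r v \<and> hd (a # u) = hd (a # p) \<and>
            last (a # u) = x \<and>
            hd v = y \<and> last v = last (a # p) \<and> set (a # u) \<subseteq> set (a # p) \<and> set v \<subseteq> set (a # p)"
          using uv ne w False by (auto simp: walk_Cons)
        then show ?thesis by blast
      qed
    qed
  qed
qed

text \<open>A walk from \<open>A\<close> to \<open>B\<close> either avoids the arc and then meets
  \<open>D0\<close>, or runs through \<open>x\<close> before and through \<open>y\<close> after it.
  In both cases it has an arc-free initial part from \<open>A\<close> to \<open>insert x D0\<close>
  and an arc-free final part from \<open>insert y D0\<close> to \<open>B\<close>, and
  \<open>D\<close> meets one of them.\<close>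

lemma separates_trans:
  assumes D0: "separates (r - {(x, y)}) A B D0"
    and D: "separates (r - {(x, y)}) A (insert x D0) D \<or> separates (r - {(x, y)}) (insert y D0) B D"
  shows "separates r A B D"
  unfolding separates_def
proof (intro allI impI)
  fix p assume p: "walk r p" "p \<noteq> []" "hd p \<in> A" "last p \<in> B"
  let ?r = "r - {(x, y)}"
  from walk_remove_arc[OF p(1,2), of x y] show "set p \<inter> D \<noteq> {}"
  proof
    assume w: "walk ?r p"
    then obtain z where z: "z \<in> set p" "z \<in> D0" using D0 p unfolding separates_def by blast
    then obtain u v where uv: "p = u @ z # v" by (auto dest: split_list)
    have "p = (u @ [z]) @ v" using uv by simp
    then have w1: "walk ?r (u @ [z])" using w by (metis walk_append)
    have w2: "walk ?r (z # v)" using w uv by (metis walk_append)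
    have h: "hd (u @ [z]) = hd p" using uv by (cases u) auto
    have l: "last (z # v) = last p" using uv by simp
    from D show ?thesis
    proof
      assume "separates ?r A (insert x D0) D"
      then have "set (u @ [z]) \<inter> D \<noteq> {}" unfolding separates_def
        using w1 h p z by (metis insertCI last_snoc snoc_eq_iff_butlast)
      then show ?thesis using uv by auto
    next
      assume "separates ?r (insert y D0) B D"
      then have "set (z # v) \<inter> D \<noteq> {}" unfolding separates_def
        using w2 l p z by (metis insertCI list.distinct(1) list.sel(1))
      then show ?thesis using uv by auto
    qed
  next
    assume "\<exists>u v. u \<noteq> [] \<and> v \<noteq> [] \<and> walk ?r u \<and> walk ?r v \<and>
       hd u = hd p \<and> last u = x \<and> hd v = y \<and> last v = last p \<and> set u \<subseteq> set p \<and> set v \<subseteq> set p"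
    then obtain u v where uv: "u \<noteq> []" "v \<noteq> []" "walk ?r u" "walk ?r v"
       "hd u = hd p" "last u = x" "hd v = y" "last v = last p" "set u \<subseteq> set p" "set v \<subseteq> set p"
      by blast
    from D show ?thesis
    proof
      assume "separates ?r A (insert x D0) D"
      then have "set u \<inter> D \<noteq> {}" unfolding separates_def using uv p by (metis insertI1)
      then show ?thesis using uv by auto
    next
      assume "separates ?r (insert y D0) B D"
      then have "set v \<inter> D \<noteq> {}" unfolding separates_def using uv p by (metis insertI1)
      then show ?thesis using uv by auto
    qed
  qed
qed

text \<open>
  Goering's argument: if removing the arc \<open>(x, y)\<close> creates a separator \<open>D\<close> that is too small, then
  \<open>A\<close> is linked to \<open>insert x D\<close> and \<open>insert y D\<close> to \<open>B\<close>, and the two linkages can only meet in \<open>D\<close>.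
\<close>

theorem menger:
  assumes "finite r" "finite A" "finite B"
    and "\<And>D. finite D \<Longrightarrow> separates r A B D \<Longrightarrow> n \<le> card D"
  shows "\<exists>P. linkage r A B P \<and> card P = n"
  using assms
proof (induction "card r" arbitrary: r A B rule: less_induct)
  case less
  note fin = \<open>finite r\<close> \<open>finite A\<close> \<open>finite B\<close>
  show ?case
  proof (cases "r = {}")
    case True
    \<comment> \<open>Without arcs every walk is a single vertex, so the common vertices of
      \<open>A\<close> and \<open>B\<close> are both a separator and a linkage.\<close>
    have "\<exists>x. p = [x]" if "walk {} p" "p \<noteq> []" for p :: "'a list"
      using that by (metis empty_iff list.exhaust walk_simps(3))
    then have "separates r A B (A \<inter> B)" unfolding separates_def True by fastforce
    then have "n \<le> card (A \<inter> B)" using less.prems(4) fin by blast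
    then obtain C where C: "C \<subseteq> A \<inter> B" "card C = n" "finite C"
      using obtain_subset_with_card_n by blast
    have "linkage r A B ((\<lambda>x. [x]) ` C)" using C by (auto simp: linkage_def)
    moreover have "card ((\<lambda>x. [x]) ` C) = n" using C by (simp add: card_image inj_on_def)
    ultimately show ?thesis by blast
  next
    case False
    then obtain x y where e: "(x, y) \<in> r" by auto
    let ?r = "r - {(x, y)}"
    have lt: "card ?r < card r" using e fin by (intro card_Diff1_less)
    show ?thesis
    proof (cases "\<forall>D. finite D \<longrightarrow> separates ?r A B D \<longrightarrow> n \<le> card D")
      case True
      then obtain P where "linkage ?r A B P" "card P = n"
        using less.hyps[OF lt, of A B] fin by blast
      moreover then have "linkage r A B P"
        unfolding linkage_def by (meson Diff_subset walk_mono)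
      ultimately show ?thesis by blast
    next
      case False
      then obtain D where D: "finite D" "separates ?r A B D" "card D < n" by force
      let ?X = "insert x D" and ?Y = "insert y D"
      have "n \<le> card E" if "finite E" "separates ?r A ?X E" for E
        using separates_trans[OF D(2)] that less.prems(4) by blast
      then obtain P where P: "linkage ?r A ?X P" "card P = n"
        using less.hyps[OF lt, of A ?X] fin D by blast
      have "n \<le> card E" if "finite E" "separates ?r ?Y B E" for E
        using separates_trans[OF D(2)] that less.prems(4) by blast
      then obtain Q where Q: "linkage ?r ?Y B Q" "card Q = n"
        using less.hyps[OF lt, of ?Y B] fin D by blast
      have lP: "last ` P \<subseteq> ?X" and hQ: "hd ` Q \<subseteq> ?Y" using P Q by (auto simp: linkage_def)
      have cP: "card (last ` P) = n" and cQ: "card (hd ` Q) = n"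
        using P Q linkage_ends card_image by metis+
      \<comment> \<open>The linkages have \<open>n\<close> distinct ends in \<open>?X\<close> and in
        \<open>?Y\<close>, while \<open>card D < n\<close>. Hence both sets have exactly
        \<open>n\<close> elements and neither \<open>x\<close> nor \<open>y\<close> lies in
        \<open>D\<close>.\<close>
      have "card ?X \<ge> n" "card ?Y \<ge> n" using cP cQ lP hQ D(1) by (metis card_mono finite_insert)+
      then have n: "card ?X = n" "card ?Y = n" "n = Suc (card D)" "x \<notin> D" "y \<notin> D"
        using D by (auto simp: card_insert_if split: if_splits)
      have "last ` P = ?X" "hd ` Q = ?Y"
        using lP hQ cP cQ n D(1) by (metis card_subset_eq finite_insert)+
      then have lP: "last ` P = ?X" and hQ: "hd ` Q = ?Y" by blast+
      define p q where "p = inv_into P last" and "q = inv_into Q hd"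
      have p: "p z \<in> P \<and> last (p z) = z" if "z \<in> ?X" for z
        using that unfolding p_def lP[symmetric] by (simp add: inv_into_into f_inv_into_f)
      have q: "q z \<in> Q \<and> hd (q z) = z" if "z \<in> ?Y" for z
        using that unfolding q_def hQ[symmetric] by (simp add: inv_into_into f_inv_into_f)
      have pw: "walk ?r (p z)" "p z \<noteq> []" "hd (p z) \<in> A" "set (butlast (p z)) \<inter> ?X = {}" if "z \<in> ?X" for z
        using p[OF that] P by (auto simp: linkage_def)
      have qw: "walk ?r (q z)" "q z \<noteq> []" "last (q z) \<in> B" "set (tl (q z)) \<inter> ?Y = {}" if "z \<in> ?Y" for z
        using q[OF that] Q by (auto simp: linkage_def)
      \<comment> \<open>Following \<open>p z\<close> up to a common vertex and then
        \<open>q z'\<close> is an arc-free walk from \<open>A\<close> to \<open>B\<close>, which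
        must meet \<open>D\<close>. But \<open>p z\<close> avoids \<open>D\<close> before its end
        and \<open>q z'\<close> avoids it after its start.\<close>
      have meet: "v = z \<and> v = z'" if zz: "z \<in> ?X" "z' \<in> ?Y" and v: "v \<in> set (p z)" "v \<in> set (q z')" for v z z'
      proof (cases "v \<in> D")
        case True
        have sp: "set (p z) = insert z (set (butlast (p z)))"
          using p[OF zz(1)] arg_cong[OF append_butlast_last_id[OF pw(2)[OF zz(1)]], of set] by auto
        have sq: "set (q z') = insert z' (set (tl (q z')))"
          using q[OF zz(2)] qw(2)[OF zz(2)] by (metis list.collapse list.simps(15))
        show ?thesis using True v sp sq pw(4)[OF zz(1)] qw(4)[OF zz(2)] by auto
      next
        case nD: False
        obtain a b where ab: "p z = a @ v # b" using v(1) by (auto dest: split_list)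
        obtain c d where cd: "q z' = c @ v # d" using v(2) by (auto dest: split_list)
        have "set a \<subseteq> set (butlast (p z))" unfolding ab by (simp add: butlast_append)
        then have a: "set a \<inter> D = {}" using pw(4)[OF zz(1)] by auto
        have "set d \<subseteq> set (tl (q z'))" unfolding cd by (cases c) auto
        then have d: "set d \<inter> D = {}" using qw(4)[OF zz(2)] by auto
        have "walk ?r (a @ v # d)"
          using pw(1)[OF zz(1)] qw(1)[OF zz(2)] unfolding ab cd by (auto simp: walk_append walk_Cons)
        moreover have "hd (a @ v # d) \<in> A" using pw(3)[OF zz(1)] ab by (cases a) auto
        moreover have "last (a @ v # d) \<in> B" using qw(3)[OF zz(2)] cd by auto
        ultimately have "set (a @ v # d) \<inter> D \<noteq> {}"
          using D(2) unfolding separates_def by blast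
        then show ?thesis using nD a d by auto
      qed
      \<comment> \<open>At \<open>x\<close> the removed arc joins the two walks. Elsewhere they
        share the vertex \<open>z\<close>, whose second copy \<open>tl\<close> drops.\<close>
      define f where "f z = (if z = x then p x @ q y else p z @ tl (q z))" for z
      have fw: "walk r (f z) \<and> f z \<noteq> [] \<and> hd (f z) \<in> A \<and> last (f z) \<in> B" if z: "z \<in> ?X" for z
      proof (cases "z = x")
        case True
        have "walk r (p x)" "walk r (q y)" 
          using walk_mono[OF pw(1)[of x] Diff_subset] walk_mono[OF qw(1)[of y] Diff_subset] by auto
        then show ?thesis using True pw[of x] qw[of y] p[of x] q[of y] e
          by (auto simp: f_def walk_append)
      next
        case False
        then have zD: "z \<in> D" using z by auto
        then have w: "walk r (p z)" "walk r (q z)" 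
          using walk_mono[OF pw(1)[of z] Diff_subset] walk_mono[OF qw(1)[of z] Diff_subset] by auto
        obtain t where t: "q z = z # t" using q[of z] qw(2)[of z] zD by (metis insertCI list.collapse)
        have "walk r (p z @ t)" using w t p[OF z] by (auto simp: walk_append walk_Cons)
        moreover have "last (p z @ t) \<in> B" using qw(3)[of z] zD t p[OF z] by (cases "t = []") auto
        ultimately show ?thesis using False t pw[OF z] by (auto simp: f_def)
      qed
      have fs: "set (f z) \<subseteq> set (p z) \<union> set (q (if z = x then y else z))" for z
        unfolding f_def by (cases "q z") auto
      have pp: "set (p z) \<inter> set (p w) = {}" if "z \<in> ?X" "w \<in> ?X" "z \<noteq> w" for z w
        using p[OF that(1)] p[OF that(2)] that P(1) unfolding linkage_def by metis
      have qq: "set (q z) \<inter> set (q w) = {}" if "z \<in> ?Y" "w \<in> ?Y" "z \<noteq> w" for z w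
        using q[OF that(1)] q[OF that(2)] that Q(1) unfolding linkage_def by metis
      have fd: "set (f z) \<inter> set (f w) = {}" if zw: "z \<in> ?X" "w \<in> ?X" "z \<noteq> w" for z w
      proof -
        let ?s = "\<lambda>z. if z = x then y else z"
        have Y: "?s z \<in> ?Y" "?s w \<in> ?Y" "?s z \<noteq> ?s w" using zw n by auto
        have ne: "z \<noteq> ?s w" "w \<noteq> ?s z" using zw n by (auto split: if_splits)
        have "set (p z) \<inter> set (q (?s w)) = {}" "set (p w) \<inter> set (q (?s z)) = {}"
          using meet[OF zw(1) Y(2)] meet[OF zw(2) Y(1)] ne by blast+
        then show ?thesis using fs[of z] fs[of w] pp[OF zw] qq[OF Y] by blast
      qed
      have inj: "inj_on f ?X"
        using fd fw by (intro inj_onI) (metis inf.idem set_empty)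
      have "\<exists>R. linkage r A B R \<and> card R = card (f ` ?X)"
      proof (rule linkage_if_walks)
        show "finite (f ` ?X)" using D by simp
        fix p assume "p \<in> f ` ?X"
        then obtain z where z: "z \<in> ?X" "p = f z" by (rule imageE)
        show "walk r p \<and> p \<noteq> [] \<and> hd p \<in> A \<and> last p \<in> B" unfolding z(2) by (rule fw[OF z(1)])
        fix q assume "q \<in> f ` ?X" "p \<noteq> q"
        then obtain w where w: "w \<in> ?X" "q = f w" by (elim imageE)
        show "set p \<inter> set q = {}"
          unfolding z(2) w(2) using \<open>p \<noteq> q\<close> z w by (intro fd) auto
      qed
      then show ?thesis using card_image[OF inj] n by simp
    qed
  qed
qed

subsection \<open>Connected sets\<close>

locale sym_graph =
  fixes adj :: "'a \<Rightarrow> 'a \<Rightarrow> bool"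
  assumes adj_sym: "adj x y \<Longrightarrow> adj y x"
begin

text \<open>A path-free form of connectedness: to show that a connected set lies in a given set, it
  suffices to check closure under adjacency. \<open>connected_induce\<close> identifies it with the
  library notion.\<close>

definition conn :: "'a set \<Rightarrow> bool" where
  "conn X \<longleftrightarrow> X \<noteq> {} \<and> (\<forall>Y. Y \<inter> X \<noteq> {} \<longrightarrow> (\<forall>y\<in>Y \<inter> X. \<forall>x\<in>X. adj y x \<longrightarrow> x \<in> Y) \<longrightarrow> X \<subseteq> Y)"

definition touch :: "'a set \<Rightarrow> 'a set \<Rightarrow> bool" where
  "touch X Y \<longleftrightarrow> (\<exists>x\<in>X. \<exists>y\<in>Y. adj x y)"

text \<open>The inner vertex boundary; deleting it cuts the rest of \<open>X\<close> off from
  \<open>V - X\<close>.\<close>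

definition bd :: "'a set \<Rightarrow> 'a set \<Rightarrow> 'a set" where
  "bd V X = {x \<in> X. \<exists>y\<in>V - X. adj x y}"

definition arcs_on :: "'a set \<Rightarrow> ('a \<times> 'a) set" where
  "arcs_on V = {(x, y). x \<in> V \<and> y \<in> V \<and> adj x y}"

lemma touch_sym: "touch X Y \<longleftrightarrow> touch Y X"
  unfolding touch_def using adj_sym by blast

lemma touch_mono: "touch X Y \<Longrightarrow> X \<subseteq> X' \<Longrightarrow> Y \<subseteq> Y' \<Longrightarrow> touch X' Y'"
  unfolding touch_def by blast

lemma touch_Un: "touch (X \<union> X') Y \<longleftrightarrow> touch X Y \<or> touch X' Y"
  "touch Y (X \<union> X') \<longleftrightarrow> touch Y X \<or> touch Y X'"
  unfolding touch_def by auto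

lemma bd_subset: "bd V X \<subseteq> X"
  by (auto simp: bd_def)

lemma bd_self [simp]: "bd V V = {}" and bd_empty [simp]: "bd V {} = {}"
  by (auto simp: bd_def)

lemma finite_arcs_on: "finite V \<Longrightarrow> finite (arcs_on V)"
  by (rule finite_subset[of _ "V \<times> V"]) (auto simp: arcs_on_def)

lemma conn_nonempty: "conn X \<Longrightarrow> X \<noteq> {}"
  by (simp add: conn_def)

lemma conn_subset_closed:
  assumes "conn X" "X \<inter> N \<noteq> {}" "\<And>v u. v \<in> N \<Longrightarrow> v \<in> X \<Longrightarrow> u \<in> X \<Longrightarrow> adj v u \<Longrightarrow> u \<in> N"
  shows "X \<subseteq> N"
  using assms unfolding conn_def by blast

lemma conn_singleton [simp]: "conn {x}"
  by (auto simp: conn_def)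

lemma conn_Union_star:
  assumes C: "conn C" and F: "\<And>X. X \<in> F \<Longrightarrow> conn X \<and> (X \<inter> C \<noteq> {} \<or> touch C X)"
  shows "conn (C \<union> \<Union>F)"
  unfolding conn_def
proof (intro conjI allI impI)
  let ?U = "C \<union> \<Union>F"
  show "?U \<noteq> {}" using conn_nonempty[OF C] by auto
  fix Y assume Y: "Y \<inter> ?U \<noteq> {}" and cl: "\<forall>y\<in>Y \<inter> ?U. \<forall>x\<in>?U. adj y x \<longrightarrow> x \<in> Y"
  have sub: "X \<subseteq> Y" if "conn X" "X \<subseteq> ?U" "X \<inter> Y \<noteq> {}" for X
    using conn_subset_closed[OF that(1,3)] cl that(2) by blast
  have step: "C \<subseteq> Y \<Longrightarrow> X \<in> F \<Longrightarrow> X \<subseteq> Y" for X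
    using F[of X] sub[of X] cl unfolding touch_def by blast
  have "C \<subseteq> Y"
  proof (cases "Y \<inter> C = {}")
    case True
    then obtain X where X: "X \<in> F" "X \<inter> Y \<noteq> {}" using Y by auto
    then have "X \<subseteq> Y" using F sub by blast
    then have "C \<inter> Y \<noteq> {}" using F[OF X(1)] cl X(1) adj_sym unfolding touch_def by blast
    then show ?thesis using sub C by blast
  next
    case False
    then show ?thesis using sub[OF C] by blast
  qed
  then show "?U \<subseteq> Y" using step by blast
qed

lemma conn_Un: "conn X \<Longrightarrow> conn Y \<Longrightarrow> X \<inter> Y \<noteq> {} \<or> touch X Y \<Longrightarrow> conn (X \<union> Y)"
  using conn_Union_star[of X "{Y}"] by auto

lemma conn_insert: "conn X \<Longrightarrow> touch X {u} \<Longrightarrow> conn (insert u X)"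
  using conn_Un[of X "{u}"] by auto

lemma conn_set_walk:
  assumes "walk r p" "p \<noteq> []" "r \<subseteq> {(x, y). adj x y}"
  shows "conn (set p)"
  using assms
proof (induction p)
  case (Cons a p)
  show ?case
  proof (cases "p = []")
    case False
    then have "conn (set p)" "adj a (hd p)" using Cons by (auto simp: walk_Cons)
    then show ?thesis using False adj_sym
      by (simp, intro conn_insert) (auto simp: touch_def intro: hd_in_set)
  qed auto
qed auto

lemma conn_walk:
  assumes "conn X" "x \<in> X" "y \<in> X"
  obtains p where "walk (arcs_on X) p" "distinct p" "p \<noteq> []" "hd p = x" "last p = y" "set p \<subseteq> X"
proof -
  define N where "N = {z \<in> X. \<exists>p. walk (arcs_on X) p \<and> distinct p \<and> p \<noteq> [] \<and> hd p = x \<and> last p = z \<and> set p \<subseteq> X}"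
  have "X \<subseteq> N"
  proof (rule conn_subset_closed[OF assms(1)])
    have "walk (arcs_on X) [x] \<and> distinct [x] \<and> [x] \<noteq> [] \<and> hd [x] = x \<and> last [x] = x \<and> set [x] \<subseteq> X"
      using assms by simp
    then have "x \<in> N" unfolding N_def using assms(2) by blast
    then show "X \<inter> N \<noteq> {}" using assms by blast
    fix v u assume v: "v \<in> N" "v \<in> X" "u \<in> X" "adj v u"
    then obtain p where p: "walk (arcs_on X) p" "distinct p" "p \<noteq> []" "hd p = x" "last p = v" "set p \<subseteq> X"
      unfolding N_def by blast
    show "u \<in> N"
    proof (cases "u \<in> set p")
      case True
      then obtain a b where ab: "p = a @ u # b" by (auto dest: split_list)
      have e: "p = (a @ [u]) @ b" using ab by simp
      then have "walk (arcs_on X) (a @ [u])" "distinct (a @ [u])" "hd (a @ [u]) = x" "set (a @ [u]) \<subseteq> X"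
        using p by (metis walk_append, metis distinct_append, metis hd_append2 snoc_eq_iff_butlast, auto)
      then have "walk (arcs_on X) (a @ [u]) \<and> distinct (a @ [u]) \<and> a @ [u] \<noteq> [] \<and> hd (a @ [u]) = x \<and>
        last (a @ [u]) = u \<and> set (a @ [u]) \<subseteq> X" by simp
      then show ?thesis unfolding N_def using v(3) by blast
    next
      case False
      have "walk (arcs_on X) (p @ [u]) \<and> distinct (p @ [u]) \<and> p @ [u] \<noteq> [] \<and> hd (p @ [u]) = x \<and>
        last (p @ [u]) = u \<and> set (p @ [u]) \<subseteq> X"
        using p False v by (auto simp: walk_append arcs_on_def)
      then show ?thesis unfolding N_def using v(3) by blast
    qed
  qed
  then show ?thesis using assms(3) that unfolding N_def by blast
qed

lemma walk_arcs_on_adj: "walk (arcs_on X) p \<Longrightarrow> p \<noteq> [] \<Longrightarrow> conn (set p)"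
  by (rule conn_set_walk) (auto simp: arcs_on_def)

lemma walk_set_arcs_on: "walk (arcs_on X) p \<Longrightarrow> p \<noteq> [] \<Longrightarrow> hd p \<in> X \<Longrightarrow> set p \<subseteq> X"
proof (induction p)
  case (Cons a p)
  then show ?case by (cases p) (auto simp: arcs_on_def)
qed auto

text \<open>A largest connected extension of \<open>C\<close> inside \<open>A - Y\<close> touches
  \<open>Y\<close>, since connectedness of \<open>A\<close> would otherwise supply one more vertex.
  This keeps a centre attached when its branch \<open>A\<close> is shrunk to
  \<open>Y\<close>.\<close>

lemma conn_extend_to:
  assumes "conn C" "conn A" "Y \<subseteq> A" "Y \<noteq> {}" "touch C A" "C \<inter> A = {}" "finite A"
  obtains C' where "C \<subseteq> C'" "C' \<subseteq> C \<union> (A - Y)" "conn C'" "touch C' Y"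
proof -
  let ?P = "\<lambda>D. conn (C \<union> D) \<and> D \<subseteq> A - Y"
  have "?P {}" using assms by simp
  moreover have "\<forall>D. ?P D \<longrightarrow> card D < Suc (card A)"
    using assms(7) by (meson Diff_subset card_mono le_imp_less_Suc subset_trans)
  ultimately obtain D where D: "?P D" "\<And>E. ?P E \<Longrightarrow> card E \<le> card D"
    using ex_has_greatest_nat[of ?P "{}" card "Suc (card A)"] by (metis less_imp_le_nat)
  have "touch (C \<union> D) Y"
  proof (rule ccontr)
    assume nt: "\<not> touch (C \<union> D) Y"
    have ex: "\<exists>u\<in>A - D. touch (C \<union> D) {u}"
    proof (cases "D = {}")
      case True
      then show ?thesis using assms(5) by (auto simp: touch_def)
    next
      case False
      have "\<not> A \<subseteq> D" using D(1) assms(3,4) by blast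
      then obtain v u where "v \<in> D" "u \<in> A" "adj v u" "u \<notin> D"
        using conn_subset_closed[OF assms(2), of D] D(1) False by blast
      then show ?thesis by (auto simp: touch_def)
    qed
    then obtain u where u: "u \<in> A" "u \<notin> D" "touch (C \<union> D) {u}" by blast
    then have "u \<notin> Y" using nt by (auto simp: touch_def)
    then have "?P (insert u D)" using D(1) u conn_insert[of "C \<union> D" u] by auto
    then have "card (insert u D) \<le> card D" by (rule D(2))
    moreover have "finite D" using D(1) assms(7) by (meson Diff_subset finite_subset)
    ultimately show False using u by simp
  qed
  then show ?thesis using D(1) that[of "C \<union> D"] by auto
qed

subsection \<open>Narrow layouts\<close>

text \<open>The prefixes of a linear layout. If \<open>T\<close> contains all vertices, bounded
  \<open>w\<close> corresponds to bounded path-width: the boundary of a prefix together with the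
  next increment forms a bag.\<close>

inductive lay :: "'a set \<Rightarrow> 'a set \<Rightarrow> nat \<Rightarrow> 'a set \<Rightarrow> bool" for V T w where
  lay_empty: "lay V T w {}"
| lay_step: "lay V T w X \<Longrightarrow> X \<subseteq> Y \<Longrightarrow> Y \<subseteq> V \<Longrightarrow> card (bd V Y) \<le> w \<Longrightarrow> card (T \<inter> (Y - X)) \<le> w
    \<Longrightarrow> lay V T w Y"

definition narrow :: "'a set \<Rightarrow> 'a set \<Rightarrow> nat \<Rightarrow> bool" where
  "narrow V T w \<longleftrightarrow> lay V T w V"

lemma lay_bound: "lay V T w X \<Longrightarrow> X \<subseteq> V \<and> card (bd V X) \<le> w"
  by (induction rule: lay.induct) auto

lemma narrow_empty [simp]: "narrow {} T w"
  by (simp add: narrow_def lay_empty)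

lemma narrow_step: "lay V T w X \<Longrightarrow> card (T \<inter> (V - X)) \<le> w \<Longrightarrow> narrow V T w"
  unfolding narrow_def by (rule lay_step[of V T w X]) (auto dest: lay_bound)

lemma lay_mono: "lay V T w X \<Longrightarrow> w \<le> w' \<Longrightarrow> lay V T w' X"
proof (induction rule: lay.induct)
  case (lay_step X Y)
  then show ?case by (intro lay.lay_step[OF lay_step.IH]) auto
qed (rule lay_empty)

lemma narrow_mono: "narrow V T w \<Longrightarrow> w \<le> w' \<Longrightarrow> narrow V T w'"
  unfolding narrow_def by (rule lay_mono)

lemma lay_restrict:
  assumes "lay V T w X" "V' \<subseteq> V" "finite V"
  shows "lay V' T w (X \<inter> V')"
  using assms(1)
proof (induction rule: lay.induct)
  case lay_empty
  then show ?case by (simp add: lay.lay_empty)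
next
  case (lay_step X Y)
  have f: "finite Y" using lay_step.hyps assms(3) finite_subset by blast
  have "bd V' (Y \<inter> V') \<subseteq> bd V Y" using assms(2) by (auto simp: bd_def)
  then have "card (bd V' (Y \<inter> V')) \<le> w"
    using lay_step f by (meson bd_subset card_mono finite_subset le_trans)
  moreover have "card (T \<inter> (Y \<inter> V' - X \<inter> V')) \<le> card (T \<inter> (Y - X))"
    using f by (intro card_mono) auto
  ultimately show ?case
    by (intro lay.lay_step[OF lay_step.IH]) (use lay_step.hyps in auto)
qed

lemma narrow_subset: "narrow V T w \<Longrightarrow> V' \<subseteq> V \<Longrightarrow> finite V \<Longrightarrow> narrow V' T w"
  unfolding narrow_def using lay_restrict[of V T w V V'] by (simp add: Int_absorb1)

text \<open>The layout of \<open>V'\<close> is put on top of that of \<open>V\<close>; as the sets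
  do not touch, all of \<open>V\<close> has empty boundary.\<close>

lemma narrow_Un:
  assumes "narrow V T w" "narrow V' T w" "\<not> touch V V'" "V \<inter> V' = {}"
  shows "narrow (V \<union> V') T w"
proof -
  have nt: "\<not> touch V' V" using assms(3) touch_sym by blast
  have 1: "lay (V \<union> V') T w X" if "lay V T w X" for X using that
  proof (induction rule: lay.induct)
    case (lay_step X Y)
    have "bd (V \<union> V') Y = bd V Y" using lay_step.hyps(3) assms(3) unfolding bd_def touch_def by blast
    then show ?case by (intro lay.lay_step[OF lay_step.IH]) (use lay_step.hyps in auto)
  qed (rule lay_empty)
  have "lay (V \<union> V') T w (V \<union> X)" if "lay V' T w X" for X using that
  proof (induction rule: lay.induct)
    case lay_empty
    then show ?case using 1 assms(1) by (simp add: narrow_def)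
  next
    case (lay_step X Y)
    have "bd (V \<union> V') (V \<union> Y) = bd V' Y"
      using lay_step.hyps(3) nt assms(3,4) unfolding bd_def touch_def by auto
    moreover have "V \<union> Y - (V \<union> X) = Y - X"
      using lay_step.hyps(3) assms(4) by blast
    ultimately show ?case by (intro lay.lay_step[OF lay_step.IH]) (use lay_step.hyps in auto)
  qed
  then show ?thesis using assms(2) by (simp add: narrow_def)
qed

text \<open>The way from \<open>X\<close> to \<open>Y\<close> is interpolated by the sets
  \<open>X \<union> (Y \<inter> Z)\<close>, where \<open>Z\<close> runs through a layout of
  \<open>R\<close>. Their boundary vertices come from the boundaries of \<open>X\<close>,
  \<open>Y\<close> and \<open>Z\<close>, whence \<open>2 * a + w\<close>.\<close>

lemma lay_fill:
  assumes X: "lay K T W X" and R: "narrow R T w" and XY: "X \<subseteq> Y" "Y \<subseteq> K" "Y - X \<subseteq> R"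
    and c: "card (bd K X) \<le> a" "card (bd K Y) \<le> a" "2 * a + w \<le> W" and fin: "finite K" "finite R"
  shows "lay K T W Y"
proof -
  have "lay K T W (X \<union> (Y \<inter> Z))" if "lay R T w Z" for Z using that
  proof (induction rule: lay.induct)
    case lay_empty
    then show ?case using X by simp
  next
    case (lay_step Z Z')
    have f: "finite (bd K X)" "finite (bd K Y)" "finite (bd R Z')" "finite Z'"
      using fin XY lay_step.hyps by (meson bd_subset finite_subset subset_trans)+
    have "bd K (X \<union> (Y \<inter> Z')) \<subseteq> bd K X \<union> bd K Y \<union> bd R Z'"
      using XY lay_step.hyps unfolding bd_def by auto
    then have "card (bd K (X \<union> (Y \<inter> Z'))) \<le> card (bd K X \<union> bd K Y \<union> bd R Z')"
      using f by (intro card_mono) auto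
    also have "\<dots> \<le> card (bd K X) + card (bd K Y) + card (bd R Z')"
      by (meson add_le_mono card_Un_le le_refl le_trans)
    also have "\<dots> \<le> W" using c lay_step.hyps by simp
    finally have 1: "card (bd K (X \<union> (Y \<inter> Z'))) \<le> W" .
    have "card (T \<inter> (X \<union> (Y \<inter> Z') - (X \<union> (Y \<inter> Z)))) \<le> card (T \<inter> (Z' - Z))"
      using f by (intro card_mono) auto
    then have 2: "card (T \<inter> (X \<union> (Y \<inter> Z') - (X \<union> (Y \<inter> Z)))) \<le> W"
      using lay_step.hyps c by simp
    show ?case by (rule lay.lay_step[OF lay_step.IH _ _ 1 2]) (use lay_step.hyps XY in auto)
  qed
  from this[of R] have "lay K T W (X \<union> (Y \<inter> R))" using R by (simp add: narrow_def)
  moreover have "X \<union> (Y \<inter> R) = Y" using XY by blast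
  ultimately show ?thesis by simp
qed

lemma bd_submodular:
  assumes "finite X" "finite Y"
  shows "card (bd V (X \<inter> Y)) + card (bd V (X \<union> Y)) \<le> card (bd V X) + card (bd V Y)"
proof -
  have f: "finite (bd V Z)" if "finite Z" for Z using that bd_subset finite_subset by metis
  have "card (bd V (X \<inter> Y)) + card (bd V (X \<union> Y)) =
    card (bd V (X \<inter> Y) \<union> bd V (X \<union> Y)) + card (bd V (X \<inter> Y) \<inter> bd V (X \<union> Y))"
    using f assms by (intro card_Un_Int) auto
  also have "\<dots> \<le> card (bd V X \<union> bd V Y) + card (bd V X \<inter> bd V Y)"
    using f assms by (intro add_mono card_mono) (auto simp: bd_def)
  also have "\<dots> = card (bd V X) + card (bd V Y)"
    using f assms by (intro card_Un_Int[symmetric]) auto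
  finally show ?thesis .
qed

subsection \<open>Rank\<close>

fun rk :: "'a set \<Rightarrow> nat \<Rightarrow> 'a set \<Rightarrow> bool" where
  "rk T 0 X \<longleftrightarrow> conn X \<and> X \<inter> T \<noteq> {}"
| "rk T (Suc h) X \<longleftrightarrow> conn X \<and> (\<exists>C A1 A2 A3. C \<union> A1 \<union> A2 \<union> A3 \<subseteq> X \<and> conn C \<and>
     rk T h A1 \<and> rk T h A2 \<and> rk T h A3 \<and> touch C A1 \<and> touch C A2 \<and> touch C A3 \<and>
     C \<inter> A1 = {} \<and> C \<inter> A2 = {} \<and> C \<inter> A3 = {} \<and> A1 \<inter> A2 = {} \<and> A1 \<inter> A3 = {} \<and> A2 \<inter> A3 = {})"

lemma rk_conn: "rk T h X \<Longrightarrow> conn X"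
  by (cases h) auto

lemma rk_mono: "rk T h X \<Longrightarrow> X \<subseteq> Y \<Longrightarrow> conn Y \<Longrightarrow> rk T h Y"
proof (cases h)
  case (Suc n)
  assume X: "rk T h X" "X \<subseteq> Y" "conn Y"
  then obtain C A1 A2 A3 where "C \<union> A1 \<union> A2 \<union> A3 \<subseteq> X" and *: "conn C"
     "rk T n A1" "rk T n A2" "rk T n A3" "touch C A1" "touch C A2" "touch C A3"
     "C \<inter> A1 = {}" "C \<inter> A2 = {}" "C \<inter> A3 = {}" "A1 \<inter> A2 = {}" "A1 \<inter> A3 = {}" "A2 \<inter> A3 = {}"
    unfolding Suc rk.simps by blast
  moreover have "C \<union> A1 \<union> A2 \<union> A3 \<subseteq> Y" using calculation(1) X(2) by (rule subset_trans)
  ultimately show ?thesis unfolding Suc rk.simps using X(3) by blast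
qed auto

lemma rk_terminal: "rk T h X \<Longrightarrow> X \<inter> T \<noteq> {}"
proof (induction h arbitrary: X)
  case (Suc h)
  then obtain C A1 A2 A3 where A: "C \<union> A1 \<union> A2 \<union> A3 \<subseteq> X" "rk T h A1"
    unfolding rk.simps by blast
  from Suc.IH[OF A(2)] A(1) show ?case by blast
qed auto

lemma rk_SucI:
  assumes "conn C" "rk T h A1" "rk T h A2" "rk T h A3" "touch C A1" "touch C A2" "touch C A3"
    "C \<inter> A1 = {}" "C \<inter> A2 = {}" "C \<inter> A3 = {}" "A1 \<inter> A2 = {}" "A1 \<inter> A3 = {}" "A2 \<inter> A3 = {}"
  shows "rk T (Suc h) (C \<union> A1 \<union> A2 \<union> A3)"
proof -
  have "conn (C \<union> \<Union>{A1, A2, A3})"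
    by (rule conn_Union_star[OF assms(1)]) (use assms(2-7) rk_conn in auto)
  then have "conn (C \<union> A1 \<union> A2 \<union> A3)" by (simp add: Un_assoc)
  moreover have "C \<union> A1 \<union> A2 \<union> A3 \<subseteq> C \<union> A1 \<union> A2 \<union> A3" by (rule subset_refl)
  ultimately show ?thesis using assms unfolding rk.simps by blast
qed

end

text \<open>The indices below \<open>i\<close> in the ternary heap order, up to depth \<open>h\<close>.\<close>

fun heap :: "nat \<Rightarrow> nat \<Rightarrow> nat set" where
  "heap 0 i = {i}"
| "heap (Suc h) i = insert i (heap h (3 * i + 1) \<union> heap h (3 * i + 2) \<union> heap h (3 * i + 3))"

context sym_graph
begin

text \<open>\<open>Z\<close> consists of \<open>Y0\<close>, the separator inside \<open>Y\<close>,
  and all that is reached from the boundary of \<open>Y0\<close> without using \<open>D\<close>. As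
  \<open>B\<close> contains the boundary of \<open>Y\<close>, the vertices reached have no
  neighbours outside \<open>Y\<close>, so only vertices of \<open>D\<close> can be on the boundary
  of \<open>Z\<close>.\<close>

lemma cut_of_separator:
  assumes "Y0 \<subseteq> Y" "Y \<subseteq> V" "bd V Y \<subseteq> B" and M: "M = Y - (Y0 - bd V Y0)"
    and sep: "separates (arcs_on M) (bd V Y0) B D"
  obtains Z where "Y0 \<subseteq> Z" "Z \<subseteq> Y" "bd V Z \<subseteq> D" "(Z - Y0) \<inter> B \<subseteq> D"
proof -
  define R where "R = {v. \<exists>p. walk (arcs_on M) p \<and> p \<noteq> [] \<and> hd p \<in> bd V Y0 \<and> last p = v \<and> set p \<inter> D = {}}"
  have bM: "bd V Y0 \<subseteq> M" using assms(1) M bd_subset by fastforce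
  have RM: "R \<subseteq> M"
    unfolding R_def using walk_set_arcs_on bM by (fastforce dest: last_in_set)
  have RB: "R \<inter> B = {}" using sep unfolding R_def separates_def by blast
  have bR: "v \<in> R" if "v \<in> bd V Y0" "v \<notin> D" for v
  proof -
    have "walk (arcs_on M) [v] \<and> [v] \<noteq> [] \<and> hd [v] \<in> bd V Y0 \<and> last [v] = v \<and> set [v] \<inter> D = {}"
      using that by simp
    then show ?thesis unfolding R_def by blast
  qed
  have ext: "u \<in> R" if "v \<in> R" "u \<in> M" "adj v u" "u \<notin> D" for u v
  proof -
    obtain p where p: "walk (arcs_on M) p" "p \<noteq> []" "hd p \<in> bd V Y0" "last p = v" "set p \<inter> D = {}"
      using \<open>v \<in> R\<close> unfolding R_def by blast
    have "walk (arcs_on M) (p @ [u]) \<and> p @ [u] \<noteq> [] \<and> hd (p @ [u]) \<in> bd V Y0 \<and> last (p @ [u]) = u \<and>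
      set (p @ [u]) \<inter> D = {}"
      using p that RM by (auto simp: walk_append arcs_on_def)
    then show ?thesis unfolding R_def by blast
  qed
  let ?Z = "Y0 \<union> (D \<inter> Y) \<union> R"
  have 1: "?Z \<subseteq> Y" using assms(1) RM M by auto
  have 2: "bd V ?Z \<subseteq> D"
  proof
    fix v assume v: "v \<in> bd V ?Z"
    show "v \<in> D"
    proof (rule ccontr)
      assume nD: "v \<notin> D"
      obtain u where u: "u \<in> V" "u \<notin> ?Z" "adj v u" using v by (auto simp: bd_def)
      have vR: "v \<in> R"
      proof (cases "v \<in> Y0")
        case True
        then have "v \<in> bd V Y0" using u by (auto simp: bd_def)
        then show ?thesis using bR nD by blast
      next
        case False
        then show ?thesis using v nD by (auto simp: bd_def)
      qed
      show False
      proof (cases "u \<in> Y")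
        case True
        then show ?thesis using ext[OF vR _ u(3)] u M by blast
      next
        case False
        then have "v \<in> bd V Y" using u vR RM M by (auto simp: bd_def)
        then show ?thesis using RB vR assms(3) by blast
      qed
    qed
  qed
  have 3: "(?Z - Y0) \<inter> B \<subseteq> D" using RB by blast
  show ?thesis by (rule that[OF _ 1 2 3]) auto
qed

text \<open>Menger's theorem from the boundary of \<open>Y0\<close> to \<open>B\<close>. A linkage
  with as many members as this boundary has vertices starts once at every boundary vertex, so the
  members can be indexed by these vertices. \<open>M\<close> omits the interior of
  \<open>Y0\<close>, which keeps them outside it.\<close>

lemma linkage_or_cut:
  assumes "finite V" "Y0 \<subseteq> Y" "Y \<subseteq> V" "bd V Y \<subseteq> B" "B \<subseteq> M" and M: "M = Y - (Y0 - bd V Y0)"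
  obtains (cut) Z D where "Y0 \<subseteq> Z" "Z \<subseteq> Y" "bd V Z \<subseteq> D" "(Z - Y0) \<inter> B \<subseteq> D" "finite D"
      "card D < card (bd V Y0)"
  | (link) f where "\<And>a. a \<in> bd V Y0 \<Longrightarrow> conn (f a) \<and> f a \<subseteq> M \<and> f a \<inter> bd V Y0 = {a} \<and> f a \<inter> B \<noteq> {}"
      "\<And>a b. a \<in> bd V Y0 \<Longrightarrow> b \<in> bd V Y0 \<Longrightarrow> a \<noteq> b \<Longrightarrow> f a \<inter> f b = {}"
proof (cases "\<exists>D. finite D \<and> separates (arcs_on M) (bd V Y0) B D \<and> card D < card (bd V Y0)")
  case True
  then show ?thesis using cut_of_separator[OF assms(2-4) M] cut by metis
next
  case False
  let ?A = "bd V Y0"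
  have fin: "finite ?A" "finite M" "finite B"
    using assms by (meson bd_subset finite_subset, meson Diff_subset finite_subset, meson Diff_subset finite_subset)
  have "\<exists>P. linkage (arcs_on M) ?A B P \<and> card P = card ?A"
    using False fin by (intro menger finite_arcs_on) (auto simp: not_less)
  then obtain P where P: "linkage (arcs_on M) ?A B P" "card P = card ?A" by blast
  have p: "walk (arcs_on M) p \<and> p \<noteq> [] \<and> hd p \<in> ?A \<and> last p \<in> B \<and> set (tl p) \<inter> ?A = {}" if "p \<in> P" for p
    using P that by (auto simp: linkage_def)
  have "card (hd ` P) = card ?A" using P linkage_ends card_image by metis
  then have hP: "hd ` P = ?A" using p fin by (intro card_subset_eq) auto
  define g where "g = inv_into P hd"
  have g: "g a \<in> P \<and> hd (g a) = a" if "a \<in> ?A" for a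
    using that unfolding g_def hP[symmetric] by (simp add: inv_into_into f_inv_into_f)
  show ?thesis
  proof (rule link)
    fix a assume a: "a \<in> ?A"
    note pg = p[OF conjunct1[OF g[OF a]]]
    have "?A \<subseteq> M" using M assms(2) bd_subset by fastforce
    then have "set (g a) \<subseteq> M" using walk_set_arcs_on pg by blast
    moreover have "set (g a) \<inter> ?A = {a}"
      using pg g[OF a] a by (cases "g a") auto
    moreover have "set (g a) \<inter> B \<noteq> {}" using pg last_in_set by blast
    ultimately show "conn (set (g a)) \<and> set (g a) \<subseteq> M \<and> set (g a) \<inter> ?A = {a} \<and> set (g a) \<inter> B \<noteq> {}"
      using walk_arcs_on_adj pg by blast
    fix b assume b: "b \<in> ?A" "a \<noteq> b"
    then have "g a \<noteq> g b" using g[OF a] g[OF b(1)] by metis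
    then show "set (g a) \<inter> set (g b) = {}"
      using P(1) g[OF a] g[OF b(1)] unfolding linkage_def by blast
  qed
qed

subsection \<open>Wide layouts contain sets of large rank\<close>

text \<open>The extremal choice behind the argument for wide layouts: any strictly larger laid set
  pays with a larger boundary, so Menger's theorem cannot find a small cut beyond
  \<open>X\<close>.\<close>

definition closed_lay :: "'a set \<Rightarrow> 'a set \<Rightarrow> nat \<Rightarrow> 'a set \<Rightarrow> bool" where
  "closed_lay V T w X \<longleftrightarrow> lay V T w X \<and>
     (\<forall>Y. lay V T w Y \<longrightarrow> X \<subseteq> Y \<longrightarrow> card (bd V Y) \<le> card (bd V X) \<longrightarrow> Y = X)"

text \<open>A partial model of the ternary tree, with nodes in heap order: the parent of
  \<open>j\<close> is \<open>(j - 1) div 3\<close>. Each branch set reaches the boundary in its own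
  token \<open>\<tau> j\<close>, where children can still be attached, and the tokens use up the
  whole boundary.\<close>

definition tree_tokens :: "'a set \<Rightarrow> 'a set \<Rightarrow> nat \<Rightarrow> (nat \<Rightarrow> 'a set) \<Rightarrow> (nat \<Rightarrow> 'a) \<Rightarrow> bool" where
  "tree_tokens V X i B \<tau> \<longleftrightarrow> inj_on \<tau> {..<i} \<and> bd V X = \<tau> ` {..<i} \<and>
     (\<forall>j<i. conn (B j) \<and> B j \<subseteq> X \<and> B j \<inter> bd V X = {\<tau> j}) \<and>
     (\<forall>j<i. \<forall>k<i. j \<noteq> k \<longrightarrow> B j \<inter> B k = {}) \<and>
     (\<forall>j<i. 0 < j \<longrightarrow> touch (B ((j - 1) div 3)) (B j))"

lemma ex_greatest:
  fixes f :: "'b \<Rightarrow> nat"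
  assumes "P x" "\<And>y. P y \<Longrightarrow> f y \<le> b"
  obtains m where "P m" "\<And>y. P y \<Longrightarrow> f y \<le> f m"
  using ex_has_greatest_nat[of P x f "Suc b"] assms by (metis le_imp_less_Suc)

lemma closed_lay_extend:
  assumes "finite V" "lay V T w X" "card (bd V X) \<le> n"
  obtains Y where "X \<subseteq> Y" "closed_lay V T w Y" "card (bd V Y) \<le> n"
proof -
  let ?P = "\<lambda>Y. X \<subseteq> Y \<and> lay V T w Y \<and> card (bd V Y) \<le> n"
  have "?P X" using assms by simp
  moreover have "card Y \<le> card V" if "?P Y" for Y using that assms(1) lay_bound card_mono by metis
  ultimately obtain Y where Y: "?P Y" "\<And>Z. ?P Z \<Longrightarrow> card Z \<le> card Y"
    using ex_greatest[of ?P X card "card V"] by blast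
  have "closed_lay V T w Y" unfolding closed_lay_def
  proof (intro conjI allI impI)
    fix Z assume Z: "lay V T w Z" "Y \<subseteq> Z" "card (bd V Z) \<le> card (bd V Y)"
    then have "card Z \<le> card Y" using Y by (meson le_trans subset_trans)
    moreover have "finite Z" using Z(1) lay_bound assms(1) finite_subset by metis
    ultimately show "Z = Y" using Z(2) by (metis card_seteq)
  qed (use Y in blast)
  then show ?thesis using that Y by blast
qed

text \<open>Of all sets between \<open>Y0\<close> and \<open>Y\<close>, one with smallest boundary inherits the layout of \<open>Y\<close>.\<close>

lemma lay_between:
  assumes fin: "finite V" and Y: "lay V T w Y" and Z: "Y0 \<subseteq> Z" "Z \<subseteq> Y" "card (bd V Z) \<le> n"
  obtains Z' where "Y0 \<subseteq> Z'" "Z' \<subseteq> Y" "lay V T w Z'" "card (bd V Z') \<le> n"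
proof -
  let ?P = "\<lambda>Z. Y0 \<subseteq> Z \<and> Z \<subseteq> Y"
  obtain Z' where Z': "?P Z'" "\<And>U. ?P U \<Longrightarrow> card (bd V Z') \<le> card (bd V U)"
    using ex_has_least_nat[of ?P Z "\<lambda>Z. card (bd V Z)"] Z by metis
  have YV: "Y \<subseteq> V" using lay_bound Y by blast
  have "lay V T w (X \<inter> Z')" if "lay V T w X" "X \<subseteq> Y" for X using that
  proof (induction rule: lay.induct)
    case (lay_step X X')
    have f: "finite X'" "finite Z'" using lay_step Z' YV fin by (meson finite_subset)+
    \<comment> \<open>Like \<open>Z'\<close>, the set \<open>X' \<union> Z'\<close> lies between
      \<open>Y0\<close> and \<open>Y\<close>. By minimality of \<open>Z'\<close> its boundary is no
      smaller, so submodularity leaves \<open>X' \<inter> Z'\<close> a boundary no larger than that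
      of \<open>X'\<close>.\<close>
    have "card (bd V (X' \<inter> Z')) + card (bd V (X' \<union> Z')) \<le> card (bd V X') + card (bd V Z')"
      using f by (rule bd_submodular)
    moreover have "card (bd V Z') \<le> card (bd V (X' \<union> Z'))"
      using Z' lay_step.prems by (intro Z'(2)) auto
    ultimately have 1: "card (bd V (X' \<inter> Z')) \<le> w" using lay_step.hyps by linarith
    have "card (T \<inter> (X' \<inter> Z' - X \<inter> Z')) \<le> card (T \<inter> (X' - X))"
      using f by (intro card_mono) auto
    then have 2: "card (T \<inter> (X' \<inter> Z' - X \<inter> Z')) \<le> w" using lay_step.hyps by linarith
    have "lay V T w (X \<inter> Z')" using lay_step by blast
    then show ?case by (rule lay.lay_step[OF _ _ _ 1 2]) (use lay_step.hyps in auto)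
  qed (simp add: lay_empty)
  from this[OF Y] have "lay V T w Z'" using Z' by (simp add: Int_absorb1)
  moreover have "card (bd V Z') \<le> n" using Z' Z by (meson le_trans)
  ultimately show ?thesis using that Z' by blast
qed

text \<open>Node \<open>i\<close> starts as a vertex \<open>u\<close> outside \<open>X\<close> next
  to the token of its parent. A closed laid set \<open>Y\<close> containing \<open>X\<close> and
  \<open>u\<close> has exactly \<open>i + 1\<close> boundary vertices, and Menger's theorem prolongs
  all tokens disjointly to them. A smaller cut would yield, by \<open>lay_between\<close>, a laid
  set above \<open>X\<close> with at most \<open>i\<close> boundary vertices, against
  closedness.\<close>

lemma tokens_step:
  assumes fin: "finite V" and cl: "closed_lay V T w X" and tok: "tree_tokens V X i B \<tau>"
    and iw: "i < w" and nl: "\<not> narrow V T w"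
  obtains X' B' \<tau>' where "closed_lay V T w X'" "tree_tokens V X' (Suc i) B' \<tau>'"
proof -
  have lX: "lay V T w X" using cl by (simp add: closed_lay_def)
  then have XV: "X \<subseteq> V" using lay_bound by blast
  have finX: "finite X" using XV fin finite_subset by blast
  have cX: "card (bd V X) = i" using tok by (auto simp: tree_tokens_def card_image)
  have B: "conn (B j) \<and> B j \<subseteq> X \<and> B j \<inter> bd V X = {\<tau> j}" if "j < i" for j
    using tok that by (auto simp: tree_tokens_def)
  have Bd: "B j \<inter> B k = {}" if "j < i" "k < i" "j \<noteq> k" for j k
    using tok that by (auto simp: tree_tokens_def)
  have "\<exists>u\<in>V - X. 0 < i \<longrightarrow> adj (\<tau> ((i - 1) div 3)) u"
  \<comment> \<open>The first node has no parent, so any vertex outside \<open>X\<close> serves; one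
    exists because \<open>V\<close> is not laid.\<close>
  proof (cases "i = 0")
    case True
    have "X \<noteq> V" using lX nl by (auto simp: narrow_def)
    then show ?thesis using True XV by auto
  next
    case False
    then have "(i - 1) div 3 < i" by (meson div_le_dividend diff_less le_less_trans not_gr_zero zero_less_one)
    then have "\<tau> ((i - 1) div 3) \<in> bd V X" using tok by (auto simp: tree_tokens_def)
    then show ?thesis by (auto simp: bd_def)
  qed
  then obtain u where u: "u \<in> V" "u \<notin> X" "0 < i \<Longrightarrow> adj (\<tau> ((i - 1) div 3)) u" by blast
  let ?Y0 = "insert u X"
  have bsub: "bd V ?Y0 \<subseteq> insert u (bd V X)" by (auto simp: bd_def)
  have finb: "finite (bd V X)" using finX bd_subset finite_subset by metis
  have "card (bd V ?Y0) \<le> card (insert u (bd V X))" using bsub finb by (intro card_mono) auto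
  also have "\<dots> \<le> Suc i" using cX finb by (simp add: card_insert_if)
  finally have c1: "card (bd V ?Y0) \<le> Suc i" .
  have "card (T \<inter> (?Y0 - X)) \<le> card {u}" by (intro card_mono) auto
  then have lY0: "lay V T w ?Y0" using lX c1 u XV iw by (intro lay.lay_step[OF lX]) auto
  have big: "i < card (bd V Z)" if "lay V T w Z" "?Y0 \<subseteq> Z" for Z
    using cl that u(2) cX unfolding closed_lay_def by (metis insert_subset not_less)
  have "card (insert u (bd V X)) \<le> card (bd V ?Y0)"
    using big[OF lY0] cX finb by (simp add: card_insert_if)
  then have bY0: "bd V ?Y0 = insert u (bd V X)" using bsub finb by (intro card_seteq) auto
  then have cY0: "card (bd V ?Y0) = Suc i" using big[OF lY0] c1 by simp
  obtain Y where Y: "?Y0 \<subseteq> Y" "closed_lay V T w Y" "card (bd V Y) \<le> Suc i"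
    using closed_lay_extend[OF fin lY0 c1] by blast
  have lY: "lay V T w Y" using Y by (simp add: closed_lay_def)
  then have YV: "Y \<subseteq> V" using lay_bound by blast
  have cY: "card (bd V Y) = Suc i" using big[OF lY Y(1)] Y(3) by simp
  define M where "M = Y - (?Y0 - bd V ?Y0)"
  have BM: "bd V Y \<subseteq> M" using Y(1) unfolding M_def bd_def by auto
  obtain f where f: "\<And>a. a \<in> bd V ?Y0 \<Longrightarrow> conn (f a) \<and> f a \<subseteq> M \<and> f a \<inter> bd V ?Y0 = {a} \<and> f a \<inter> bd V Y \<noteq> {}"
      "\<And>a b. a \<in> bd V ?Y0 \<Longrightarrow> b \<in> bd V ?Y0 \<Longrightarrow> a \<noteq> b \<Longrightarrow> f a \<inter> f b = {}"
  proof (rule linkage_or_cut[OF fin Y(1) YV subset_refl BM M_def])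
    fix Z D assume Z: "?Y0 \<subseteq> Z" "Z \<subseteq> Y" "bd V Z \<subseteq> D" "finite D" "card D < card (bd V ?Y0)"
    then have c: "card (bd V Z) \<le> i" using card_mono[OF Z(4,3)] cY0 by linarith
    obtain Z' where "?Y0 \<subseteq> Z'" "Z' \<subseteq> Y" "lay V T w Z'" "card (bd V Z') \<le> i"
      by (rule lay_between[OF fin lY Z(1,2) c])
    then show thesis using big[of Z'] by linarith
  qed (rule that; assumption)
  have "\<forall>a\<in>bd V ?Y0. \<exists>b. b \<in> f a \<inter> bd V Y" using f(1) by blast
  then obtain g where g: "\<And>a. a \<in> bd V ?Y0 \<Longrightarrow> g a \<in> f a \<inter> bd V Y" by metis
  have ginj: "inj_on g (bd V ?Y0)" using g f(2) by (intro inj_onI) (metis IntE disjoint_iff)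
  have finY: "finite (bd V Y)" using YV fin bd_subset finite_subset by metis
  \<comment> \<open>The two boundaries have the same size, so \<open>g\<close> is a bijection and
    each path meets the new boundary in a single vertex.\<close>
  have gim: "g ` bd V ?Y0 = bd V Y"
    using g cY0 cY finY card_image[OF ginj] by (intro card_subset_eq) auto
  have fY: "f a \<inter> bd V Y = {g a}" if a: "a \<in> bd V ?Y0" for a
  proof -
    have "x = g a" if x: "x \<in> f a" "x \<in> bd V Y" for x
    proof -
      obtain b where b: "b \<in> bd V ?Y0" "x = g b" using x gim by blast
      then have "x \<in> f b" using g by blast
      then show ?thesis using f(2)[OF a b(1)] x b by blast
    qed
    then show ?thesis using g[OF a] by blast
  qed
  have tau: "\<tau> j \<in> bd V X" if "j < i" for j using tok that by (auto simp: tree_tokens_def)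
  define t where "t j = (if j < i then \<tau> j else u)" for j
  have t: "t j \<in> bd V ?Y0" if "j < Suc i" for j using that tau bY0 by (auto simp: t_def)
  have tinj: "inj_on t {..<Suc i}"
  proof (rule inj_onI)
    fix j k assume jk: "j \<in> {..<Suc i}" "k \<in> {..<Suc i}" "t j = t k"
    have "inj_on \<tau> {..<i}" using tok by (simp add: tree_tokens_def)
    moreover have "u \<noteq> \<tau> j" "u \<noteq> \<tau> k" if "j < i \<or> k < i" using tau u bd_subset that
      by (metis jk subsetD t_def)+
    ultimately show "j = k" using jk unfolding t_def inj_on_def
      by (auto split: if_splits)
  qed
  have tim: "t ` {..<Suc i} = bd V ?Y0"
    using t tinj cY0 finb bY0 by (intro card_subset_eq) (auto simp: card_image)
  define B' where "B' j = (if j < i then B j \<union> f (\<tau> j) else f u)" for j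
  have fX: "f a \<inter> X \<subseteq> {a}" if "a \<in> bd V ?Y0" for a
    using f(1)[OF that] unfolding M_def by blast
  have fB: "f (t j) \<inter> B k = {}" if "j < Suc i" "k < i" "j \<noteq> k" for j k
  proof -
    have "f (t j) \<inter> B k \<subseteq> {t j} \<inter> B k" using fX[OF t[OF that(1)]] B[OF that(2)] by blast
    moreover have "t j \<notin> B k"
    proof
      assume a: "t j \<in> B k"
      then have "t j \<in> X" using B[OF that(2)] by blast
      then have "j < i" using u by (auto simp: t_def split: if_splits)
      then have "t j \<in> B j" using B[of j] by (auto simp: t_def)
      then show False using a Bd[OF \<open>j < i\<close> that(2,3)] by blast
    qed
    ultimately show ?thesis by blast
  qed
  have Bt: "B' j = (if j < i then B j else {}) \<union> f (t j)" if "j < Suc i" for j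
    using that by (auto simp: B'_def t_def)
  have "tree_tokens V Y (Suc i) B' (g \<circ> t)"
    unfolding tree_tokens_def
  proof (intro conjI allI impI)
    show "inj_on (g \<circ> t) {..<Suc i}" using tinj ginj tim by (simp add: comp_inj_on)
    show "bd V Y = (g \<circ> t) ` {..<Suc i}" by (metis image_comp tim gim)
    fix j assume j: "j < Suc i"
    have tf: "t j \<in> f (t j)" using f(1)[OF t[OF j]] by blast
    show "conn (B' j)"
    proof (cases "j < i")
      case True
      then have "t j \<in> B j" using B[OF True] by (auto simp: t_def)
      then have "conn (B j \<union> f (t j))" using B[OF True] f(1)[OF t[OF j]] tf by (intro conn_Un) auto
      then show ?thesis using Bt[OF j] True by simp
    next
      case False
      then show ?thesis using Bt[OF j] f(1)[OF t[OF j]] by simp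
    qed
    show "B' j \<subseteq> Y" using Bt[OF j] B[of j] f(1)[OF t[OF j]] Y(1) unfolding M_def by (auto split: if_splits)
    show "B' j \<inter> bd V Y = {(g \<circ> t) j}"
    proof -
      have "x \<in> f (t j)" if x: "x \<in> B j" "x \<in> bd V Y" "j < i" for x
      proof -
        have "x \<in> bd V X" using x B[OF x(3)] Y(1) unfolding bd_def by blast
        then have "x = \<tau> j" using x B[OF x(3)] by blast
        then show ?thesis using tf x(3) by (simp add: t_def)
      qed
      then show ?thesis using Bt[OF j] fY[OF t[OF j]] by (auto split: if_splits)
    qed
    show "B' j \<inter> B' k = {}" if k: "k < Suc i" "j \<noteq> k" for k
    proof -
      have "f (t j) \<inter> f (t k) = {}"
        using f(2)[OF t[OF j] t[OF k(1)]] tinj j k unfolding inj_on_def by blast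
      then show ?thesis
        using Bt[OF j] Bt[OF k(1)] fB[OF j, of k] fB[OF k(1), of j] Bd[of j k] k(2) by (auto split: if_splits)
    qed
    show "touch (B' ((j - 1) div 3)) (B' j)" if j0: "0 < j"
    proof -
      have p: "(j - 1) div 3 < j" using j0
        by (meson div_le_dividend diff_less le_less_trans zero_less_one)
      show ?thesis
      proof (cases "j < i")
        case True
        then have "touch (B ((j - 1) div 3)) (B j)" using tok j0 by (auto simp: tree_tokens_def)
        then show ?thesis using True p by (rule_tac touch_mono) (auto simp: B'_def)
      next
        case False
        then have ji: "j = i" using j by simp
        then have "adj (\<tau> ((j - 1) div 3)) u" using u(3) j0 by simp
        moreover have "\<tau> ((j - 1) div 3) \<in> B' ((j - 1) div 3)"
          using B[of "(j - 1) div 3"] p ji by (auto simp: B'_def)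
        moreover have "u \<in> B' j" using tf ji by (auto simp: B'_def t_def)
        ultimately show ?thesis unfolding touch_def by blast
      qed
    qed
  qed
  then show ?thesis using that Y(2) by blast
qed

lemma tokens_exist:
  assumes fin: "finite V" and nl: "\<not> narrow V T w" and "i \<le> w"
  shows "\<exists>X B \<tau>. closed_lay V T w X \<and> tree_tokens V X i B \<tau>"
  using assms(3)
proof (induction i)
  case 0
  obtain X where X: "closed_lay V T w X" "card (bd V X) \<le> 0"
    by (rule closed_lay_extend[OF fin lay_empty[of V T w], of 0]) simp_all
  then have "X \<subseteq> V" using lay_bound[of V T w X] by (simp add: closed_lay_def)
  then have "finite (bd V X)" using fin bd_subset finite_subset by metis
  then have "bd V X = {}" using X by simp
  then show ?case using X by (auto simp: tree_tokens_def)
next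
  case (Suc i)
  then obtain X B \<tau> where "closed_lay V T w X" "tree_tokens V X i B \<tau>" by auto
  then show ?case using tokens_step[OF fin _ _ _ nl, of X i B \<tau>] Suc.prems by (metis Suc_le_lessD)
qed

text \<open>In terms of \<open>2 * j + 3\<close> the passage to the last child
  \<open>3 * j + 3\<close> is multiplication by 3.\<close>

lemma heap_bound: "x \<in> heap h i \<Longrightarrow> i \<le> x \<and> 2 * x + 3 \<le> 3 ^ h * (2 * i + 3)"
proof (induction h arbitrary: i)
  case (Suc h)
  then consider "x = i" | k where "x \<in> heap h k" "k \<in> {3 * i + 1, 3 * i + 2, 3 * i + 3}" by auto
  then show ?case
  proof cases
    case 1
    have "(1::nat) \<le> 3 ^ Suc h" by simp
    then have "1 * (2 * i + 3) \<le> 3 ^ Suc h * (2 * i + 3)" by (rule mult_le_mono1)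
    then show ?thesis using 1 by simp
  next
    case 2
    then have k: "k \<le> x" "2 * x + 3 \<le> 3 ^ h * (2 * k + 3)" using Suc.IH by auto
    have "3 ^ h * (2 * k + 3) \<le> 3 ^ h * (3 * (2 * i + 3))" using 2 by (intro mult_le_mono2) auto
    then have "2 * x + 3 \<le> 3 ^ Suc h * (2 * i + 3)" using k(2) by (simp only: power_Suc mult.assoc mult.left_commute)
    then show ?thesis using k 2 by auto
  qed
qed auto

lemma heap_ancestor: "x \<in> heap h i \<Longrightarrow> \<exists>n. ((\<lambda>j. (j - 1) div 3) ^^ n) x = i"
proof (induction h arbitrary: i)
  case 0
  then have "((\<lambda>j. (j - 1) div 3) ^^ 0) x = i" by simp
  then show ?case by blast
next
  case (Suc h)
  then consider "x = i" | k where "x \<in> heap h k" "(k - 1) div 3 = i" by fastforce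
  then show ?case
  proof cases
    case 1
    then have "((\<lambda>j. (j - 1) div 3) ^^ 0) x = i" by simp
    then show ?thesis by blast
  next
    case 2
    then obtain n where "((\<lambda>j. (j - 1) div 3) ^^ n) x = k" using Suc.IH by blast
    then have "((\<lambda>j. (j - 1) div 3) ^^ Suc n) x = i" using 2 by simp
    then show ?thesis by blast
  qed
qed

text \<open>Both \<open>a\<close> and \<open>b\<close> are ancestors of a common element, so one
  would be a proper ancestor of the other. Proper ancestors are at most the common parent
  \<open>i\<close>, which is smaller than both.\<close>

lemma heap_siblings:
  assumes "(a - 1) div 3 = i" "(b - 1) div 3 = i" "i < a" "i < b" "a \<noteq> b"
  shows "heap h a \<inter> heap h b = {}"
proof -
  let ?p = "\<lambda>j::nat. (j - 1) div 3"
  have p: "?p j \<le> j" for j by (meson diff_le_self div_le_dividend le_trans)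
  have le: "(?p ^^ n) j \<le> j" for n j
  proof (induction n)
    case (Suc n)
    then show ?case using p[of "(?p ^^ n) j"] by simp
  qed simp
  have aux: False if "(?p ^^ m) x = a" "(?p ^^ (m + d)) x = b" "?p a = i" "?p b = i" "i < a" "i < b" "a \<noteq> b" for m d x a b
  proof (cases d)
    case 0
    then show ?thesis using that by simp
  next
    case (Suc e)
    have "b = (?p ^^ d) a" using that by (metis add.commute comp_apply funpow_add)
    also have "\<dots> = (?p ^^ e) i" by (simp only: Suc funpow_Suc_right comp_apply that(3))
    also have "\<dots> \<le> i" by (rule le)
    finally show ?thesis using that by simp
  qed
  show ?thesis
  proof (rule ccontr)
    assume "heap h a \<inter> heap h b \<noteq> {}"
    then obtain x where "x \<in> heap h a" "x \<in> heap h b" by blast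
    then obtain m n where mn: "(?p ^^ m) x = a" "(?p ^^ n) x = b" using heap_ancestor by meson
    show False
    proof (cases "m \<le> n")
      case True
      then show ?thesis using aux[of m x a "n - m" b] mn assms by simp
    next
      case False
      then show ?thesis using aux[of n x b "m - n" a] mn assms by simp
    qed
  qed
qed

lemma rk_heap:
  assumes B: "\<And>j. j < n \<Longrightarrow> conn (B j) \<and> B j \<inter> T \<noteq> {}"
    and d: "\<And>j k. j < n \<Longrightarrow> k < n \<Longrightarrow> j \<noteq> k \<Longrightarrow> B j \<inter> B k = {}"
    and t: "\<And>j. j < n \<Longrightarrow> 0 < j \<Longrightarrow> touch (B ((j - 1) div 3)) (B j)"
    and h: "\<And>x. x \<in> heap h i \<Longrightarrow> x < n"
  shows "rk T h (\<Union>j\<in>heap h i. B j)"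
  using h
proof (induction h arbitrary: i)
  case 0
  then show ?case using B by simp
next
  case (Suc h)
  let ?A = "\<lambda>k. \<Union>j\<in>heap h k. B j"
  have self: "k \<in> heap h k" for k by (cases h) auto
  have kid: "rk T h (?A k) \<and> touch (B i) (?A k) \<and> B i \<inter> ?A k = {}"
    if k: "k \<in> {3 * i + 1, 3 * i + 2, 3 * i + 3}" for k
  proof (intro conjI)
    have sub: "heap h k \<subseteq> heap (Suc h) i" using k by auto
    then show "rk T h (?A k)" using Suc by blast
    have kn: "k < n" using Suc.prems sub self by blast
    have p: "(k - 1) div 3 = i" "0 < k" using k by auto
    then have "touch (B i) (B k)" using t[OF kn] by simp
    then show "touch (B i) (?A k)" by (rule touch_mono) (use self in auto)
    have "i < n" using Suc.prems by simp
    moreover have "i < x" if "x \<in> heap h k" for x using heap_bound[OF that] k by auto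
    ultimately show "B i \<inter> ?A k = {}" using d[of i] Suc.prems sub by blast
  qed
  have sib: "?A k \<inter> ?A l = {}"
    if k: "k \<in> {3 * i + 1, 3 * i + 2, 3 * i + 3}" "l \<in> {3 * i + 1, 3 * i + 2, 3 * i + 3}" "k \<noteq> l" for k l
  proof -
    have "heap h k \<inter> heap h l = {}" using k by (intro heap_siblings[of k i l]) auto
    moreover have "heap h k \<union> heap h l \<subseteq> heap (Suc h) i" using k by auto
    then have "x < n" if "x \<in> heap h k \<union> heap h l" for x using that Suc.prems by blast
    ultimately have "B x \<inter> B y = {}" if "x \<in> heap h k" "y \<in> heap h l" for x y
      using d[of x y] that by blast
    then show ?thesis by blast
  qed
  have "rk T (Suc h) (B i \<union> ?A (3 * i + 1) \<union> ?A (3 * i + 2) \<union> ?A (3 * i + 3))"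
  proof (rule rk_SucI)
    show "conn (B i)" using B Suc.prems by simp
    show "?A (3 * i + 1) \<inter> ?A (3 * i + 2) = {}" "?A (3 * i + 1) \<inter> ?A (3 * i + 3) = {}"
      "?A (3 * i + 2) \<inter> ?A (3 * i + 3) = {}" by (rule sib; simp)+
  qed (use kid in blast)+
  moreover have "B i \<union> ?A (3 * i + 1) \<union> ?A (3 * i + 2) \<union> ?A (3 * i + 3) = (\<Union>j\<in>heap (Suc h) i. B j)"
    by auto
  ultimately show ?case by simp
qed

lemma heap_root_bound: "x \<in> heap h 0 \<Longrightarrow> x < 3 ^ Suc h"
  using heap_bound[of x h 0] by simp

text \<open>\<open>3 ^ Suc h\<close> tokens suffice for a complete ternary tree of depth
  \<open>h\<close>. Disjoint paths from the tokens, outside the interior of \<open>X\<close>, bring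
  a terminal to every branch set. A smaller cut would give another laid set, because the terminals
  between \<open>X\<close> and the cut lie in the cut, and this contradicts closedness.\<close>

lemma rk_if_not_narrow:
  assumes fin: "finite V" and nl: "\<not> narrow V T (3 ^ Suc h)"
  shows "\<exists>X\<subseteq>V. rk T h X"
proof -
  define w :: nat where "w = 3 ^ Suc h"
  obtain X B \<tau> where cl: "closed_lay V T w X" and tok: "tree_tokens V X w B \<tau>"
    using tokens_exist[OF fin nl le_refl, folded w_def] by blast
  have lX: "lay V T w X" using cl by (simp add: closed_lay_def)
  then have XV: "X \<subseteq> V" using lay_bound by blast
  have cX: "card (bd V X) = w" using tok by (auto simp: tree_tokens_def card_image)
  have B: "conn (B j) \<and> B j \<subseteq> X \<and> B j \<inter> bd V X = {\<tau> j}" if "j < w" for j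
    using tok that by (auto simp: tree_tokens_def)
  define M where "M = V - (X - bd V X)"
  have TM: "T \<inter> M \<subseteq> M" by blast
  obtain f where f: "\<And>a. a \<in> bd V X \<Longrightarrow> conn (f a) \<and> f a \<subseteq> M \<and> f a \<inter> bd V X = {a} \<and> f a \<inter> (T \<inter> M) \<noteq> {}"
      "\<And>a b. a \<in> bd V X \<Longrightarrow> b \<in> bd V X \<Longrightarrow> a \<noteq> b \<Longrightarrow> f a \<inter> f b = {}"
  proof (rule linkage_or_cut[OF fin XV subset_refl _ TM M_def])
    show "bd V V \<subseteq> T \<inter> M" by simp
  next
    fix Z D assume Z: "X \<subseteq> Z" "Z \<subseteq> V" "bd V Z \<subseteq> D" "(Z - X) \<inter> (T \<inter> M) \<subseteq> D" "finite D" "card D < card (bd V X)"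
    have c: "card (bd V Z) < w" using card_mono[OF Z(5,3)] Z(6) cX by linarith
    have "T \<inter> (Z - X) \<subseteq> D" using Z(2,4) unfolding M_def by blast
    then have "card (T \<inter> (Z - X)) \<le> card D" by (rule card_mono[OF Z(5)])
    then have "card (T \<inter> (Z - X)) \<le> w" using Z(6) cX by linarith
    then have "lay V T w Z" using lay.lay_step[OF lX Z(1,2)] c by simp
    then have "Z = X" using cl Z(1) c cX unfolding closed_lay_def by simp
    then show thesis using c cX by simp
  qed (rule that; assumption)
  have tau: "\<tau> j \<in> bd V X" if "j < w" for j using tok that by (auto simp: tree_tokens_def)
  have fX: "f a \<inter> X = {a}" if "a \<in> bd V X" for a
    using f(1)[OF that] bd_subset[of V X] that unfolding M_def by blast
  define B' where "B' j = B j \<union> f (\<tau> j)" for j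
  have "rk T h (\<Union>j\<in>heap h 0. B' j)"
  proof (rule rk_heap[where n = w])
    fix j assume j: "j < w"
    have "conn (B' j)" unfolding B'_def
      using B[OF j] f(1)[OF tau[OF j]] by (intro conn_Un) blast+
    then show "conn (B' j) \<and> B' j \<inter> T \<noteq> {}" using f(1)[OF tau[OF j]] unfolding B'_def by blast
    show "touch (B' ((j - 1) div 3)) (B' j)" if "0 < j"
    proof -
      have "touch (B ((j - 1) div 3)) (B j)" using tok j that by (auto simp: tree_tokens_def)
      then show ?thesis by (rule touch_mono) (auto simp: B'_def)
    qed
    fix k assume k: "k < w" "j \<noteq> k"
    have 1: "B j \<inter> B k = {}" using tok j k by (auto simp: tree_tokens_def)
    have "\<tau> j \<noteq> \<tau> k" using tok j k unfolding tree_tokens_def inj_on_def by blast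
    then have "f (\<tau> j) \<inter> f (\<tau> k) = {}" using f(2) tau j k by blast
    moreover have "f (\<tau> a) \<inter> B b = {}" if "a < w" "b < w" "B a \<inter> B b = {}" for a b
    proof -
      have "f (\<tau> a) \<inter> B b \<subseteq> {\<tau> a}" using fX[OF tau[OF that(1)]] B[OF that(2)] by blast
      moreover have "\<tau> a \<in> B a" using B[OF that(1)] by blast
      ultimately show ?thesis using that(3) by blast
    qed
    then have "f (\<tau> j) \<inter> B k = {}" "f (\<tau> k) \<inter> B j = {}" using 1 j k by blast+
    ultimately show "B' j \<inter> B' k = {}" using 1 unfolding B'_def by blast
  next
    fix x assume "x \<in> heap h 0"
    then show "x < w" unfolding w_def by (rule heap_root_bound)
  qed
  moreover have "(\<Union>j\<in>heap h 0. B' j) \<subseteq> V"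
  proof -
    have "B' j \<subseteq> V" if "j < w" for j
      using B[OF that] f(1)[OF tau[OF that]] XV unfolding B'_def M_def by blast
    then show ?thesis using heap_root_bound unfolding w_def by blast
  qed
  ultimately show ?thesis by blast
qed

text \<open>Every vertex is a terminal here, so the branch sets already contain terminals and the
  set found stays inside a laid set. That position makes the greedy placement applicable to trees
  without roots.\<close>

lemma rk_in_lay:
  assumes fin: "finite V" and nl: "\<not> narrow V V (3 ^ Suc h)"
  shows "\<exists>Y X. lay V V (3 ^ Suc h) Y \<and> X \<subseteq> Y \<and> rk V h X"
proof -
  define w :: nat where "w = 3 ^ Suc h"
  obtain X B \<tau> where cl: "closed_lay V V w X" and tok: "tree_tokens V X w B \<tau>"
    using tokens_exist[OF fin nl le_refl, folded w_def] by blast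
  have lX: "lay V V w X" using cl by (simp add: closed_lay_def)
  then have XV: "X \<subseteq> V" using lay_bound by blast
  have B: "conn (B j) \<and> B j \<subseteq> X" if "j < w" for j
    using tok that by (auto simp: tree_tokens_def)
  have "rk V h (\<Union>j\<in>heap h 0. B j)"
  proof (rule rk_heap[where n = w])
    show "conn (B j) \<and> B j \<inter> V \<noteq> {}" if "j < w" for j
      using B[OF that] conn_nonempty[of "B j"] XV by blast
  qed (use tok heap_root_bound w_def in \<open>auto simp: tree_tokens_def\<close>)
  moreover have "(\<Union>j\<in>heap h 0. B j) \<subseteq> X"
    using B heap_root_bound unfolding w_def by blast
  ultimately show ?thesis using lX unfolding w_def by blast
qed

end

subsection \<open>Path covers and routes to atoms\<close>

text \<open>The number of paths covering a thin set of rank \<open>h\<close>: those of the three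
  branches and two for a tripod in the centre.\<close>

primrec segs :: "nat \<Rightarrow> nat" where
  "segs 0 = 1"
| "segs (Suc h) = 3 * segs h + 2"

context sym_graph
begin

definition pcover :: "nat \<Rightarrow> 'a set \<Rightarrow> bool" where
  "pcover n Y \<longleftrightarrow> (\<exists>ps. length ps \<le> n \<and> distinct (concat ps) \<and> set (concat ps) = Y \<and>
     (\<forall>p\<in>set ps. walk (arcs_on UNIV) p))"

lemma pcover_Un:
  assumes "pcover m X" "pcover n Y" "X \<inter> Y = {}"
  shows "pcover (m + n) (X \<union> Y)"
proof -
  obtain ps qs where "length ps \<le> m" "distinct (concat ps)" "set (concat ps) = X"
     "\<forall>p\<in>set ps. walk (arcs_on UNIV) p"
     "length qs \<le> n" "distinct (concat qs)" "set (concat qs) = Y"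
     "\<forall>p\<in>set qs. walk (arcs_on UNIV) p"
    using assms unfolding pcover_def by blast
  then have "length (ps @ qs) \<le> m + n \<and> distinct (concat (ps @ qs)) \<and> set (concat (ps @ qs)) = X \<union> Y \<and>
     (\<forall>p\<in>set (ps @ qs). walk (arcs_on UNIV) p)" using assms(3) by auto
  then show ?thesis unfolding pcover_def by blast
qed

lemma pcover_walk: "walk (arcs_on UNIV) p \<Longrightarrow> distinct p \<Longrightarrow> pcover 1 (set p)"
  unfolding pcover_def by (rule exI[of _ "[p]"]) auto

lemma pcover_Union:
  assumes "finite F" "disjoint F" "\<And>X. X \<in> F \<Longrightarrow> pcover n X"
  shows "pcover (n * card F) (\<Union>F)"
  using assms
proof (induction F rule: finite_induct)
  case empty
  then show ?case unfolding pcover_def by (auto intro!: exI[of _ "[]"])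
next
  case (insert X F)
  have d: "X \<inter> \<Union>F = {}" using insert.prems(1) insert.hyps(2) by (auto simp: disjoint_def)
  have "disjoint F" using insert.prems(1) by (auto simp: disjoint_def)
  then have "pcover (n * card F) (\<Union>F)" using insert by auto
  then have "pcover (n + n * card F) (X \<union> \<Union>F)" using insert.prems(2) d by (intro pcover_Un) auto
  then show ?case using insert.hyps by simp
qed

lemma walk_arcs_UNIV: "walk (arcs_on X) p \<Longrightarrow> walk (arcs_on UNIV) p"
  by (erule walk_mono) (auto simp: arcs_on_def)

text \<open>The branches are thinned first, and the centre is extended through the discarded parts
  until it touches what is left of them. Of the extended centre only a path between the attachments
  of two branches and a path from the third attachment to it are kept.\<close>

lemma rk_thin:
  assumes "rk T h X" "finite X"
  shows "\<exists>Y\<subseteq>X. rk T h Y \<and> pcover (segs h) Y"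
  using assms
proof (induction h arbitrary: X)
  case 0
  then obtain x where x: "x \<in> X" "x \<in> T" by auto
  have "rk T 0 {x}" "pcover (segs 0) {x}" using x pcover_walk[of "[x]"] by auto
  then show ?case using x by blast
next
  case (Suc h)
  from Suc.prems(1) obtain C A1 A2 A3 where sub: "C \<union> A1 \<union> A2 \<union> A3 \<subseteq> X" and C: "conn C"
     and A: "rk T h A1" "rk T h A2" "rk T h A3" and t: "touch C A1" "touch C A2" "touch C A3"
     and d: "C \<inter> A1 = {}" "C \<inter> A2 = {}" "C \<inter> A3 = {}" "A1 \<inter> A2 = {}" "A1 \<inter> A3 = {}" "A2 \<inter> A3 = {}"
    unfolding rk.simps by blast
  have fin: "finite A1" "finite A2" "finite A3" using sub Suc.prems(2) by (meson finite_subset Un_subset_iff)+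
  obtain Y1 where Y1: "Y1 \<subseteq> A1" "rk T h Y1" "pcover (segs h) Y1" using Suc.IH A fin by blast
  obtain Y2 where Y2: "Y2 \<subseteq> A2" "rk T h Y2" "pcover (segs h) Y2" using Suc.IH A fin by blast
  obtain Y3 where Y3: "Y3 \<subseteq> A3" "rk T h Y3" "pcover (segs h) Y3" using Suc.IH A fin by blast
  obtain C1 where C1: "C \<subseteq> C1" "C1 \<subseteq> C \<union> (A1 - Y1)" "conn C1" "touch C1 Y1"
    using conn_extend_to[OF C rk_conn[OF A(1)] Y1(1) conn_nonempty[OF rk_conn[OF Y1(2)]] t(1) d(1) fin(1)] by blast
  have t12: "touch C1 A2" by (rule touch_mono[OF t(2) C1(1) subset_refl])
  have d12: "C1 \<inter> A2 = {}" using C1 d by blast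
  obtain C2 where C2: "C1 \<subseteq> C2" "C2 \<subseteq> C1 \<union> (A2 - Y2)" "conn C2" "touch C2 Y2"
    using conn_extend_to[OF C1(3) rk_conn[OF A(2)] Y2(1) conn_nonempty[OF rk_conn[OF Y2(2)]] t12 d12 fin(2)] by blast
  have t23: "touch C2 A3" by (rule touch_mono[OF t(3) _ subset_refl]) (use C1 C2 in blast)
  have d23: "C2 \<inter> A3 = {}" using C2 C1 d by blast
  obtain C3 where C3: "C2 \<subseteq> C3" "C3 \<subseteq> C2 \<union> (A3 - Y3)" "conn C3" "touch C3 Y3"
    using conn_extend_to[OF C2(3) rk_conn[OF A(3)] Y3(1) conn_nonempty[OF rk_conn[OF Y3(2)]] t23 d23 fin(3)] by blast
  have C3sub: "C3 \<subseteq> C \<union> (A1 - Y1) \<union> (A2 - Y2) \<union> (A3 - Y3)" using C1 C2 C3 by blast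
  have "touch C3 Y1" by (rule touch_mono[OF C1(4) _ subset_refl]) (use C2 C3 in blast)
  moreover have "touch C3 Y2" by (rule touch_mono[OF C2(4) C3(1) subset_refl])
  ultimately obtain x1 x2 x3 where x: "x1 \<in> C3" "x2 \<in> C3" "x3 \<in> C3" "touch {x1} Y1" "touch {x2} Y2" "touch {x3} Y3"
    using C3(4) unfolding touch_def by blast
  obtain p where p: "walk (arcs_on C3) p" "distinct p" "p \<noteq> []" "hd p = x1" "last p = x2" "set p \<subseteq> C3"
    by (rule conn_walk[OF C3(3) x(1,2)])
  obtain q where q: "walk (arcs_on C3) q" "distinct q" "q \<noteq> []" "hd q = x3" "last q = x1" "set q \<subseteq> C3"
    by (rule conn_walk[OF C3(3) x(3,1)])
  have x12: "x1 \<in> set p" "x2 \<in> set p" using p hd_in_set last_in_set by blast+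
  \<comment> \<open>Stopping \<open>q\<close> before its first vertex on \<open>p\<close> keeps the
    two paths disjoint; together they still contain the three attachments.\<close>
  have "\<exists>z\<in>set q. z \<in> set p" using q x12 last_in_set by blast
  then obtain ys z zs where ys: "q = ys @ z # zs" "z \<in> set p" "\<forall>y\<in>set ys. y \<notin> set p"
    using split_list_first_prop[of q "\<lambda>z. z \<in> set p"] by blast
  let ?D = "set p \<union> set ys"
  have wy: "walk (arcs_on C3) ys" "distinct ys" using q ys by (auto simp: walk_append)
  have x3: "x3 \<in> ?D" using q(4) ys by (cases ys) auto
  have cD: "conn ?D"
  proof (cases "ys = []")
    case True
    then show ?thesis using walk_arcs_on_adj p by simp
  next
    case False
    have "(last ys, z) \<in> arcs_on C3" using q(1) ys(1) False by (auto simp: walk_append)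
    then have "touch (set ys) (set p)" using False ys(2) by (auto simp: touch_def arcs_on_def intro: last_in_set)
    then show ?thesis using walk_arcs_on_adj p wy False touch_sym by (intro conn_Un) auto
  qed
  have DC: "?D \<subseteq> C3" using p ys q by auto
  have dY: "?D \<inter> Y1 = {}" "?D \<inter> Y2 = {}" "?D \<inter> Y3 = {}" "Y1 \<inter> Y2 = {}" "Y1 \<inter> Y3 = {}" "Y2 \<inter> Y3 = {}"
    using DC C3sub Y1(1) Y2(1) Y3(1) d by blast+
  have tD: "touch ?D Y1" "touch ?D Y2" "touch ?D Y3"
    using x(4-6) x12 x3 unfolding touch_def by blast+
  have r: "rk T (Suc h) (?D \<union> Y1 \<union> Y2 \<union> Y3)"
    by (rule rk_SucI[OF cD Y1(2) Y2(2) Y3(2) tD dY])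
  have "pcover (1 + 1) ?D"
    using p wy ys by (intro pcover_Un pcover_walk walk_arcs_UNIV) auto
  then have "pcover (1 + 1 + segs h) (?D \<union> Y1)" using Y1(3) dY(1) by (rule pcover_Un)
  then have "pcover (1 + 1 + segs h + segs h) (?D \<union> Y1 \<union> Y2)" using Y2(3)
    by (rule pcover_Un) (use dY in blast)
  then have "pcover (1 + 1 + segs h + segs h + segs h) (?D \<union> Y1 \<union> Y2 \<union> Y3)" using Y3(3)
    by (rule pcover_Un) (use dY in blast)
  then have "pcover (segs (Suc h)) (?D \<union> Y1 \<union> Y2 \<union> Y3)" by (simp add: numeral_3_eq_3 add.assoc)
  moreover have "?D \<union> Y1 \<union> Y2 \<union> Y3 \<subseteq> X" using DC C3sub Y1(1) Y2(1) Y3(1) sub by blast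
  ultimately show ?case using r by blast
qed

lemma walk_prefix_three:
  assumes "3 \<le> card (M \<inter> set p)"
  obtains xs ys where "p = xs @ ys" "card (M \<inter> set xs) = 3"
proof -
  define k where "k = (LEAST k. 3 \<le> card (M \<inter> set (take k p)))"
  have k: "3 \<le> card (M \<inter> set (take k p))"
    unfolding k_def by (rule LeastI[of _ "length p"]) (use assms in simp)
  have "k \<noteq> 0" using k by (intro notI) simp
  then obtain j where j: "k = Suc j" by (cases k) auto
  have lt: "card (M \<inter> set (take j p)) < 3"
    using not_less_Least[of j "\<lambda>k. 3 \<le> card (M \<inter> set (take k p))"] j k_def by simp
  have "card (M \<inter> set (take k p)) \<le> 3"
  proof (cases "j < length p")
    case True
    then have "M \<inter> set (take k p) \<subseteq> insert (p ! j) (M \<inter> set (take j p))"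
      by (auto simp: j take_Suc_conv_app_nth)
    then have "card (M \<inter> set (take k p)) \<le> card (insert (p ! j) (M \<inter> set (take j p)))"
      by (intro card_mono) auto
    also have "\<dots> \<le> Suc (card (M \<inter> set (take j p)))" by (simp add: card_insert_if)
    finally show ?thesis using lt by simp
  next
    case False
    then show ?thesis using lt j by simp
  qed
  then show ?thesis using that[of "take k p" "drop k p"] k by simp
qed

text \<open>A shortest initial segment with three marked vertices is cut off repeatedly, so at most
  two marked vertices are left at the end of the path.\<close>

lemma path_clusters:
  assumes "walk (arcs_on UNIV) p" "distinct p"
  shows "\<exists>\<C>. finite \<C> \<and> disjoint \<C> \<and> (\<forall>C\<in>\<C>. conn C \<and> C \<subseteq> set p \<and> 3 \<le> card (M \<inter> C)) \<and>
    card (M \<inter> set p) \<le> 3 * card \<C> + 2"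
  using assms
proof (induction "length p" arbitrary: p rule: less_induct)
  case less
  show ?case
  proof (cases "3 \<le> card (M \<inter> set p)")
    case False
    then have "finite {} \<and> disjoint {} \<and> (\<forall>C\<in>{}. conn C \<and> C \<subseteq> set p \<and> 3 \<le> card (M \<inter> C)) \<and>
      card (M \<inter> set p) \<le> 3 * card ({} :: 'a set set) + 2" by (simp add: disjoint_def)
    then show ?thesis by blast
  next
    case True
    then obtain xs ys where xy: "p = xs @ ys" "card (M \<inter> set xs) = 3" by (rule walk_prefix_three)
    then have ne: "xs \<noteq> []" by auto
    have "length ys < length p" "walk (arcs_on UNIV) ys" "distinct ys"
      using xy ne less.prems by (auto simp: walk_append)
    then obtain \<C> where C: "finite \<C>" "disjoint \<C>" "\<forall>C\<in>\<C>. conn C \<and> C \<subseteq> set ys \<and> 3 \<le> card (M \<inter> C)"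
      "card (M \<inter> set ys) \<le> 3 * card \<C> + 2" using less.hyps by blast
    have dis: "set xs \<inter> set ys = {}" using less.prems xy by auto
    have nin: "set xs \<notin> \<C>" using C(3) dis ne by (metis inf.absorb_iff1 set_empty)
    have cx: "conn (set xs)" using less.prems xy ne by (intro walk_arcs_on_adj) (auto simp: walk_append)
    have "card (M \<inter> set p) = card (M \<inter> set xs \<union> M \<inter> set ys)" using xy by (simp add: Int_Un_distrib)
    also have "\<dots> = card (M \<inter> set xs) + card (M \<inter> set ys)" using dis by (intro card_Un_disjoint) auto
    finally have "card (M \<inter> set p) \<le> 3 * card (insert (set xs) \<C>) + 2" using C nin xy by simp
    moreover have "disjoint (insert (set xs) \<C>)" using C dis unfolding disjoint_def by blast
    moreover have "\<forall>C\<in>insert (set xs) \<C>. conn C \<and> C \<subseteq> set p \<and> 3 \<le> card (M \<inter> C)"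
      using C(3) xy cx by auto
    ultimately show ?thesis using C(1) by (meson finite_insert)
  qed
qed

lemma cover_clusters:
  assumes "pcover m P" "M \<subseteq> P"
  shows "\<exists>\<C>. finite \<C> \<and> disjoint \<C> \<and> (\<forall>C\<in>\<C>. conn C \<and> C \<subseteq> P \<and> 3 \<le> card (M \<inter> C)) \<and>
    card M \<le> 3 * card \<C> + 2 * m"
proof -
  obtain ps where ps: "length ps \<le> m" "distinct (concat ps)" "set (concat ps) = P"
     "\<forall>p\<in>set ps. walk (arcs_on UNIV) p" using assms unfolding pcover_def by blast
  have "\<exists>\<C>. finite \<C> \<and> disjoint \<C> \<and> (\<forall>C\<in>\<C>. conn C \<and> C \<subseteq> set (concat ps) \<and> 3 \<le> card (M \<inter> C)) \<and>
    card (M \<inter> set (concat ps)) \<le> 3 * card \<C> + 2 * length ps"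
    using ps(2,4)
  proof (induction ps)
    case Nil
    then show ?case by (auto intro!: exI[of _ "{}"] simp: disjoint_def)
  next
    case (Cons p ps)
    then obtain \<C> where C: "finite \<C>" "disjoint \<C>" "\<forall>C\<in>\<C>. conn C \<and> C \<subseteq> set (concat ps) \<and> 3 \<le> card (M \<inter> C)"
      "card (M \<inter> set (concat ps)) \<le> 3 * card \<C> + 2 * length ps" by auto
    obtain \<D> where D: "finite \<D>" "disjoint \<D>" "\<forall>C\<in>\<D>. conn C \<and> C \<subseteq> set p \<and> 3 \<le> card (M \<inter> C)"
      "card (M \<inter> set p) \<le> 3 * card \<D> + 2" using path_clusters[of p M] Cons.prems by auto
    have dis: "set p \<inter> set (concat ps) = {}" using Cons.prems by auto
    have CD: "C \<inter> D = {}" if "C \<in> \<C>" "D \<in> \<D>" for C D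
    proof -
      have "C \<subseteq> set (concat ps)" "D \<subseteq> set p" using that C(3) D(3) by blast+
      then show ?thesis using dis by blast
    qed
    have dd: "disjoint (\<C> \<union> \<D>)"
    proof (rule disjointI)
      fix C D assume "C \<in> \<C> \<union> \<D>" "D \<in> \<C> \<union> \<D>" "C \<noteq> D"
      then show "C \<inter> D = {}" using CD[of C D] CD[of D C] disjointD[OF C(2), of C D] disjointD[OF D(2), of C D]
        by (auto simp: Int_commute)
    qed
    have "\<C> \<inter> \<D> = {}"
    proof (rule ccontr)
      assume "\<C> \<inter> \<D> \<noteq> {}"
      then obtain C where "C \<in> \<C>" "C \<in> \<D>" by blast
      then have "conn C" "C = {}" using C(3) CD[of C C] by auto
      then show False using conn_nonempty by blast
    qed
    then have "card (\<C> \<union> \<D>) = card \<C> + card \<D>" using C D by (intro card_Un_disjoint) auto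
    moreover have "card (M \<inter> set (concat (p # ps))) = card (M \<inter> set p \<union> M \<inter> set (concat ps))"
      by (simp add: Int_Un_distrib)
    moreover have "\<dots> = card (M \<inter> set p) + card (M \<inter> set (concat ps))"
      using dis by (intro card_Un_disjoint) auto
    ultimately have "card (M \<inter> set (concat (p # ps))) \<le> 3 * card (\<C> \<union> \<D>) + 2 * length (p # ps)"
      using C(4) D(4) by simp
    moreover have "\<forall>C\<in>\<C> \<union> \<D>. conn C \<and> C \<subseteq> set (concat (p # ps)) \<and> 3 \<le> card (M \<inter> C)"
      using C(3) D(3) by auto
    ultimately show ?case using dd C(1) D(1) by (meson finite_UnI)
  qed
  then obtain \<C> where C: "finite \<C>" "disjoint \<C>" "\<forall>C\<in>\<C>. conn C \<and> C \<subseteq> set (concat ps) \<and> 3 \<le> card (M \<inter> C)"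
    "card (M \<inter> set (concat ps)) \<le> 3 * card \<C> + 2 * length ps" by blast
  have "M \<inter> set (concat ps) = M" using assms(2) ps by blast
  then have "card M \<le> 3 * card \<C> + 2 * m" using C(4) ps(1) by simp
  then show ?thesis using C ps by metis
qed

section \<open>Packings and routes to their members, the atoms\<close>

definition packing :: "'a set \<Rightarrow> nat \<Rightarrow> 'a set \<Rightarrow> 'a set set \<Rightarrow> bool" where
  "packing T h V \<A> \<longleftrightarrow> finite \<A> \<and> disjoint \<A> \<and> (\<forall>A\<in>\<A>. A \<subseteq> V \<and> rk T h A)"

lemma conn_Union_walk:
  assumes "walk r \<rho>" "\<rho> \<noteq> []" "\<And>X. X \<in> set \<rho> \<Longrightarrow> conn X" "\<And>X Y. (X, Y) \<in> r \<Longrightarrow> touch X Y"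
  shows "conn (\<Union>(set \<rho>))"
  using assms
proof (induction \<rho>)
  case (Cons X \<rho>)
  show ?case
  proof (cases "\<rho> = []")
    case True
    then show ?thesis using Cons.prems by simp
  next
    case False
    then have "conn (\<Union>(set \<rho>))" using Cons by (auto simp: walk_Cons)
    moreover have "touch X (hd \<rho>)" using Cons.prems False by (auto simp: walk_Cons)
    then have "touch X (\<Union>(set \<rho>))" by (rule touch_mono) (use False hd_in_set in blast)+
    ultimately show ?thesis using Cons.prems(3) by (simp, intro conn_Un) auto
  qed
qed auto

text \<open>\<open>D \<rho>\<close> is a route from its only vertex \<open>q \<rho>\<close> in
  \<open>P\<close> to an atom of its own. Grouping the starting vertices in threes along the paths
  covering \<open>P\<close> gives connected clusters, and a cluster together with three of its
  routes is a centre touching three atoms. At most two starting vertices per path are lost.\<close>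

lemma packing_of_routes:
  assumes A: "finite \<A>" "disjoint \<A>" "\<And>A. A \<in> \<A> \<Longrightarrow> A \<subseteq> V \<and> rk T h A \<and> A \<inter> P = {}"
    and P: "P \<subseteq> V" "pcover m P"
    and R: "finite R" "\<And>\<rho>. \<rho> \<in> R \<Longrightarrow> conn (D \<rho>) \<and> D \<rho> \<subseteq> V - \<Union>\<A> \<and> D \<rho> \<inter> P = {q \<rho>} \<and> a \<rho> \<in> \<A> \<and> touch (D \<rho>) (a \<rho>)"
      "\<And>\<rho> \<sigma>. \<rho> \<in> R \<Longrightarrow> \<sigma> \<in> R \<Longrightarrow> \<rho> \<noteq> \<sigma> \<Longrightarrow> D \<rho> \<inter> D \<sigma> = {} \<and> a \<rho> \<noteq> a \<sigma>"
  shows "\<exists>\<B>. packing T (Suc h) V \<B> \<and> card R \<le> 3 * card \<B> + 2 * m"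
proof -
  have Dq: "D \<rho> \<inter> P = {q \<rho>}" and DV: "D \<rho> \<subseteq> V - \<Union>\<A>" and aA: "a \<rho> \<in> \<A>" if "\<rho> \<in> R" for \<rho>
    using R(2)[OF that] by simp_all
  have aV: "a \<rho> \<subseteq> V" if "\<rho> \<in> R" for \<rho> using A(3)[OF aA[OF that]] by simp
  have qD: "q \<rho> \<in> D \<rho>" "q \<rho> \<in> P" if "\<rho> \<in> R" for \<rho> using Dq[OF that] by auto
  have qinj: "inj_on q R" using qD R(3) by (intro inj_onI) (metis disjoint_iff)
  have "q ` R \<subseteq> P" using qD by auto
  from cover_clusters[OF P(2) this] obtain \<C> where C: "finite \<C>" "disjoint \<C>"
    "\<And>C. C \<in> \<C> \<Longrightarrow> conn C \<and> C \<subseteq> P \<and> 3 \<le> card (q ` R \<inter> C)" "card (q ` R) \<le> 3 * card \<C> + 2 * m" by blast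
  define X where "X C = C \<union> \<Union>((\<lambda>\<rho>. D \<rho> \<union> a \<rho>) ` {\<rho> \<in> R. q \<rho> \<in> C})" for C
  have aD: "a \<rho> \<inter> D \<sigma> = {}" if "\<rho> \<in> R" "\<sigma> \<in> R" for \<rho> \<sigma>
    using aA[OF that(1)] DV[OF that(2)] by blast
  have aa: "a \<rho> \<inter> a \<sigma> = {}" if "\<rho> \<in> R" "\<sigma> \<in> R" "\<rho> \<noteq> \<sigma>" for \<rho> \<sigma>
    using disjointD[OF A(2) aA[OF that(1)] aA[OF that(2)]] R(3)[OF that] by simp
  have aP: "a \<rho> \<inter> P = {}" if "\<rho> \<in> R" for \<rho> using A(3)[OF aA[OF that]] by simp
  have Xr: "rk T (Suc h) (X C)" if CC: "C \<in> \<C>" for C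
  proof -
    note c = C(3)[OF CC]
    have "\<exists>S\<subseteq>q ` R \<inter> C. card S = 3" using c by (metis obtain_subset_with_card_n)
    then obtain q1 q2 q3 where q3: "{q1, q2, q3} \<subseteq> q ` R \<inter> C" "q1 \<noteq> q2" "q1 \<noteq> q3" "q2 \<noteq> q3"
      by (metis card_3_iff)
    then have q3R: "q1 \<in> q ` R" "q2 \<in> q ` R" "q3 \<in> q ` R" by auto
    obtain r1 where "r1 \<in> R" "q r1 = q1" using q3R(1) by (metis imageE)
    moreover obtain r2 where "r2 \<in> R" "q r2 = q2" using q3R(2) by (metis imageE)
    moreover obtain r3 where "r3 \<in> R" "q r3 = q3" using q3R(3) by (metis imageE)
    ultimately have r: "r1 \<in> R" "r2 \<in> R" "r3 \<in> R" "q r1 = q1" "q r2 = q2" "q r3 = q3" by auto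
    have rC: "q r1 \<in> C" "q r2 \<in> C" "q r3 \<in> C" using r q3 by auto
    have rne: "r1 \<noteq> r2" "r1 \<noteq> r3" "r2 \<noteq> r3" using r q3 by auto
    note f = R(2)[OF r(1)] R(2)[OF r(2)] R(2)[OF r(3)]
    have qDr: "q r1 \<in> D r1" "q r2 \<in> D r2" "q r3 \<in> D r3" by (rule qD(1), rule r)+
    have "conn (C \<union> \<Union>{D r1, D r2, D r3})"
      by (rule conn_Union_star) (use c f qDr rC in auto)
    then have cc: "conn (C \<union> D r1 \<union> D r2 \<union> D r3)" by (simp add: Un_assoc)
    have "rk T (Suc h) (C \<union> D r1 \<union> D r2 \<union> D r3 \<union> a r1 \<union> a r2 \<union> a r3)"
    proof (rule rk_SucI[OF cc])
      show "rk T h (a r1)" "rk T h (a r2)" "rk T h (a r3)" using A(3) aA r by simp_all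
      show "touch (C \<union> D r1 \<union> D r2 \<union> D r3) (a r1)" "touch (C \<union> D r1 \<union> D r2 \<union> D r3) (a r2)"
        "touch (C \<union> D r1 \<union> D r2 \<union> D r3) (a r3)" using f by (auto simp: touch_Un)
      have "C \<inter> a \<rho> = {}" if "\<rho> \<in> R" for \<rho> using c aP[OF that] by auto
      then have "C \<inter> a r1 = {}" "C \<inter> a r2 = {}" "C \<inter> a r3 = {}" using r by simp_all
      moreover have "(C \<union> D r1 \<union> D r2 \<union> D r3) \<inter> a \<rho> = {}" if "\<rho> \<in> R" "C \<inter> a \<rho> = {}" for \<rho>
        using aD[OF that(1) r(1)] aD[OF that(1) r(2)] aD[OF that(1) r(3)] that(2) by blast
      ultimately show "(C \<union> D r1 \<union> D r2 \<union> D r3) \<inter> a r1 = {}" "(C \<union> D r1 \<union> D r2 \<union> D r3) \<inter> a r2 = {}"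
        "(C \<union> D r1 \<union> D r2 \<union> D r3) \<inter> a r3 = {}"
        using r(1-3) by simp_all
      show "a r1 \<inter> a r2 = {}" "a r1 \<inter> a r3 = {}" "a r2 \<inter> a r3 = {}" using aa r rne by auto
    qed
    then show ?thesis
    proof (rule rk_mono)
      show "C \<union> D r1 \<union> D r2 \<union> D r3 \<union> a r1 \<union> a r2 \<union> a r3 \<subseteq> X C"
        using r rC unfolding X_def by auto
      show "conn (X C)" unfolding X_def
      proof (rule conn_Union_star)
        fix Y assume "Y \<in> (\<lambda>\<rho>. D \<rho> \<union> a \<rho>) ` {\<rho> \<in> R. q \<rho> \<in> C}"
        then obtain \<rho> where \<rho>: "\<rho> \<in> R" "q \<rho> \<in> C" "Y = D \<rho> \<union> a \<rho>" by blast
        have "conn (a \<rho>)" using A(3)[OF aA[OF \<rho>(1)]] by (auto dest: rk_conn)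
        then have "conn Y" using R(2)[OF \<rho>(1)] \<rho>(3) conn_Un by simp
        moreover have "q \<rho> \<in> Y" using qD[OF \<rho>(1)] \<rho>(3) by simp
        ultimately show "conn Y \<and> (Y \<inter> C \<noteq> {} \<or> touch C Y)" using \<rho>(2) by blast
      qed (use c in blast)
    qed
  qed
  have Xd: "X C \<inter> X C' = {}" if CC: "C \<in> \<C>" "C' \<in> \<C>" "C \<noteq> C'" for C C'
  proof -
    have 0: "C \<inter> C' = {}" using CC C(2) unfolding disjoint_def by blast
    have 1: "(D \<rho> \<union> a \<rho>) \<inter> C' = {}" if "\<rho> \<in> R" "q \<rho> \<notin> C'" "C' \<in> \<C>" for \<rho> C'
    proof -
      have "C' \<subseteq> P" using C(3) that by blast
      then have "D \<rho> \<inter> C' \<subseteq> {q \<rho>}" "a \<rho> \<inter> C' = {}" using Dq[OF that(1)] aP[OF that(1)] by blast+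
      then show ?thesis using that(2) by auto
    qed
    have 2: "(D \<rho> \<union> a \<rho>) \<inter> (D \<sigma> \<union> a \<sigma>) = {}" if "\<rho> \<in> R" "\<sigma> \<in> R" "\<rho> \<noteq> \<sigma>" for \<rho> \<sigma>
      using R(3)[OF that] aD[of \<rho> \<sigma>] aD[of \<sigma> \<rho>] aa[OF that] that by blast
    show ?thesis
    proof (rule ccontr)
      assume "X C \<inter> X C' \<noteq> {}"
      then obtain x where x: "x \<in> X C" "x \<in> X C'" by blast
      have a: "x \<in> C \<or> (\<exists>\<rho>\<in>R. q \<rho> \<in> C \<and> x \<in> D \<rho> \<union> a \<rho>)" using x(1) unfolding X_def by auto
      have b: "x \<in> C' \<or> (\<exists>\<rho>\<in>R. q \<rho> \<in> C' \<and> x \<in> D \<rho> \<union> a \<rho>)" using x(2) unfolding X_def by auto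
      show False
      proof (cases "x \<in> C")
        case True
        then obtain \<rho> where "\<rho> \<in> R" "q \<rho> \<in> C'" "x \<in> D \<rho> \<union> a \<rho>" using b 0 by blast
        then show False using 1[of \<rho> C] 0 CC True by blast
      next
        case False
        then obtain \<rho> where \<rho>: "\<rho> \<in> R" "q \<rho> \<in> C" "x \<in> D \<rho> \<union> a \<rho>" using a by blast
        have "x \<notin> C'" using 1[of \<rho> C'] 0 CC \<rho> by blast
        then obtain \<sigma> where \<sigma>: "\<sigma> \<in> R" "q \<sigma> \<in> C'" "x \<in> D \<sigma> \<union> a \<sigma>" using b by blast
        then have "\<rho> \<noteq> \<sigma>" using \<rho> 0 by blast
        then show False using 2[OF \<rho>(1) \<sigma>(1)] \<rho> \<sigma> by blast
      qed
    qed
  qed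
  have Xinj: "inj_on X \<C>"
  proof (rule inj_onI)
    fix C C' assume c: "C \<in> \<C>" "C' \<in> \<C>" "X C = X C'"
    have "X C \<noteq> {}" using rk_conn[OF Xr[OF c(1)]] conn_nonempty by blast
    then show "C = C'" using Xd[OF c(1,2)] c(3) by auto
  qed
  have "X C \<subseteq> V" if "C \<in> \<C>" for C
  proof -
    have "D \<rho> \<union> a \<rho> \<subseteq> V" if "\<rho> \<in> R" for \<rho> using DV[OF that] aV[OF that] by blast
    moreover have "C \<subseteq> V" using C(3)[OF that] P(1) by auto
    ultimately show ?thesis unfolding X_def by auto
  qed
  moreover have "disjoint (X ` \<C>)"
  proof (rule disjointI)
    fix a b assume "a \<in> X ` \<C>" "b \<in> X ` \<C>" "a \<noteq> b"
    then obtain C C' where "C \<in> \<C>" "C' \<in> \<C>" "a = X C" "b = X C'" by (elim imageE)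
    then show "a \<inter> b = {}" using Xd[of C C'] \<open>a \<noteq> b\<close> by auto
  qed
  ultimately have "packing T (Suc h) V (X ` \<C>)"
    unfolding packing_def using C(1) Xr by simp
  moreover have "card R \<le> 3 * card (X ` \<C>) + 2 * m"
    using C(4) card_image[OF Xinj] card_image[OF qinj] by simp
  ultimately show ?thesis by blast
qed

text \<open>Menger's theorem in the graph with every atom contracted to a vertex: disjoint routes
  then end in distinct atoms, and a separator consists of vertices and whole atoms. More than
  \<open>3 * p + 2 * m\<close> routes would produce more than \<open>p\<close> sets of rank
  \<open>h + 1\<close>.\<close>

lemma atom_cut:
  assumes fin: "finite V" and A: "finite \<A>" "disjoint \<A>" "\<And>A. A \<in> \<A> \<Longrightarrow> A \<subseteq> V \<and> rk T h A \<and> A \<inter> P = {}"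
    and P: "P \<subseteq> V" "pcover m P"
    and max: "\<And>\<B>. packing T (Suc h) V \<B> \<Longrightarrow> card \<B> \<le> p"
  obtains Z H where "Z \<subseteq> V - \<Union>\<A>" "H \<subseteq> \<A>" "card Z + card H \<le> 3 * p + 2 * m"
    "\<And>X. conn X \<Longrightarrow> X \<subseteq> V - Z - \<Union>H \<Longrightarrow> X \<inter> P \<noteq> {} \<Longrightarrow> X \<inter> \<Union>\<A> = {}"
proof -
  define N where "N = (\<lambda>v. {v}) ` (V - \<Union>\<A>) \<union> \<A>"
  define r where "r = {(X, Y). X \<in> N \<and> Y \<in> N \<and> touch X Y}"
  have finN: "finite N" using fin A(1) unfolding N_def by simp
  have finr: "finite r" by (rule finite_subset[of _ "N \<times> N"]) (auto simp: r_def finN)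
  let ?A = "(\<lambda>v. {v}) ` P"
  have finP: "finite P" using P(1) fin finite_subset by blast
  have "\<exists>D. finite D \<and> separates r ?A \<A> D \<and> card D \<le> 3 * p + 2 * m"
  proof (rule ccontr)
    assume "\<not> ?thesis"
    then have "\<exists>R. linkage r ?A \<A> R \<and> card R = Suc (3 * p + 2 * m)"
      using finr finP A(1) by (intro menger) (auto simp: not_le Suc_le_eq)
    then obtain R where R: "linkage r ?A \<A> R" "card R = Suc (3 * p + 2 * m)" by blast
    have \<rho>: "walk r \<rho> \<and> \<rho> \<noteq> [] \<and> hd \<rho> \<in> ?A \<and> last \<rho> \<in> \<A> \<and> set (tl \<rho>) \<inter> ?A = {} \<and> set (butlast \<rho>) \<inter> \<A> = {}"
      if "\<rho> \<in> R" for \<rho> using R that by (auto simp: linkage_def)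
    define D where "D \<rho> = \<Union>(set (butlast \<rho>))" for \<rho> :: "'a set list"
    define q where "q \<rho> = the_elem (hd \<rho>)" for \<rho> :: "'a set list"
    have q: "hd \<rho> = {q \<rho>} \<and> q \<rho> \<in> P" if "\<rho> \<in> R" for \<rho> using \<rho>[OF that] unfolding q_def by auto
    have bl: "butlast \<rho> \<noteq> [] \<and> hd (butlast \<rho>) = hd \<rho>" if "\<rho> \<in> R" for \<rho>
    proof -
      have "hd \<rho> \<noteq> last \<rho>" using q[OF that] \<rho>[OF that] A(3) by blast
      then show ?thesis using \<rho>[OF that] by (cases \<rho>) (auto split: if_splits)
    qed
    have sN: "X \<in> (\<lambda>v. {v}) ` (V - \<Union>\<A>)" if "\<rho> \<in> R" "X \<in> set (butlast \<rho>)" for \<rho> X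
    proof -
      have *: "walk r \<rho>' \<Longrightarrow> X \<in> set (butlast \<rho>') \<Longrightarrow> X \<in> N" for \<rho>'
        by (induction \<rho>') (auto simp: walk_Cons r_def split: if_splits)
      show ?thesis using *[of \<rho>] \<rho>[OF that(1)] that(2) unfolding N_def by blast
    qed
    have "\<exists>\<B>. packing T (Suc h) V \<B> \<and> card R \<le> 3 * card \<B> + 2 * m"
    proof (rule packing_of_routes[OF A P, where D = D and q = q and a = last])
      show "finite R" using R by (simp add: linkage_def)
      fix \<rho> assume r: "\<rho> \<in> R"
      have w: "walk r (butlast \<rho> @ [last \<rho>])" using \<rho>[OF r] by simp
      have "conn (D \<rho>)" unfolding D_def
      proof (rule conn_Union_walk)
        show "walk r (butlast \<rho>)" using w by (simp only: walk_append)
        show "butlast \<rho> \<noteq> []" using bl[OF r] by simp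
        show "conn X" if X: "X \<in> set (butlast \<rho>)" for X
        proof -
          obtain v where "X = {v}" using sN[OF r X] by blast
          then show ?thesis by simp
        qed
        show "\<And>X Y. (X, Y) \<in> r \<Longrightarrow> touch X Y" by (simp add: r_def)
      qed
      moreover have "D \<rho> \<subseteq> V - \<Union>\<A>" using sN[OF r] unfolding D_def by blast
      moreover have "D \<rho> \<inter> P = {q \<rho>}"
      proof -
        have "hd \<rho> \<in> set (butlast \<rho>)" using bl[OF r] by (metis hd_in_set)
        then have 1: "q \<rho> \<in> D \<rho> \<inter> P" using q[OF r] unfolding D_def by auto
        have "v = q \<rho>" if v: "v \<in> D \<rho> \<inter> P" for v
        proof -
          obtain X where X: "X \<in> set (butlast \<rho>)" "v \<in> X" using v unfolding D_def by blast
          then have "X = {v}" using sN[OF r X(1)] by auto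
          then have "X \<in> ?A" "X \<in> set \<rho>" using v X by (auto dest: in_set_butlastD)
          then have "X = hd \<rho>" using \<rho>[OF r] by (cases \<rho>) auto
          then show ?thesis using q[OF r] \<open>X = {v}\<close> by simp
        qed
        then show ?thesis using 1 by blast
      qed
      moreover have "touch (D \<rho>) (last \<rho>)"
      proof -
        have "(last (butlast \<rho>), last \<rho>) \<in> r" using w bl[OF r] by (simp add: walk_append)
        then have "touch (last (butlast \<rho>)) (last \<rho>)" by (simp add: r_def)
        then show ?thesis unfolding D_def
          by (rule touch_mono) (use bl[OF r] last_in_set[of "butlast \<rho>"] in blast)+
      qed
      ultimately show "conn (D \<rho>) \<and> D \<rho> \<subseteq> V - \<Union>\<A> \<and> D \<rho> \<inter> P = {q \<rho>} \<and> last \<rho> \<in> \<A> \<and> touch (D \<rho>) (last \<rho>)"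
        using \<rho>[OF r] by blast
      fix \<sigma> assume s: "\<sigma> \<in> R" "\<rho> \<noteq> \<sigma>"
      then have dis: "set \<rho> \<inter> set \<sigma> = {}" using R(1) r unfolding linkage_def by blast
      have "last \<rho> \<noteq> last \<sigma>" using dis \<rho>[OF r] \<rho>[OF s(1)] by (metis disjoint_iff last_in_set)
      moreover have "D \<rho> \<inter> D \<sigma> = {}"
      proof (rule ccontr)
        assume "D \<rho> \<inter> D \<sigma> \<noteq> {}"
        then obtain v X Y where v: "v \<in> X" "v \<in> Y" "X \<in> set (butlast \<rho>)" "Y \<in> set (butlast \<sigma>)" unfolding D_def by blast
        then have "X = Y" using sN[OF r v(3)] sN[OF s(1) v(4)] by auto
        then show False using dis v by (auto dest!: in_set_butlastD)
      qed
      ultimately show "D \<rho> \<inter> D \<sigma> = {} \<and> last \<rho> \<noteq> last \<sigma>" by blast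
    qed
    then obtain \<B> where "packing T (Suc h) V \<B>" "card R \<le> 3 * card \<B> + 2 * m" by blast
    then show False using max[of \<B>] R(2) by simp
  qed
  then obtain D where D: "finite D" "separates r ?A \<A> D" "card D \<le> 3 * p + 2 * m" by blast
  define Z where "Z = {v \<in> V - \<Union>\<A>. {v} \<in> D}"
  define H where "H = \<A> \<inter> D"
  have finZ: "finite Z" using fin unfolding Z_def by simp
  have "card Z + card H = card ((\<lambda>v. {v}) ` Z) + card H" by (simp add: card_image)
  also have "\<dots> = card ((\<lambda>v. {v}) ` Z \<union> H)"
    using finZ A(1) by (intro card_Un_disjoint[symmetric]) (auto simp: Z_def H_def)
  also have "\<dots> \<le> card D" using D(1) by (intro card_mono) (auto simp: Z_def H_def)
  finally have c: "card Z + card H \<le> 3 * p + 2 * m" using D(3) by simp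
  have "X \<inter> \<Union>\<A> = {}" if X: "conn X" "X \<subseteq> V - Z - \<Union>H" "X \<inter> P \<noteq> {}" for X
  proof (rule ccontr)
    assume "X \<inter> \<Union>\<A> \<noteq> {}"
    then obtain y where y: "y \<in> X" "y \<in> \<Union>\<A>" by blast
    obtain x where x: "x \<in> X" "x \<in> P" using X by blast
    obtain p where p: "walk (arcs_on X) p" "p \<noteq> []" "hd p = x" "last p = y" "set p \<subseteq> X"
      by (rule conn_walk[OF X(1) x(1) y(1)])
    \<comment> \<open>Maps a vertex to its image under the contraction. Consecutive vertices in one
      atom are harmless: the atom then touches itself, so \<open>r\<close> contains the
      loop.\<close>
    define b where "b v = (if v \<in> \<Union>\<A> then SOME A. A \<in> \<A> \<and> v \<in> A else {v})" for v
    have bA: "b v \<in> \<A> \<and> v \<in> b v" if "v \<in> \<Union>\<A>" for v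
      using that someI_ex[of "\<lambda>A. A \<in> \<A> \<and> v \<in> A"] unfolding b_def by auto
    have b: "v \<in> b v \<and> b v \<in> N \<and> b v \<notin> D" if "v \<in> X" for v
    proof (cases "v \<in> \<Union>\<A>")
      case True
      then show ?thesis using bA[OF True] X(2) that unfolding N_def H_def by blast
    next
      case False
      then show ?thesis using X(2) that unfolding N_def Z_def b_def by auto
    qed
    have "walk (arcs_on X) p \<Longrightarrow> walk r (map b p)"
    proof (induction p)
      case (Cons v p)
      then show ?case using b by (cases p) (auto simp: arcs_on_def r_def touch_def)
    qed simp
    moreover have "hd (map b p) \<in> ?A"
    proof -
      have "x \<notin> \<Union>\<A>" using x A(3) by (metis UnionE disjoint_iff)
      then show ?thesis using p x by (simp add: hd_map b_def)
    qed
    moreover have "last (map b p) \<in> \<A>" using p bA[OF y(2)] by (simp add: last_map)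
    ultimately have "set (map b p) \<inter> D \<noteq> {}" using D(2) p unfolding separates_def by blast
    then show False using b p(5) by auto
  qed
  then show ?thesis using that[of Z H] c unfolding Z_def H_def by blast
qed

end

subsection \<open>Chains of parts\<close>

context sym_graph
begin

lemma conn_crosses:
  assumes "conn Y" "Y \<subseteq> V" "Y \<inter> X \<noteq> {}" "\<not> Y \<subseteq> X"
  shows "Y \<inter> bd V X \<noteq> {}"
proof (rule ccontr)
  assume "\<not> ?thesis"
  then have "Y \<subseteq> X"
    using assms(2) by (intro conn_subset_closed[OF assms(1,3)]) (auto simp: bd_def)
  then show False using assms(4) by blast
qed

text \<open>Otherwise, let \<open>Y\<close> be the first laid set containing a part and
  \<open>X\<close> its predecessor. Every part meets \<open>Y\<close> and none lies in
  \<open>X\<close>, so each contains a vertex of \<open>bd V X\<close>, of \<open>bd V Y\<close> or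
  of \<open>T \<inter> (Y - X)\<close>. These are at most \<open>3 * w\<close> vertices for more
  than \<open>3 * w\<close> disjoint parts.\<close>

lemma separated_pair:
  assumes fin: "finite V" "finite J" and V: "V = (\<Union>i\<in>J. P i)"
    and d: "\<And>i j. i \<in> J \<Longrightarrow> j \<in> J \<Longrightarrow> i \<noteq> j \<Longrightarrow> P i \<inter> P j = {}"
    and c: "\<And>i. i \<in> J \<Longrightarrow> conn (P i) \<and> P i \<inter> T \<noteq> {}"
    and nar: "narrow V T w" and big: "3 * w < card J"
  obtains i j X where "i \<in> J" "j \<in> J" "i \<noteq> j" "X \<subseteq> V" "card (bd V X) \<le> w" "P i \<subseteq> X" "P j \<inter> X = {}"
proof (rule ccontr)
  note witness = that
  assume nt: "\<not> thesis"
  have no: "P j \<inter> X \<noteq> {}"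
    if "i \<in> J" "j \<in> J" "i \<noteq> j" "X \<subseteq> V" "card (bd V X) \<le> w" "P i \<subseteq> X" for i j X
    using witness[OF that(1-6)] nt by blast
  have ne: "P i \<noteq> {}" if "i \<in> J" for i using c[OF that] by blast
  have PV: "P i \<subseteq> V" if "i \<in> J" for i using that V by blast
  have "\<forall>i\<in>J. \<not> P i \<subseteq> X" if "lay V T w X" for X using that
  proof (induction rule: lay.induct)
    case lay_empty
    then show ?case using ne by blast
  next
    case (lay_step X Y)
    show ?case
    proof (rule ccontr)
      assume "\<not> (\<forall>i\<in>J. \<not> P i \<subseteq> Y)"
      then obtain i where i: "i \<in> J" "P i \<subseteq> Y" by blast
      have meets: "P j \<inter> Y \<noteq> {}" if "j \<in> J" for j
        using no[OF i(1) that _ lay_step.hyps(3,4) i(2)] i ne[OF i(1)] by (cases "i = j") auto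
      let ?S = "bd V X \<union> bd V Y \<union> (T \<inter> (Y - X))"
      have "\<exists>x. x \<in> P j \<inter> ?S" if j: "j \<in> J" for j
      proof (cases "P j \<inter> X = {}")
        case False
        then have "P j \<inter> bd V X \<noteq> {}" using lay_step.IH j c PV by (intro conn_crosses) auto
        then show ?thesis by blast
      next
        case True
        show ?thesis
        proof (cases "P j \<subseteq> Y")
          case True
          then show ?thesis using c[OF j] \<open>P j \<inter> X = {}\<close> by blast
        next
          case False
          then have "P j \<inter> bd V Y \<noteq> {}" using meets[OF j] c[OF j] PV[OF j] by (intro conn_crosses) auto
          then show ?thesis by blast
        qed
      qed
      then obtain f where f: "\<And>j. j \<in> J \<Longrightarrow> f j \<in> P j \<inter> ?S" by metis
      have fS: "finite ?S"
        using fin(1) lay_step.hyps by (meson bd_subset finite_Diff finite_Int finite_Un finite_subset)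
      have "inj_on f J" using f d by (intro inj_onI) (metis IntD1 disjoint_iff)
      then have "card J \<le> card ?S" using f fS by (intro card_inj_on_le[of f]) auto
      also have "\<dots> \<le> card (bd V X) + card (bd V Y) + card (T \<inter> (Y - X))"
        by (meson add_le_mono card_Un_le le_refl le_trans)
      also have "\<dots> \<le> 3 * w" using lay_step.hyps lay_bound[OF lay_step.hyps(1)] by linarith
      finally show False using big by simp
    qed
  qed
  moreover have "J \<noteq> {}" using big by auto
  ultimately show False using nar PV unfolding narrow_def by blast
qed

text \<open>If the pair comes in the wrong order, the complement of \<open>X\<close> with the
  boundary of \<open>X\<close> added takes its place. The far part may then meet it in boundary
  vertices, which is why \<open>D\<close> appears instead of disjointness.\<close>

lemma separated_ordered_pair:
  fixes P :: "nat \<Rightarrow> 'a set"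
  assumes fin: "finite V" "finite J" and V: "V = (\<Union>i\<in>J. P i)"
    and d: "\<And>i j. i \<in> J \<Longrightarrow> j \<in> J \<Longrightarrow> i \<noteq> j \<Longrightarrow> P i \<inter> P j = {}"
    and c: "\<And>i. i \<in> J \<Longrightarrow> conn (P i) \<and> P i \<inter> T \<noteq> {}"
    and nar: "narrow V T w" and big: "3 * w < card J"
  obtains i j B D where "i \<in> J" "j \<in> J" "i < j" "B \<subseteq> V" "D \<subseteq> B" "card D \<le> w" "bd V B \<subseteq> D"
    "P i \<subseteq> B" "P j \<inter> B \<subseteq> D"
proof -
  obtain i j X where X: "i \<in> J" "j \<in> J" "i \<noteq> j" "X \<subseteq> V" "card (bd V X) \<le> w" "P i \<subseteq> X" "P j \<inter> X = {}"
    by (rule separated_pair[OF assms])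
  show ?thesis
  proof (cases "i < j")
    case True
    show ?thesis by (rule that[OF X(1,2) True X(4) bd_subset X(5) subset_refl X(6)]) (use X in blast)
  next
    case False
    let ?B = "(V - X) \<union> bd V X"
    have B: "?B \<subseteq> V" using X(4) bd_subset by fastforce
    have D: "bd V X \<subseteq> ?B" by blast
    have b: "bd V ?B \<subseteq> bd V X"
    proof
      fix v assume v: "v \<in> bd V ?B"
      show "v \<in> bd V X"
      proof (rule ccontr)
        assume nv: "v \<notin> bd V X"
        obtain u where u: "u \<in> V" "u \<notin> ?B" "adj v u" and vB: "v \<in> ?B" using v by (auto simp: bd_def)
        have "v \<in> V - X" "u \<in> X" using u vB nv by auto
        then have "u \<in> bd V X" using u adj_sym by (auto simp: bd_def)
        then show False using u by blast
      qed
    qed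
    have Pj: "P j \<subseteq> ?B" using X(2,7) V by blast
    have Pi: "P i \<inter> ?B \<subseteq> bd V X" using X(6) by blast
    show ?thesis by (rule that[OF X(2,1) _ B D X(5) b Pj Pi]) (use False X(3) in simp)
  qed
qed

end

text \<open>Parts in a row, or in a ring when the first touches the last.
  \<open>4 * (3 * w + 1)\<close> is the number of parts that one step of the layout in
  \<open>chain_narrow\<close> may involve.\<close>

locale part_chain = sym_graph adj for adj :: "'a \<Rightarrow> 'a \<Rightarrow> bool" +
  fixes P :: "nat \<Rightarrow> 'a set" and n :: nat and T :: "'a set" and w :: nat
  assumes fin: "\<And>i. i < n \<Longrightarrow> finite (P i)"
    and disj: "\<And>i j. i < n \<Longrightarrow> j < n \<Longrightarrow> i \<noteq> j \<Longrightarrow> P i \<inter> P j = {}"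
    and part: "\<And>i. i < n \<Longrightarrow> conn (P i) \<and> P i \<inter> T \<noteq> {}"
    and nbr: "\<And>i j. i < n \<Longrightarrow> j < n \<Longrightarrow> i \<noteq> j \<Longrightarrow> touch (P i) (P j) \<Longrightarrow>
      i = Suc j \<or> j = Suc i \<or> {i, j} = {0, n - 1}"
    and nar: "\<And>J. J \<subseteq> {..<n} \<Longrightarrow> card J \<le> 4 * (3 * w + 1) \<Longrightarrow> narrow (\<Union>i\<in>J. P i) T w"
begin

definition U :: "nat set \<Rightarrow> 'a set" where
  "U J = (\<Union>i\<in>J. P i)"

lemma U_mono: "I \<subseteq> J \<Longrightarrow> U I \<subseteq> U J"
  by (auto simp: U_def)

lemma U_diff: "U I - U J \<subseteq> U (I - J)"
  by (auto simp: U_def)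

lemma finite_U: "J \<subseteq> {..<n} \<Longrightarrow> finite (U J)"
  unfolding U_def using fin finite_subset[of J "{..<n}"] by auto

text \<open>A window of \<open>3 * w + 1\<close> parts is large enough to contain a separated pair
  \<open>i < j\<close>. The cut runs between these two parts, so apart from \<open>D\<close> the
  only way out of \<open>X\<close> is the closing link of a ring.\<close>

lemma half_cut:
  assumes b: "b = a + (3 * w + 1)" "b \<le> n"
  obtains X D where "U {..<a} \<subseteq> X" "X \<subseteq> U {..<b}" "P 0 \<subseteq> X" "D \<subseteq> X" "card D \<le> w"
    "\<And>v u q. v \<in> X - D \<Longrightarrow> u \<in> P q \<Longrightarrow> q < n \<Longrightarrow> adj v u \<Longrightarrow> u \<in> X \<or> (v \<in> P 0 \<and> q = n - 1)"
proof -
  let ?J = "{a..<b}"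
  let ?V = "U ?J"
  have Jn: "?J \<subseteq> {..<n}" using b by auto
  have nV: "narrow ?V T w" unfolding U_def by (rule nar[OF Jn]) (use b in simp)
  have dJ: "P i \<inter> P j = {}" if "i \<in> ?J" "j \<in> ?J" "i \<noteq> j" for i j
    using disj[of i j] that b(2) by simp
  have cJ: "conn (P i) \<and> P i \<inter> T \<noteq> {}" if "i \<in> ?J" for i using part that Jn by auto
  obtain i j B D where s: "i \<in> ?J" "j \<in> ?J" "i < j" "B \<subseteq> ?V" "D \<subseteq> B" "card D \<le> w" "bd ?V B \<subseteq> D"
    "P i \<subseteq> B" "P j \<inter> B \<subseteq> D"
    by (rule separated_ordered_pair[OF finite_U[OF Jn] _ U_def dJ cJ nV]) (use b in simp_all)
  \<comment> \<open>Neighbours in part \<open>j\<close> of a vertex from \<open>B - D\<close> belong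
    to \<open>B\<close> and hence to \<open>D\<close>, so adding all of \<open>D\<close> closes
    \<open>X\<close> at this end.\<close>
  define X where "X = U {..i} \<union> (B \<inter> U {i<..<j}) \<union> D"
  have inB: "u \<in> B" if "v \<in> B" "v \<notin> D" "u \<in> P q" "q \<in> ?J" "adj v u" for u v q
  proof (rule ccontr)
    assume "u \<notin> B"
    then have "v \<in> bd ?V B" using that unfolding bd_def U_def by blast
    then show False using s(7) that by blast
  qed
  have X1: "P q \<subseteq> X" if "q \<le> i" for q using that unfolding X_def U_def by auto
  have X2: "u \<in> X" if "u \<in> B" "u \<in> P q" "i \<le> q" "q \<le> j" for u q
  proof -
    consider "q = i" | "i < q" "q < j" | "q = j" using \<open>i \<le> q\<close> \<open>q \<le> j\<close> by linarith
    then show ?thesis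
    proof cases
      case 1
      then show ?thesis using X1 that by blast
    next
      case 2
      then show ?thesis using that unfolding X_def U_def by auto
    next
      case 3
      then show ?thesis using that s(9) unfolding X_def by blast
    qed
  qed
  have "u \<in> X \<or> (v \<in> P 0 \<and> q = n - 1)" if v: "v \<in> X - D" "u \<in> P q" "q < n" "adj v u" for v u q
  proof -
    have "\<exists>p. p < j \<and> v \<in> P p \<and> (p \<le> i \<or> i < p \<and> v \<in> B)"
    proof (cases "v \<in> U {..i}")
      case True
      then obtain p where "p \<le> i" "v \<in> P p" unfolding U_def by blast
      moreover from this have "p < j" using s(3) by simp
      ultimately show ?thesis by blast
    next
      case False
      then have "v \<in> B" "v \<in> U {i<..<j}" using v(1) unfolding X_def by auto
      then show ?thesis unfolding U_def by auto
    qed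
    then obtain p where p: "p < j" "v \<in> P p" "p \<le> i \<or> i < p \<and> v \<in> B" by blast
    have pn: "p < n" using p(1) s(2) b(2) by simp
    have "touch (P p) (P q)" using p v unfolding touch_def by blast
    then have pq: "p = q \<or> p = Suc q \<or> q = Suc p \<or> {p, q} = {0, n - 1}" using nbr[OF pn v(3)] by (cases "p = q") simp_all
    show ?thesis
    proof (cases "p \<le> i")
      case True
      show ?thesis
      proof (cases "q \<le> i")
        case True
        then show ?thesis using X1 v by blast
      next
        case False
        consider "p = i" "q = Suc i" | "p = 0" "q = n - 1"
          using pq \<open>p \<le> i\<close> False by (auto simp: doubleton_eq_iff)
        then show ?thesis
        proof cases
          case 1
          then have "v \<in> B" "q \<in> ?J" "q \<le> j" using p s by auto
          then have "u \<in> B" using inB[of v u q] v by auto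
          then show ?thesis using X2[of u q] v 1 \<open>q \<le> j\<close> by auto
        next
          case 2
          then show ?thesis using p by auto
        qed
      qed
    next
      case False
      then have vB: "v \<in> B" "i < p" using p by auto
      consider "i \<le> q" "q \<le> j" | "q = 0" using pq vB(2) p(1) by (auto simp: doubleton_eq_iff)
      then show ?thesis
      proof cases
        case 1
        then have "q \<in> ?J" using s by auto
        then have "u \<in> B" using inB[of v u q] v vB by auto
        then show ?thesis using X2[of u q] v 1 by auto
      next
        case 2
        then show ?thesis using X1[of 0] v by auto
      qed
    qed
  qed
  moreover have "U {..<a} \<subseteq> X"
  proof -
    have "P q \<subseteq> X" if "q < a" for q using X1[of q] that s(1) by simp
    then show ?thesis unfolding U_def by blast
  qed
  moreover have "X \<subseteq> U {..<b}"
  proof -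
    have "U {..i} \<subseteq> U {..<b}" "U {i<..<j} \<subseteq> U {..<b}" "?V \<subseteq> U {..<b}" using s(1,2) by (intro U_mono; auto)+
    then show ?thesis using s(4,5) unfolding X_def by blast
  qed
  moreover have "P 0 \<subseteq> X" using X1[of 0] by simp
  moreover have "D \<subseteq> X" unfolding X_def by blast
  ultimately show ?thesis using that s(6) by blast
qed

abbreviation K :: "'a set" where
  "K \<equiv> U {..<n}"

text \<open>The parts among the first or the last \<open>k (3 w + 1)\<close> ones: folding the chain in the middle treats
  paths and cycles of parts alike.\<close>

definition L :: "nat \<Rightarrow> nat set" where
  "L k = {j. j < n \<and> (j < k * (3 * w + 1) \<or> n \<le> j + k * (3 * w + 1))}"

lemma L_subset: "L k \<subseteq> {..<n}"
  by (auto simp: L_def)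

lemma part_chain_rev: "part_chain adj (\<lambda>i. P (n - 1 - i)) n T w"
proof unfold_locales
  fix i j assume ij: "i < n" "j < n" "i \<noteq> j"
  show "P (n - 1 - i) \<inter> P (n - 1 - j) = {}" using ij by (intro disj) auto
  assume t: "touch (P (n - 1 - i)) (P (n - 1 - j))"
  have "n - 1 - i = Suc (n - 1 - j) \<or> n - 1 - j = Suc (n - 1 - i) \<or> {n - 1 - i, n - 1 - j} = {0, n - 1}"
    using ij by (intro nbr[OF _ _ _ t]) auto
  then show "i = Suc j \<or> j = Suc i \<or> {i, j} = {0, n - 1}"
    using ij by (auto simp: doubleton_eq_iff)
next
  fix J assume J: "J \<subseteq> {..<n}" "card J \<le> 4 * (3 * w + 1)"
  have "card ((\<lambda>i. n - 1 - i) ` J) \<le> card J" using J finite_subset[of J "{..<n}"] by (intro card_image_le) auto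
  then have "narrow (\<Union>i\<in>(\<lambda>i. n - 1 - i) ` J. P i) T w" using J by (intro nar) auto
  then show "narrow (\<Union>i\<in>J. P (n - 1 - i)) T w" by simp
qed (use fin part in auto)

text \<open>Cutting from both ends disposes of the closing link of a ring: \<open>X\<close> contains
  the first part and \<open>X'\<close> the last, so the link stays inside the union. If the two end
  segments overlap, they cover the chain, and all of \<open>K\<close> with its empty boundary is
  taken.\<close>

lemma middle_cut: "\<exists>X. U (L (k - 1)) \<subseteq> X \<and> X \<subseteq> U (L k) \<and> card (bd K X) \<le> 2 * w"
proof -
  let ?m = "3 * w + 1"
  consider "k = 0" | "n < 2 * (k * ?m)" | "0 < k" "2 * (k * ?m) \<le> n" by linarith
  then show ?thesis
  proof cases
    case 1
    then have "U (L (k - 1)) \<subseteq> {} \<and> {} \<subseteq> U (L k) \<and> card (bd K {}) \<le> 2 * w" by (auto simp: L_def U_def)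
    then show ?thesis by blast
  next
    case 2
    have "L k = {..<n}" using 2 unfolding L_def by auto
    then have "U (L (k - 1)) \<subseteq> K \<and> K \<subseteq> U (L k) \<and> card (bd K K) \<le> 2 * w"
      using U_mono[OF L_subset] by simp
    then show ?thesis by blast
  next
    case 3
    let ?a = "(k - 1) * ?m" and ?b = "k * ?m"
    have ab: "?b = ?a + ?m" using 3(1) by (cases k) auto
    have bn: "?b \<le> n" "0 < n" using 3 by auto
    obtain X D where X: "U {..<?a} \<subseteq> X" "X \<subseteq> U {..<?b}" "P 0 \<subseteq> X" "D \<subseteq> X" "card D \<le> w"
      "\<And>v u q. v \<in> X - D \<Longrightarrow> u \<in> P q \<Longrightarrow> q < n \<Longrightarrow> adj v u \<Longrightarrow> u \<in> X \<or> (v \<in> P 0 \<and> q = n - 1)"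
      by (rule half_cut[OF ab bn(1)]) (rule that; assumption)
    interpret R: part_chain adj "\<lambda>i. P (n - 1 - i)" n T w by (rule part_chain_rev)
    obtain X' D' where X': "R.U {..<?a} \<subseteq> X'" "X' \<subseteq> R.U {..<?b}" "P (n - 1 - 0) \<subseteq> X'" "D' \<subseteq> X'" "card D' \<le> w"
      "\<And>v u q. v \<in> X' - D' \<Longrightarrow> u \<in> P (n - 1 - q) \<Longrightarrow> q < n \<Longrightarrow> adj v u \<Longrightarrow> u \<in> X' \<or> (v \<in> P (n - 1 - 0) \<and> q = n - 1)"
      by (rule R.half_cut[OF ab bn(1)]) (rule that; assumption)
    let ?X = "X \<union> X'"
    have "U (L (k - 1)) \<subseteq> U {..<?a} \<union> R.U {..<?a}"
    proof
      fix x assume "x \<in> U (L (k - 1))"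
      then obtain j where j: "x \<in> P j" "j < n" "j < ?a \<or> n \<le> j + ?a" unfolding U_def L_def by auto
      show "x \<in> U {..<?a} \<union> R.U {..<?a}"
      proof (cases "j < ?a")
        case True
        then show ?thesis using j unfolding U_def by auto
      next
        case False
        then have "n - 1 - j < ?a" "n - 1 - (n - 1 - j) = j" using j by linarith+
        then have "x \<in> R.U {..<?a}" unfolding R.U_def using j(1) by (intro UN_I[of "n - 1 - j"]) auto
        then show ?thesis by blast
      qed
    qed
    then have 1: "U (L (k - 1)) \<subseteq> ?X" using X(1) X'(1) by blast
    have "U {..<?b} \<subseteq> U (L k)" using bn by (intro U_mono) (auto simp: L_def)
    moreover have "R.U {..<?b} \<subseteq> U (L k)"
    proof
      fix x assume "x \<in> R.U {..<?b}"
      then obtain j where j: "x \<in> P (n - 1 - j)" "j < ?b" unfolding R.U_def by auto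
      then have "n - 1 - j \<in> L k" using bn unfolding L_def by auto
      then show "x \<in> U (L k)" using j unfolding U_def by blast
    qed
    ultimately have 2: "?X \<subseteq> U (L k)" using X(2) X'(2) by blast
    have "bd K ?X \<subseteq> D \<union> D'"
    proof
      fix v assume v: "v \<in> bd K ?X"
      show "v \<in> D \<union> D'"
      proof (rule ccontr)
        assume nD: "v \<notin> D \<union> D'"
        obtain u q where u: "u \<in> P q" "q < n" "u \<notin> ?X" "adj v u" using v unfolding bd_def U_def by auto
        have "v \<in> X - D \<or> v \<in> X' - D'" using v nD bd_subset by fastforce
        then show False
        proof
          assume "v \<in> X - D"
          then have "q = n - 1" using X(6)[of v u q] u by blast
          then show False using X'(3) u by auto
        next
          assume v': "v \<in> X' - D'"
          have "n - 1 - (n - 1 - q) = q" using u(2) by linarith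
          then have "n - 1 - q = n - 1" using X'(6)[OF v', of u "n - 1 - q"] u bn by auto
          then have "q = 0" using u(2) by linarith
          then show False using X(3) u by auto
        qed
      qed
    qed
    moreover have "finite (D \<union> D')"
    proof -
      have "?X \<subseteq> K" using 2 U_mono[OF L_subset] by blast
      then show ?thesis using X(4) X'(4) finite_U[OF subset_refl] by (meson finite_subset le_sup_iff finite_UnI)
    qed
    ultimately have "card (bd K ?X) \<le> card (D \<union> D')" by (rule card_mono[rotated])
    also have "\<dots> \<le> 2 * w" using card_Un_le[of D D'] X(5) X'(5) by linarith
    finally show ?thesis using 1 2 by blast
  qed
qed

lemma card_L_diff: "card (L (k + l) - L k) \<le> 2 * l * (3 * w + 1)"
proof -
  let ?m = "3 * w + 1"
  have "L (k + l) - L k \<subseteq> {k * ?m..<(k + l) * ?m} \<union> {n - (k + l) * ?m..<n - k * ?m}"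
    unfolding L_def by auto
  then have "card (L (k + l) - L k) \<le> card ({k * ?m..<(k + l) * ?m} \<union> {n - (k + l) * ?m..<n - k * ?m})"
    by (intro card_mono) auto
  also have "\<dots> \<le> ((k + l) * ?m - k * ?m) + ((n - k * ?m) - (n - (k + l) * ?m))"
    by (rule le_trans[OF card_Un_le]) simp
  also have "\<dots> \<le> l * ?m + l * ?m" by (simp only: add_mult_distrib)
  finally show ?thesis by (simp add: algebra_simps)
qed

lemma chain_layout:
  obtains X where "\<And>k. U (L (k - 1)) \<subseteq> X k" "\<And>k. X k \<subseteq> U (L k)" "\<And>k. card (bd K (X k)) \<le> 2 * w"
proof -
  have "\<forall>k. \<exists>X. U (L (k - 1)) \<subseteq> X \<and> X \<subseteq> U (L k) \<and> card (bd K X) \<le> 2 * w"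
    using middle_cut by blast
  from choice[OF this] show ?thesis using that by blast
qed

text \<open>Successive cuts have boundaries of size at most \<open>2 * w\<close> and differ within
  two levels of the folded chain, that is within \<open>4 * (3 * w + 1)\<close> parts. Filling in by
  a layout of width \<open>w\<close> gives \<open>2 * (2 * w) + w\<close>.\<close>

lemma chain_narrow: "narrow K T (5 * w)"
proof -
  obtain X where X: "\<And>k. U (L (k - 1)) \<subseteq> X k" "\<And>k. X k \<subseteq> U (L k)" "\<And>k. card (bd K (X k)) \<le> 2 * w"
    by (rule chain_layout) (rule that; assumption)
  have "lay K T (5 * w) (X k)" for k
  proof (induction k)
    case 0
    have "X 0 = {}" using X(2)[of 0] by (auto simp: U_def L_def)
    then show ?case by (simp add: lay_empty)
  next
    case (Suc k)
    let ?J = "L (Suc k) - L (k - 1)"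
    have J: "?J \<subseteq> {..<n}" using L_subset by blast
    have "card ?J \<le> 4 * (3 * w + 1)"
    proof (cases k)
      case 0
      then show ?thesis using card_L_diff[of 0 1] by simp
    next
      case (Suc l)
      then show ?thesis using card_L_diff[of l 2] by simp
    qed
    then have "narrow (U ?J) T w" unfolding U_def by (rule nar[OF J])
    then show ?case
    proof (rule lay_fill[OF Suc.IH, where a = "2 * w"])
      show "X k \<subseteq> X (Suc k)" using X(1)[of "Suc k"] X(2)[of k] by auto
      show "X (Suc k) \<subseteq> K" using X(2) U_mono[OF L_subset] by blast
      show "X (Suc k) - X k \<subseteq> U ?J" using X(1)[of k] X(2)[of "Suc k"] U_diff by blast
      show "finite K" "finite (U ?J)" using finite_U J by auto
    qed (use X(3) in auto)
  qed
  moreover have "X (Suc n) = K"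
  proof -
    have "L n = {..<n}" unfolding L_def by auto
    then show ?thesis using X(1)[of "Suc n"] X(2)[of "Suc n"] U_mono[OF L_subset, of "Suc n"] by auto
  qed
  ultimately show ?thesis unfolding narrow_def by metis
qed

text \<open>\<open>N\<close> is enclosed between a cut before the level of the part and one after
  it, and \<open>Z\<close> consists of the two boundaries. The position of each cut is uncertain by
  one level, so \<open>N\<close> spreads over at most three levels of \<open>2 * (3 * w + 1)\<close>
  parts each.\<close>

lemma chain_local:
  assumes j: "j < n"
  obtains N Z J where "P j \<subseteq> N" "N \<subseteq> U J" "J \<subseteq> {..<n}" "card J \<le> 6 * (3 * w + 1)" "Z \<subseteq> K" "card Z \<le> 4 * w"
    "\<And>v u. v \<in> N - Z \<Longrightarrow> u \<in> K - Z \<Longrightarrow> adj v u \<Longrightarrow> u \<in> N"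
proof -
  obtain X where X: "\<And>k. U (L (k - 1)) \<subseteq> X k" "\<And>k. X k \<subseteq> U (L k)" "\<And>k. card (bd K (X k)) \<le> 2 * w"
    by (rule chain_layout) (rule that; assumption)
  define k where "k = (LEAST k. j \<in> L k)"
  have jk: "j \<in> L k" unfolding k_def by (rule LeastI[of _ n]) (use j in \<open>auto simp: L_def\<close>)
  have "k \<noteq> 0"
  proof
    assume "k = 0"
    then show False using jk j by (simp add: L_def)
  qed
  then obtain l where l: "k = Suc l" by (cases k) auto
  then have jl: "j \<notin> L l" using not_less_Least[of l "\<lambda>k. j \<in> L k"] k_def by simp
  let ?N = "X (Suc k) - X l"
  let ?Z = "bd K (X (Suc k)) \<union> bd K (X l)"
  let ?J = "L (Suc k) - L (l - 1)"
  have "P j \<subseteq> X (Suc k)" using jk X(1)[of "Suc k"] unfolding U_def by auto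
  moreover have "P j \<inter> U (L l) = {}" using jl disj[OF j] L_subset unfolding U_def by blast
  ultimately have 1: "P j \<subseteq> ?N" using X(2)[of l] by blast
  have 2: "?N \<subseteq> U ?J" using X(1)[of l] X(2)[of "Suc k"] U_diff by blast
  have 3: "?J \<subseteq> {..<n}" using L_subset by blast
  have 4: "card ?J \<le> 6 * (3 * w + 1)"
  proof (cases l)
    case 0
    then show ?thesis using card_L_diff[of 0 2] l by (simp add: numeral_2_eq_2)
  next
    case (Suc i)
    then show ?thesis using card_L_diff[of i 3] l by (simp add: numeral_3_eq_3)
  qed
  have XK: "X k \<subseteq> K" for k using X(2) U_mono[OF L_subset] by blast
  then have 5: "?Z \<subseteq> K" using bd_subset by fastforce
  have 6: "card ?Z \<le> 4 * w" using card_Un_le[of "bd K (X (Suc k))" "bd K (X l)"] X(3)[of "Suc k"] X(3)[of l] by linarith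
  have 7: "u \<in> ?N" if "v \<in> ?N - ?Z" "u \<in> K - ?Z" "adj v u" for v u
    using that adj_sym[OF that(3)] XK unfolding bd_def by blast
  show ?thesis by (rule that[OF 1 2 3 4 5 6 7])
qed

end

section \<open>Decomposing parts with at most two neighbours each into chains\<close>

context sym_graph
begin

text \<open>A longest sequence of distinct, consecutively touching parts through \<open>A\<close>.
  An interior member has two neighbours in the sequence and therefore no others; a neighbour of an
  end outside the sequence would prolong it. The only further contact is between the two
  ends.\<close>

lemma component_list:
  assumes fin: "finite I" and deg: "\<forall>A\<in>I. card {B \<in> I. B \<noteq> A \<and> touch A B} \<le> 2" and A: "A \<in> I"
  obtains xs where "distinct xs" "A \<in> set xs" "set xs \<subseteq> I"
    "\<And>i B. i < length xs \<Longrightarrow> B \<in> I \<Longrightarrow> B \<noteq> xs ! i \<Longrightarrow> touch (xs ! i) B \<Longrightarrow>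
       \<exists>j<length xs. B = xs ! j \<and> (i = Suc j \<or> j = Suc i \<or> {i, j} = {0, length xs - 1})"
proof -
  let ?Q = "\<lambda>xs. distinct xs \<and> A \<in> set xs \<and> set xs \<subseteq> I \<and> successively touch xs"
  have "?Q [A]" using A by simp
  moreover have "length xs \<le> card I" if "?Q xs" for xs
    using that fin by (metis card_mono distinct_card)
  ultimately obtain xs where xs: "?Q xs" "\<And>ys. ?Q ys \<Longrightarrow> length ys \<le> length xs"
    using ex_greatest[of ?Q "[A]" length "card I"] by blast
  have suc: "touch (xs ! i) (xs ! Suc i)" if "Suc i < length xs" for i
    using xs(1) that by (simp add: successively_conv_nth)
  have three: False if "i < length xs" "{B1, B2, B3} \<subseteq> {B \<in> I. B \<noteq> xs ! i \<and> touch (xs ! i) B}"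
    "B1 \<noteq> B2" "B1 \<noteq> B3" "B2 \<noteq> B3" for i B1 B2 B3
  proof -
    have "card {B1, B2, B3} \<le> card {B \<in> I. B \<noteq> xs ! i \<and> touch (xs ! i) B}"
      using that(2) fin by (intro card_mono) auto
    also have "\<dots> \<le> 2" using deg xs(1) that(1) nth_mem by blast
    finally show False using that by simp
  qed
  have interior: "j = Suc i \<or> i = Suc j"
    if i: "0 < i" "Suc i < length xs" and j: "j < length xs" "j \<noteq> i" "touch (xs ! i) (xs ! j)" for i j
  proof (rule ccontr)
    assume n: "\<not> ?thesis"
    obtain k where k: "i = Suc k" using i by (cases i) auto
    have "xs ! j \<noteq> xs ! i" "xs ! k \<noteq> xs ! i" "xs ! Suc i \<noteq> xs ! i" "xs ! j \<noteq> xs ! k" "xs ! j \<noteq> xs ! Suc i" "xs ! k \<noteq> xs ! Suc i"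
      using xs(1) i j k n by (auto simp: nth_eq_iff_index_eq)
    moreover have "touch (xs ! i) (xs ! k)" "touch (xs ! i) (xs ! Suc i)"
      using suc[of k] suc[of i] i k touch_sym by auto
    moreover have "{xs ! j, xs ! k, xs ! Suc i} \<subseteq> I" using xs(1) i j k nth_mem by auto
    ultimately show False using three[of i "xs ! j" "xs ! k" "xs ! Suc i"] i j by auto
  qed
  have "\<exists>j<length xs. B = xs ! j \<and> (i = Suc j \<or> j = Suc i \<or> {i, j} = {0, length xs - 1})"
    if i: "i < length xs" and B: "B \<in> I" "B \<noteq> xs ! i" "touch (xs ! i) B" for i B
  proof (cases "B \<in> set xs")
    case True
    then obtain j where j: "j < length xs" "B = xs ! j" by (metis in_set_conv_nth)
    then have ij: "i \<noteq> j" using B by blast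
    have tt: "touch (xs ! i) (xs ! j)" "touch (xs ! j) (xs ! i)" using B j touch_sym by auto
    consider "0 < i" "Suc i < length xs" | "0 < j" "Suc j < length xs" | "{i, j} = {0, length xs - 1}"
    proof -
      have "0 < i \<and> Suc i < length xs \<or> 0 < j \<and> Suc j < length xs \<or>
        i = 0 \<and> j = length xs - 1 \<or> j = 0 \<and> i = length xs - 1"
        using i j(1) ij by arith
      then show thesis using that by (auto simp: insert_commute)
    qed
    then have "i = Suc j \<or> j = Suc i \<or> {i, j} = {0, length xs - 1}"
    proof cases
      case 1
      then show ?thesis using interior[OF 1 j(1) _ tt(1)] ij by blast
    next
      case 2
      then show ?thesis using interior[OF 2 i _ tt(2)] ij by blast
    qed blast
    then show ?thesis using j by blast
  next
    case False
    consider "i = 0" | "Suc i = length xs" | "0 < i" "Suc i < length xs" using i by linarith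
    then show ?thesis
    proof cases
      case 1
      then obtain y ys where "xs = y # ys" "touch B y" using i B touch_sym by (cases xs) auto
      then have "?Q (B # xs)" using xs(1) False B by auto
      then show ?thesis using xs(2)[of "B # xs"] by simp
    next
      case 2
      then have "xs \<noteq> []" by auto
      moreover from this have "last xs = xs ! i" using 2 by (metis diff_Suc_1 last_conv_nth)
      ultimately have "?Q (xs @ [B])" using xs(1) False B by (auto simp: successively_append_iff)
      then show ?thesis using xs(2)[of "xs @ [B]"] by simp
    next
      case 3
      obtain k where k: "i = Suc k" using 3 by (cases i) auto
      have "touch (xs ! i) (xs ! k)" "touch (xs ! i) (xs ! Suc i)"
        using suc[of k] suc[of i] 3 k touch_sym by auto
      moreover have "xs ! k \<noteq> xs ! i" "xs ! Suc i \<noteq> xs ! i" "xs ! k \<noteq> xs ! Suc i"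
        using xs(1) 3 k by (auto simp: nth_eq_iff_index_eq)
      moreover have "xs ! k \<in> set xs" "xs ! Suc i \<in> set xs" using 3 k by auto
      ultimately show ?thesis using three[OF i, of B "xs ! k" "xs ! Suc i"] False B xs(1) by auto
    qed
  qed
  then show ?thesis using that xs(1) by blast
qed

text \<open>The contact graph of the parts has maximum degree two, so its components are paths and
  cycles and satisfy \<open>part_chain\<close>.\<close>

definition good_parts :: "'a set set \<Rightarrow> 'a set \<Rightarrow> nat \<Rightarrow> bool" where
  "good_parts I T w \<longleftrightarrow> finite I \<and> disjoint I \<and> (\<forall>A\<in>I. finite A \<and> conn A \<and> A \<inter> T \<noteq> {}) \<and>
     (\<forall>A\<in>I. card {B \<in> I. B \<noteq> A \<and> touch A B} \<le> 2) \<and>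
     (\<forall>J\<subseteq>I. card J \<le> 4 * (3 * w + 1) \<longrightarrow> narrow (\<Union>J) T w)"

lemma good_parts_component:
  assumes g: "good_parts I T w" and A: "A \<in> I"
  obtains xs where "distinct xs" "A \<in> set xs" "set xs \<subseteq> I" "\<not> touch (\<Union>(set xs)) (\<Union>(I - set xs))"
    "part_chain adj (\<lambda>i. xs ! i) (length xs) T w"
proof -
  have fin: "finite I" and deg: "\<forall>A\<in>I. card {B \<in> I. B \<noteq> A \<and> touch A B} \<le> 2"
    using g by (auto simp: good_parts_def)
  obtain xs where xs: "distinct xs" "A \<in> set xs" "set xs \<subseteq> I"
    "\<And>i B. i < length xs \<Longrightarrow> B \<in> I \<Longrightarrow> B \<noteq> xs ! i \<Longrightarrow> touch (xs ! i) B \<Longrightarrow>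
       \<exists>j<length xs. B = xs ! j \<and> (i = Suc j \<or> j = Suc i \<or> {i, j} = {0, length xs - 1})"
    by (rule component_list[OF fin deg A]) (rule that; assumption)
  have I: "xs ! i \<in> I" if "i < length xs" for i using xs(3) that by auto
  have "part_chain adj (\<lambda>i. xs ! i) (length xs) T w"
  proof unfold_locales
    fix i j assume ij: "i < length xs" "j < length xs" "i \<noteq> j"
    have ne: "xs ! i \<noteq> xs ! j" using ij xs(1) by (simp add: nth_eq_iff_index_eq)
    then show "xs ! i \<inter> xs ! j = {}" using g I[OF ij(1)] I[OF ij(2)] by (auto simp: good_parts_def dest: disjointD)
    assume "touch (xs ! i) (xs ! j)"
    then obtain k where "k < length xs" "xs ! j = xs ! k" "i = Suc k \<or> k = Suc i \<or> {i, k} = {0, length xs - 1}"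
      using xs(4)[OF ij(1) I[OF ij(2)]] ne by metis
    then show "i = Suc j \<or> j = Suc i \<or> {i, j} = {0, length xs - 1}"
      using ij xs(1) by (auto simp: nth_eq_iff_index_eq)
  next
    fix J assume J: "J \<subseteq> {..<length xs}" "card J \<le> 4 * (3 * w + 1)"
    have fJ: "finite J" using J finite_subset by blast
    have "card ((!) xs ` J) \<le> card J" using fJ by (rule card_image_le)
    moreover have "(!) xs ` J \<subseteq> I" using J I by auto
    ultimately show "narrow (\<Union>i\<in>J. xs ! i) T w" using g J(2) unfolding good_parts_def by auto
  qed (use g I in \<open>auto simp: good_parts_def\<close>)
  moreover have "\<not> touch (\<Union>(set xs)) (\<Union>(I - set xs))"
  proof
    assume "touch (\<Union>(set xs)) (\<Union>(I - set xs))"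
    then obtain X B where XB: "X \<in> set xs" "B \<in> I" "B \<notin> set xs" "touch X B" unfolding touch_def by blast
    obtain i where "i < length xs" "X = xs ! i" using XB(1) by (metis in_set_conv_nth)
    moreover from this have "B \<noteq> xs ! i" using XB by auto
    ultimately have "\<exists>j<length xs. B = xs ! j" using xs(4)[of i B] XB by blast
    then show False using XB(3) by auto
  qed
  ultimately show ?thesis using that xs by blast
qed

lemma good_parts_subset: "good_parts I T w \<Longrightarrow> J \<subseteq> I \<Longrightarrow> good_parts J T w"
proof -
  assume g: "good_parts I T w" and J: "J \<subseteq> I"
  have "card {B \<in> J. B \<noteq> A \<and> touch A B} \<le> 2" if "A \<in> J" for A
  proof -
    have "card {B \<in> J. B \<noteq> A \<and> touch A B} \<le> card {B \<in> I. B \<noteq> A \<and> touch A B}"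
      using g J by (intro card_mono) (auto simp: good_parts_def)
    moreover have "A \<in> I" using that J by blast
    ultimately show ?thesis using g unfolding good_parts_def by (meson le_trans)
  qed
  moreover have "disjoint J"
  proof (rule disjointI)
    fix a b assume ab: "a \<in> J" "b \<in> J" "a \<noteq> b"
    have "disjoint I" using g by (simp add: good_parts_def)
    then show "a \<inter> b = {}" by (rule disjointD) (use ab J in auto)
  qed
  moreover have "finite J" using g J finite_subset[of J I] by (simp add: good_parts_def)
  moreover have "narrow (\<Union>J') T w" if "J' \<subseteq> J" "card J' \<le> 4 * (3 * w + 1)" for J'
    using g J that unfolding good_parts_def by (meson subset_trans)
  moreover have "finite A \<and> conn A \<and> A \<inter> T \<noteq> {}" if "A \<in> J" for A
  proof -
    have "A \<in> I" using J that by (rule subsetD)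
    then show ?thesis using g by (simp add: good_parts_def)
  qed
  ultimately show ?thesis unfolding good_parts_def by simp
qed

lemma U_list: "(\<Union>i\<in>{..<length xs}. xs ! i) = \<Union>(set xs)"
  unfolding set_conv_nth by auto

lemma good_parts_narrow: "good_parts I T w \<Longrightarrow> narrow (\<Union>I) T (5 * w)"
proof (induction "card I" arbitrary: I rule: less_induct)
  case less
  show ?case
  proof (cases "I = {}")
    case False
    then obtain A where A: "A \<in> I" by blast
    obtain xs where xs: "A \<in> set xs" "set xs \<subseteq> I" "\<not> touch (\<Union>(set xs)) (\<Union>(I - set xs))"
      "part_chain adj (\<lambda>i. xs ! i) (length xs) T w" by (rule good_parts_component[OF less.prems A])
    have fin: "finite I" using less.prems by (simp add: good_parts_def)
    have "card (I - set xs) < card I" using xs A fin by (intro psubset_card_mono) auto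
    then have "narrow (\<Union>(I - set xs)) T (5 * w)"
      using less.hyps good_parts_subset[OF less.prems, of "I - set xs"] by blast
    moreover have "narrow (\<Union>(set xs)) T (5 * w)"
      using part_chain.chain_narrow[OF xs(4)] part_chain.U_def[OF xs(4)] U_list[of xs] by simp
    moreover have "\<Union>(set xs) \<inter> \<Union>(I - set xs) = {}"
    proof -
      have dI: "disjoint I" using less.prems by (simp add: good_parts_def)
      have "X \<inter> Y = {}" if "X \<in> set xs" "Y \<in> I - set xs" for X Y
        using that xs(2) by (intro disjointD[OF dI]) auto
      then show ?thesis by blast
    qed
    ultimately have "narrow (\<Union>(set xs) \<union> \<Union>(I - set xs)) T (5 * w)" using xs(3) narrow_Un by blast
    moreover have "\<Union>(set xs) \<union> \<Union>(I - set xs) = \<Union>I" using xs(2) by blast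
    ultimately show ?thesis by simp
  qed simp
qed

lemma good_parts_local:
  assumes g: "good_parts I T w" and A: "A \<in> I"
  obtains N Z where "A \<subseteq> N" "N \<subseteq> \<Union>I" "Z \<subseteq> \<Union>I" "card Z \<le> 4 * w"
    "\<And>v u. v \<in> N - Z \<Longrightarrow> u \<in> \<Union>I - Z \<Longrightarrow> adj v u \<Longrightarrow> u \<in> N"
    "card {B \<in> I. B \<inter> N \<noteq> {}} \<le> 6 * (3 * w + 1)"
proof -
  obtain xs where xs: "A \<in> set xs" "set xs \<subseteq> I" "\<not> touch (\<Union>(set xs)) (\<Union>(I - set xs))"
      "part_chain adj (\<lambda>i. xs ! i) (length xs) T w" by (rule good_parts_component[OF g A])
  interpret C: part_chain adj "\<lambda>i. xs ! i" "length xs" T w by (rule xs(4))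
  have K: "C.K = \<Union>(set xs)" unfolding C.U_def by (rule U_list)
  obtain j where j: "j < length xs" "A = xs ! j" using xs(1) by (metis in_set_conv_nth)
  obtain N Z J where N: "xs ! j \<subseteq> N" "N \<subseteq> C.U J" "J \<subseteq> {..<length xs}" "card J \<le> 6 * (3 * w + 1)" "Z \<subseteq> C.K" "card Z \<le> 4 * w"
    "\<And>v u. v \<in> N - Z \<Longrightarrow> u \<in> C.K - Z \<Longrightarrow> adj v u \<Longrightarrow> u \<in> N"
    by (rule C.chain_local[OF j(1)]) (rule that; assumption)
  have NK: "N \<subseteq> \<Union>(set xs)" using N(2) C.U_mono[OF N(3)] K by blast
  have "{B \<in> I. B \<inter> N \<noteq> {}} \<subseteq> (!) xs ` J"
  proof
    fix B assume "B \<in> {B \<in> I. B \<inter> N \<noteq> {}}"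
    then obtain i x where i: "i \<in> J" "x \<in> xs ! i" "x \<in> B" "B \<in> I" using N(2) unfolding C.U_def by blast
    have "i < length xs" using i(1) N(3) by blast
    then have "xs ! i \<in> I" using xs(2) nth_mem by blast
    moreover have "B \<inter> xs ! i \<noteq> {}" using i by blast
    ultimately have "B = xs ! i" using disjointD[of I B "xs ! i"] g i(4) by (auto simp: good_parts_def)
    then show "B \<in> (!) xs ` J" using i(1) by (rule image_eqI)
  qed
  moreover have fJ: "finite J" using N(3) finite_subset by blast
  ultimately have "card {B \<in> I. B \<inter> N \<noteq> {}} \<le> card ((!) xs ` J)" by (intro card_mono) auto
  also have "\<dots> \<le> card J" using fJ by (rule card_image_le)
  finally have c: "card {B \<in> I. B \<inter> N \<noteq> {}} \<le> 6 * (3 * w + 1)" using N(4) by simp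
  have cl: "u \<in> N" if "v \<in> N - Z" "u \<in> \<Union>I - Z" "adj v u" for v u
  proof (cases "u \<in> \<Union>(set xs)")
    case True
    then have "u \<in> C.K - Z" using that(2) unfolding K by simp
    then show ?thesis using N(7) that by simp
  next
    case False
    then have "u \<in> \<Union>(I - set xs)" "v \<in> \<Union>(set xs)" using that NK by blast+
    then show ?thesis using xs(3) that(3) unfolding touch_def by blast
  qed
  have KI: "\<Union>(set xs) \<subseteq> \<Union>I" using xs(2) by blast
  have "A \<subseteq> N" using N(1) j(2) by simp
  moreover have "N \<subseteq> \<Union>I" using NK KI by (rule subset_trans)
  moreover have "Z \<subseteq> \<Union>I" using N(5) KI unfolding K by (rule subset_trans)
  ultimately show ?thesis using N(6) cl c by (rule that)
qed

end

subsection \<open>Hitting all sets of large rank\<close>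

text \<open>Width \<open>3 ^ (h + 2)\<close> is the threshold of \<open>rk_if_not_narrow\<close> for
  rank \<open>h + 1\<close>, and chains cost a factor of 5. The maximum accommodates the width left
  by the induction hypothesis.\<close>

primrec wd :: "nat \<Rightarrow> nat" where
  "wd 0 = 0"
| "wd (Suc h) = max (5 * 3 ^ (h + 2)) (wd h)"

text \<open>The largest number of atoms met by a cheap set. It equals the number of parts whose
  union \<open>good_parts\<close> wants to be narrow, for width \<open>3 ^ (h + 2)\<close>.\<close>

definition near :: "nat \<Rightarrow> nat" where
  "near h = 4 * (3 * 3 ^ (h + 2) + 1)"

text \<open>\<open>q * p\<close> bounds the vertices and atoms of two applications of
  \<open>atom_cut\<close>: \<open>3 * p\<close> each, and \<open>2 * segs\<close> for each of at
  most \<open>p\<close> cheap sets and at most \<open>near h * p\<close> atoms met by them. The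
  second summand pays for cutting the chains near the cut atoms; the last factor bounds the atoms
  met by the region left to the induction hypothesis.\<close>

primrec ep_const :: "nat \<Rightarrow> nat" where
  "ep_const 0 = 1"
| "ep_const (Suc h) =
     (let q = 6 + 2 * segs (Suc h) + 2 * (segs h * near h) in
      q + q * (4 * 3 ^ (h + 2)) + ep_const h * (near h + q + q * (2 * near h)))"

context sym_graph
begin

lemma packing_nonempty: "packing T h V \<A> \<Longrightarrow> A \<in> \<A> \<Longrightarrow> A \<noteq> {}"
  unfolding packing_def using rk_conn conn_nonempty by blast

lemma packing_disjoint: "packing T h V \<A> \<Longrightarrow> A \<in> \<A> \<Longrightarrow> B \<in> \<A> \<Longrightarrow> A \<noteq> B \<Longrightarrow> A \<inter> B = {}"
  unfolding packing_def by (meson disjointD)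

lemma packing_insert:
  assumes "packing T h V \<A>" "rk T h X" "X \<subseteq> V" "X \<inter> \<Union>\<A> = {}"
  shows "packing T h V (insert X \<A>)" "X \<notin> \<A>"
proof -
  have "X \<noteq> {}" using assms(2) rk_conn conn_nonempty by blast
  then show "X \<notin> \<A>" using assms(4) by blast
  have "disjoint (insert X \<A>)"
  proof (rule disjointI)
    fix a b assume "a \<in> insert X \<A>" "b \<in> insert X \<A>" "a \<noteq> b"
    then show "a \<inter> b = {}" using assms(4) packing_disjoint[OF assms(1), of a b] by auto
  qed
  then show "packing T h V (insert X \<A>)" using assms unfolding packing_def by simp
qed

lemma thin_packing:
  assumes "finite V" "packing T h V \<B>"
  shows "\<exists>\<A>. packing T h V \<A> \<and> (\<forall>A\<in>\<A>. pcover (segs h) A) \<and> card \<A> = card \<B>"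
proof -
  have "\<exists>Y\<subseteq>B. rk T h Y \<and> pcover (segs h) Y" if "B \<in> \<B>" for B
    using that assms unfolding packing_def by (meson finite_subset rk_thin)
  then obtain f where f: "\<And>B. B \<in> \<B> \<Longrightarrow> f B \<subseteq> B \<and> rk T h (f B) \<and> pcover (segs h) (f B)" by metis
  have d: "f B \<inter> f C = {}" if "B \<in> \<B>" "C \<in> \<B>" "B \<noteq> C" for B C
    using packing_disjoint[OF assms(2) that] f[OF that(1)] f[OF that(2)] by blast
  have "inj_on f \<B>"
  proof (rule inj_onI)
    fix B C assume "B \<in> \<B>" "C \<in> \<B>" "f B = f C"
    then show "B = C" using d[of B C] f[of B] rk_conn conn_nonempty by (metis inf.idem)
  qed
  moreover have "disjoint (f ` \<B>)"
  proof (rule disjointI)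
    fix a b assume "a \<in> f ` \<B>" "b \<in> f ` \<B>" "a \<noteq> b"
    then obtain B C where "B \<in> \<B>" "C \<in> \<B>" "a = f B" "b = f C" by (elim imageE)
    then show "a \<inter> b = {}" using d[of B C] \<open>a \<noteq> b\<close> by auto
  qed
  moreover have "f B \<subseteq> V" if "B \<in> \<B>" for B using f[OF that] that assms(2) unfolding packing_def by blast
  ultimately have "packing T h V (f ` \<B>) \<and> (\<forall>A\<in>f ` \<B>. pcover (segs h) A) \<and> card (f ` \<B>) = card \<B>"
    using f assms(2) by (simp add: packing_def card_image)
  then show ?thesis by blast
qed

text \<open>Parts with a largest union: an outside vertex adjacent to a part could be added to
  it.\<close>

lemma parts_exist:
  assumes "finite V" "finite \<A>" "disjoint \<A>" "\<And>A. A \<in> \<A> \<Longrightarrow> A \<subseteq> V \<and> conn A"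
  obtains P where "\<And>A. A \<in> \<A> \<Longrightarrow> A \<subseteq> P A \<and> P A \<subseteq> V \<and> conn (P A)"
    "\<And>A B. A \<in> \<A> \<Longrightarrow> B \<in> \<A> \<Longrightarrow> A \<noteq> B \<Longrightarrow> P A \<inter> P B = {}"
    "\<not> touch (\<Union>A\<in>\<A>. P A) (V - (\<Union>A\<in>\<A>. P A))"
proof -
  let ?Q = "\<lambda>P. (\<forall>A\<in>\<A>. A \<subseteq> P A \<and> P A \<subseteq> V \<and> conn (P A)) \<and> (\<forall>A\<in>\<A>. \<forall>B\<in>\<A>. A \<noteq> B \<longrightarrow> P A \<inter> P B = {})"
  obtain P where P: "?Q P" "\<And>R. ?Q R \<Longrightarrow> card (\<Union>A\<in>\<A>. R A) \<le> card (\<Union>A\<in>\<A>. P A)"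
  proof (rule ex_greatest[of ?Q "\<lambda>A. A" "\<lambda>P. card (\<Union>A\<in>\<A>. P A)" "card V"])
    show "?Q (\<lambda>A. A)" using assms(3,4) by (auto dest: disjointD)
    show "card (\<Union>A\<in>\<A>. P A) \<le> card V" if "?Q P" for P
      using that assms(1) by (intro card_mono) auto
  qed (rule that; assumption)
  have "\<not> touch (\<Union>A\<in>\<A>. P A) (V - (\<Union>A\<in>\<A>. P A))"
  proof
    assume "touch (\<Union>A\<in>\<A>. P A) (V - (\<Union>A\<in>\<A>. P A))"
    then obtain A v u where u: "A \<in> \<A>" "v \<in> P A" "u \<in> V" "u \<notin> (\<Union>A\<in>\<A>. P A)" "adj v u"
      unfolding touch_def by blast
    let ?R = "P(A := insert u (P A))"
    have "conn (insert u (P A))" using P(1) u by (intro conn_insert) (auto simp: touch_def)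
    then have "?Q ?R" using P(1) u by auto
    then have "card (\<Union>A\<in>\<A>. ?R A) \<le> card (\<Union>A\<in>\<A>. P A)" by (rule P(2))
    moreover have "(\<Union>A\<in>\<A>. ?R A) = insert u (\<Union>A\<in>\<A>. P A)" using u(1) by (auto split: if_splits)
    moreover have "finite (\<Union>A\<in>\<A>. P A)" using P(1) assms(1) finite_subset[of "\<Union>A\<in>\<A>. P A" V] by blast
    ultimately show False using u(4) by simp
  qed
  then show ?thesis by (intro that[of P]) (use P(1) in simp_all)
qed

text \<open>An exchange argument: the members of a maximum packing that meet \<open>W\<close> can be
  replaced by any packing inside \<open>W\<close>.\<close>

lemma packing_le_touched:
  assumes A: "packing T h V \<A>" and max: "\<And>\<B>. packing T h V \<B> \<Longrightarrow> card \<B> \<le> card \<A>"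
    and W: "W \<subseteq> V" and B: "packing T h W \<B>"
  shows "card \<B> \<le> card {A \<in> \<A>. A \<inter> W \<noteq> {}}"
proof -
  let ?t = "{A \<in> \<A>. A \<inter> W \<noteq> {}}"
  have fA: "finite \<A>" and fB: "finite \<B>" using A B by (auto simp: packing_def)
  have BW: "X \<subseteq> W" if "X \<in> \<B>" for X using B that by (auto simp: packing_def)
  have cross: "X \<inter> Y = {}" if "X \<in> \<A> - ?t" "Y \<in> \<B>" for X Y using BW[OF that(2)] that(1) by blast
  have "disjoint ((\<A> - ?t) \<union> \<B>)"
  proof (rule disjointI)
    fix a b assume "a \<in> (\<A> - ?t) \<union> \<B>" "b \<in> (\<A> - ?t) \<union> \<B>" "a \<noteq> b"
    then show "a \<inter> b = {}"
      using cross[of a b] cross[of b a] packing_disjoint[OF A, of a b] packing_disjoint[OF B, of a b]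
      by (auto simp: Int_commute)
  qed
  moreover have "X \<subseteq> V \<and> rk T h X" if "X \<in> (\<A> - ?t) \<union> \<B>" for X
    using that A B W by (auto simp: packing_def)
  ultimately have "packing T h V ((\<A> - ?t) \<union> \<B>)" using fA fB unfolding packing_def by simp
  then have le: "card ((\<A> - ?t) \<union> \<B>) \<le> card \<A>" by (rule max)
  have "(\<A> - ?t) \<inter> \<B> = {}"
  proof (rule ccontr)
    assume "(\<A> - ?t) \<inter> \<B> \<noteq> {}"
    then obtain X where "X \<in> \<A> - ?t" "X \<in> \<B>" by blast
    then show False using cross[of X X] packing_nonempty[OF B, of X] by auto
  qed
  then have "card ((\<A> - ?t) \<union> \<B>) = card (\<A> - ?t) + card \<B>" using fA fB by (intro card_Un_disjoint) auto
  moreover have "card (\<A> - ?t) = card \<A> - card ?t" using fA by (intro card_Diff_subset) auto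
  moreover have "card ?t \<le> card \<A>" using fA by (intro card_mono) auto
  ultimately show ?thesis using le by linarith
qed

lemma card_UN_bound:
  assumes "finite I" "\<And>i. i \<in> I \<Longrightarrow> card (f i) \<le> k"
  shows "card (\<Union>i\<in>I. f i) \<le> card I * k"
  using card_UN_le[OF assms(1), of f] sum_bounded_above[of I "\<lambda>i. card (f i)" k] assms(2) by fastforce

text \<open>
  One step of the induction on the rank. The sets in \<open>\<M>\<close> are the cheap sets of rank \<open>h + 1\<close>, those
  meeting few atoms of a maximum packing \<open>\<A>\<close> of sets of rank \<open>h\<close>. Away from \<open>Q\<close>, which consists of
  boundedly many paths per element of \<open>\<M>\<close>, the atoms form chains. Many disjoint routes from \<open>Q\<close> to
  distinct atoms would yield too many sets of rank \<open>h + 1\<close>, so few vertices and few atoms separate \<open>Q\<close>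
  from the remaining atoms, and the chains can be cut near these few atoms.
\<close>

lemma ep_step:
  assumes IH: "\<And>W p. finite W \<Longrightarrow> (\<And>\<B>. packing T h W \<B> \<Longrightarrow> card \<B> \<le> p) \<Longrightarrow>
      \<exists>Z\<subseteq>W. card Z \<le> ep_const h * p \<and> narrow (W - Z) T (wd h)"
    and fin: "finite V" and max: "\<And>\<B>. packing T (Suc h) V \<B> \<Longrightarrow> card \<B> \<le> p"
  shows "\<exists>Z\<subseteq>V. card Z \<le> ep_const (Suc h) * p \<and> narrow (V - Z) T (wd (Suc h))"
proof -
  define u :: nat where "u = 3 ^ (h + 2)"
  have m0: "near h = 4 * (3 * u + 1)" by (simp add: near_def u_def)
  let ?tp = "\<lambda>\<A>. packing T h V \<A> \<and> (\<forall>A\<in>\<A>. pcover (segs h) A)"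
  have "?tp {}" by (simp add: packing_def disjoint_def)
  moreover have "card \<A> \<le> card (Pow V)" if "?tp \<A>" for \<A>
    using that fin by (intro card_mono) (auto simp: packing_def)
  ultimately obtain \<A> where A0: "?tp \<A>" "\<And>\<B>. ?tp \<B> \<Longrightarrow> card \<B> \<le> card \<A>"
    using ex_greatest[of ?tp "{}" card "card (Pow V)"] by blast
  have A: "packing T h V \<A>" and Acov: "\<And>A. A \<in> \<A> \<Longrightarrow> pcover (segs h) A" using A0(1) by auto
  \<comment> \<open>Thinning preserves the number of members, so a largest packing by thin sets is a
    largest packing altogether.\<close>
  have maxA: "card \<B> \<le> card \<A>" if "packing T h V \<B>" for \<B>
    using thin_packing[OF fin that] A0(2) by metis
  have fA: "finite \<A>" using A by (auto simp: packing_def)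
  have AV: "A \<subseteq> V" "rk T h A" if "A \<in> \<A>" for A using A that by (auto simp: packing_def)
  let ?touched = "\<lambda>X. {A \<in> \<A>. A \<inter> X \<noteq> {}}"
  let ?ch = "\<lambda>\<M>. packing T (Suc h) V \<M> \<and> (\<forall>M\<in>\<M>. pcover (segs (Suc h)) M \<and> card (?touched M) \<le> near h)"
  have "?ch {}" by (simp add: packing_def disjoint_def)
  moreover have "card \<M> \<le> p" if "?ch \<M>" for \<M> using that max by blast
  ultimately obtain \<M> where M0: "?ch \<M>" "\<And>\<B>. ?ch \<B> \<Longrightarrow> card \<B> \<le> card \<M>"
    using ex_greatest[of ?ch "{}" card p] by blast
  have M: "packing T (Suc h) V \<M>" and Mcov: "\<And>M. M \<in> \<M> \<Longrightarrow> pcover (segs (Suc h)) M"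
    and Mt: "\<And>M. M \<in> \<M> \<Longrightarrow> card (?touched M) \<le> near h" using M0(1) by auto
  have fM: "finite \<M>" and dM: "disjoint \<M>" and cM: "card \<M> \<le> p" using M max by (auto simp: packing_def)
  have MV: "\<Union>\<M> \<subseteq> V" using M by (auto simp: packing_def)
  define H0 where "H0 = ?touched (\<Union>\<M>)"
  have H0A: "H0 \<subseteq> \<A>" by (auto simp: H0_def)
  have fH0: "finite H0" using fA H0A finite_subset by blast
  have "H0 = (\<Union>M\<in>\<M>. ?touched M)" by (auto simp: H0_def)
  then have "card H0 \<le> card \<M> * near h" using card_UN_bound[OF fM Mt] by simp
  also have "\<dots> \<le> p * near h" using cM by (rule mult_le_mono1)
  finally have cH0: "card H0 \<le> p * near h" .
  have H0V: "\<Union>H0 \<subseteq> V" using AV(1) H0A by blast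
  define Q where "Q = \<Union>\<M> \<union> \<Union>H0"
  have QV: "Q \<subseteq> V" using MV H0V by (simp add: Q_def)
  define A1 where "A1 = \<A> - H0"
  have A1A: "A1 \<subseteq> \<A>" by (auto simp: A1_def)
  have fA1: "finite A1" using fA A1A finite_subset by blast
  have dA1: "disjoint A1" unfolding A1_def
    by (rule disjointI) (use packing_disjoint[OF A] in auto)
  have A1M: "A \<inter> \<Union>\<M> = {}" if "A \<in> A1" for A using that by (auto simp: A1_def H0_def)
  have A1H: "A \<inter> \<Union>H0 = {}" if "A \<in> A1" for A
  proof -
    have "A \<inter> B = {}" if "B \<in> H0" for B
      using packing_disjoint[OF A, of A B] \<open>A \<in> A1\<close> that H0A by (auto simp: A1_def)
    then show ?thesis by blast
  qed
  have A1Q: "A \<inter> Q = {}" if "A \<in> A1" for A using A1M[OF that] A1H[OF that] by (auto simp: Q_def)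
  \<comment> \<open>A thin subset of \<open>X\<close> is still cheap and could be added to the
    largest cheap packing \<open>\<M>\<close>.\<close>
  have nocheap: False if X: "rk T (Suc h) X" "X \<subseteq> V - Q" "card (?touched X) \<le> near h" for X
  proof -
    have fX: "finite X" using X(2) fin by (meson Diff_subset finite_subset)
    obtain Y where Y: "Y \<subseteq> X" "rk T (Suc h) Y" "pcover (segs (Suc h)) Y" using rk_thin[OF X(1) fX] by blast
    have YV: "Y \<subseteq> V" "Y \<inter> \<Union>\<M> = {}" using Y(1) X(2) by (auto simp: Q_def)
    have "card (?touched Y) \<le> card (?touched X)" using fA Y(1) by (intro card_mono) auto
    then have "?ch (insert Y \<M>)" using packing_insert(1)[OF M Y(2) YV] Y(3) X(3) M0(1) by auto
    then have "card (insert Y \<M>) \<le> card \<M>" by (rule M0(2))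
    then show False using packing_insert(2)[OF M Y(2) YV] fM by simp
  qed
  have no_near: "narrow X T u" if "X \<subseteq> V - Q" "card (?touched X) \<le> near h" for X
  proof (rule ccontr)
    have fX: "finite X" using that(1) fin by (meson Diff_subset finite_subset)
    assume "\<not> narrow X T u"
    then have "\<not> narrow X T (3 ^ Suc (Suc h))" by (simp add: u_def)
    then obtain Y where Y: "Y \<subseteq> X" "rk T (Suc h) Y" using rk_if_not_narrow[OF fX] by blast
    have "card (?touched Y) \<le> card (?touched X)" using fA Y(1) by (intro card_mono) auto
    then show False using nocheap[OF Y(2)] Y(1) that by (meson le_trans subset_trans)
  qed
  have pM: "pcover (segs (Suc h) * card \<M>) (\<Union>\<M>)" by (rule pcover_Union[OF fM dM Mcov])
  have dH0: "disjoint H0" by (rule disjointI) (use packing_disjoint[OF A] H0A in auto)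
  have pH: "pcover (segs h * card H0) (\<Union>H0)" by (rule pcover_Union[OF fH0 dH0]) (use Acov H0A in auto)
  have a1: "A \<subseteq> V \<and> rk T h A \<and> A \<inter> \<Union>\<M> = {}" if "A \<in> A1" for A using AV A1A A1M[OF that] that by auto
  have a2: "A \<subseteq> V \<and> rk T h A \<and> A \<inter> \<Union>H0 = {}" if "A \<in> A1" for A using AV A1A A1H[OF that] that by auto
  \<comment> \<open>The cut is made separately for \<open>\<M>\<close> and \<open>H0\<close>: a path
    cover must be disjoint, but members of \<open>\<M>\<close> overlap the atoms that they
    meet.\<close>
  obtain Za Ha where Za: "Za \<subseteq> V - \<Union>A1" "Ha \<subseteq> A1" "card Za + card Ha \<le> 3 * p + 2 * (segs (Suc h) * card \<M>)"
    "\<And>X. conn X \<Longrightarrow> X \<subseteq> V - Za - \<Union>Ha \<Longrightarrow> X \<inter> \<Union>\<M> \<noteq> {} \<Longrightarrow> X \<inter> \<Union>A1 = {}"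
    by (rule atom_cut[OF fin fA1 dA1 a1 MV pM max]) (assumption | rule that)+
  obtain Zb Hb where Zb: "Zb \<subseteq> V - \<Union>A1" "Hb \<subseteq> A1" "card Zb + card Hb \<le> 3 * p + 2 * (segs h * card H0)"
    "\<And>X. conn X \<Longrightarrow> X \<subseteq> V - Zb - \<Union>Hb \<Longrightarrow> X \<inter> \<Union>H0 \<noteq> {} \<Longrightarrow> X \<inter> \<Union>A1 = {}"
    by (rule atom_cut[OF fin fA1 dA1 a2 H0V pH max]) (assumption | rule that)+
  define q where "q = 6 + 2 * segs (Suc h) + 2 * (segs h * near h)"
  define Z1 where "Z1 = Za \<union> Zb"
  define H1 where "H1 = Ha \<union> Hb"
  have H1A: "H1 \<subseteq> A1" using Za Zb by (simp add: H1_def)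
  have fH1: "finite H1" using H1A fA1 finite_subset by blast
  have Z1V: "Z1 \<subseteq> V" using Za Zb by (auto simp: Z1_def)
  have "card Z1 + card H1 \<le> (card Za + card Ha) + (card Zb + card Hb)"
    unfolding Z1_def H1_def using card_Un_le[of Za Zb] card_Un_le[of Ha Hb] by linarith
  also have "\<dots> \<le> (3 * p + 2 * (segs (Suc h) * p)) + (3 * p + 2 * (segs h * (p * near h)))"
    using Za(3) Zb(3) mult_le_mono2[OF cM, of "segs (Suc h)"] mult_le_mono2[OF cH0, of "segs h"] by linarith
  also have "\<dots> = q * p" by (simp add: q_def algebra_simps)
  finally have cZ1: "card Z1 + card H1 \<le> q * p" .
  have A1VQ: "A \<subseteq> V - Q \<and> conn A" if "A \<in> A1" for A
    using a1[OF that] A1Q[OF that] rk_conn by blast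
  have finVQ: "finite (V - Q)" using fin by simp
  obtain P where P: "\<And>A. A \<in> A1 \<Longrightarrow> A \<subseteq> P A \<and> P A \<subseteq> V - Q \<and> conn (P A)"
    "\<And>A B. A \<in> A1 \<Longrightarrow> B \<in> A1 \<Longrightarrow> A \<noteq> B \<Longrightarrow> P A \<inter> P B = {}"
    "\<not> touch (\<Union>A\<in>A1. P A) (V - Q - (\<Union>A\<in>A1. P A))"
    by (rule parts_exist[OF finVQ fA1 dA1 A1VQ]) (assumption | rule that)+
  define I where "I = P ` A1"
  have Pinj: "inj_on P A1"
  proof (rule inj_onI)
    fix A B assume AB: "A \<in> A1" "B \<in> A1" "P A = P B"
    have "P A \<noteq> {}" using P(1)[OF AB(1)] conn_nonempty by blast
    then show "A = B" using P(2)[OF AB(1,2)] AB(3) by auto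
  qed
  have IV: "\<Union>I \<subseteq> V - Q" using P(1) by (auto simp: I_def)
  have touchP: "?touched (\<Union>(P ` J)) \<subseteq> J" if J: "J \<subseteq> A1" for J
  proof
    fix B assume B: "B \<in> ?touched (\<Union>(P ` J))"
    then obtain A x where x: "A \<in> J" "x \<in> P A" "x \<in> B" "B \<in> \<A>" by blast
    have "x \<notin> Q" using x(1,2) J P(1) by blast
    then have B1: "B \<in> A1" using x by (auto simp: A1_def Q_def)
    then have "x \<in> P B" using x P(1) by blast
    then have "B = A" using P(2)[OF B1, of A] x J by blast
    then show "B \<in> J" using x by simp
  qed
  have rkP: "rk T h (P A)" if "A \<in> A1" for A
    using rk_mono[of T h A "P A"] a1[OF that] P(1)[OF that] by blast
  have gp: "good_parts I T u"
    unfolding good_parts_def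
  proof (intro conjI ballI allI impI)
    show "finite I" using fA1 by (simp add: I_def)
    show "disjoint I"
    proof (rule disjointI)
      fix a b assume "a \<in> I" "b \<in> I" "a \<noteq> b"
      then obtain A B where "A \<in> A1" "B \<in> A1" "a = P A" "b = P B" unfolding I_def by (elim imageE)
      then show "a \<inter> b = {}" using P(2)[of A B] \<open>a \<noteq> b\<close> by auto
    qed
    fix X assume "X \<in> I"
    then obtain A where XA: "A \<in> A1" "X = P A" by (auto simp: I_def)
    show "finite X" using P(1)[OF XA(1)] XA(2) finVQ finite_subset by blast
    show "conn X" "X \<inter> T \<noteq> {}" using rkP[OF XA(1)] XA(2) rk_conn rk_terminal by blast+
    \<comment> \<open>A part with three neighbours would form with them a set of rank
      \<open>h + 1\<close> that avoids \<open>Q\<close> and meets at most four atoms, hence a cheap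
      one.\<close>
    show "card {B \<in> I. B \<noteq> X \<and> touch X B} \<le> 2"
    proof (rule ccontr)
      assume "\<not> ?thesis"
      then have c3: "3 \<le> card {B \<in> I. B \<noteq> X \<and> touch X B}" by simp
      obtain S where S: "S \<subseteq> {B \<in> I. B \<noteq> X \<and> touch X B}" "card S = 3"
        by (rule obtain_subset_with_card_n[OF c3])
      obtain X1 X2 X3 where S3: "S = {X1, X2, X3}" "X1 \<noteq> X2" "X1 \<noteq> X3" "X2 \<noteq> X3"
        using S(2) by (auto simp: card_3_iff)
      then have X3: "{X1, X2, X3} \<subseteq> {B \<in> I. B \<noteq> X \<and> touch X B}" "X1 \<noteq> X2" "X1 \<noteq> X3" "X2 \<noteq> X3"
        using S(1) by simp_all
      obtain B1 where B1: "B1 \<in> A1" "X1 = P B1" using X3(1) by (auto simp: I_def)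
      obtain B2 where B2: "B2 \<in> A1" "X2 = P B2" using X3(1) by (auto simp: I_def)
      obtain B3 where B3: "B3 \<in> A1" "X3 = P B3" using X3(1) by (auto simp: I_def)
      have ne: "A \<noteq> B1" "A \<noteq> B2" "A \<noteq> B3" "B1 \<noteq> B2" "B1 \<noteq> B3" "B2 \<noteq> B3"
        using X3 XA B1 B2 B3 by auto
      have t: "touch X X1" "touch X X2" "touch X X3" using X3(1) by auto
      have r: "rk T (Suc h) (X \<union> X1 \<union> X2 \<union> X3)"
      proof (rule rk_SucI)
        show "conn X" by fact
        show "rk T h X1" "rk T h X2" "rk T h X3" using rkP B1 B2 B3 by auto
        show "touch X X1" "touch X X2" "touch X X3" by fact+
        show "X \<inter> X1 = {}" "X \<inter> X2 = {}" "X \<inter> X3 = {}" "X1 \<inter> X2 = {}" "X1 \<inter> X3 = {}" "X2 \<inter> X3 = {}"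
          unfolding XA(2) B1(2) B2(2) B3(2)
          by (rule P(2)[OF XA(1) B1(1) ne(1)], rule P(2)[OF XA(1) B2(1) ne(2)], rule P(2)[OF XA(1) B3(1) ne(3)],
              rule P(2)[OF B1(1) B2(1) ne(4)], rule P(2)[OF B1(1) B3(1) ne(5)], rule P(2)[OF B2(1) B3(1) ne(6)])
      qed
      have e: "X \<union> X1 \<union> X2 \<union> X3 = \<Union>(P ` {A, B1, B2, B3})"
        unfolding XA(2) B1(2) B2(2) B3(2) by auto
      have s: "\<Union>(P ` {A, B1, B2, B3}) \<subseteq> V - Q" using P(1)[OF XA(1)] P(1)[OF B1(1)] P(1)[OF B2(1)] P(1)[OF B3(1)] by simp
      have c: "card (?touched (\<Union>(P ` {A, B1, B2, B3}))) \<le> near h"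
      proof -
        have "?touched (\<Union>(P ` {A, B1, B2, B3})) \<subseteq> {A, B1, B2, B3}"
          by (rule touchP) (use XA(1) B1(1) B2(1) B3(1) in simp)
        then have "card (?touched (\<Union>(P ` {A, B1, B2, B3}))) \<le> card {A, B1, B2, B3}"
          by (rule card_mono[rotated]) simp
        also have "\<dots> \<le> 4" using card_length[of "[A, B1, B2, B3]"] by simp
        finally show ?thesis using m0 by simp
      qed
      show False by (rule nocheap[OF r[unfolded e] s c])
    qed
  next
    fix J' assume J': "J' \<subseteq> I" "card J' \<le> 4 * (3 * u + 1)"
    then obtain J where J: "J \<subseteq> A1" "J' = P ` J" unfolding I_def by (meson subset_imageE)
    have fJ: "finite J" using J(1) fA1 finite_subset by blast
    have "card (?touched (\<Union>(P ` J))) \<le> card J" using touchP[OF J(1)] fJ by (intro card_mono)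
    also have "card J = card J'" using J Pinj by (metis card_image inj_on_subset)
    finally have "card (?touched (\<Union>(P ` J))) \<le> near h" using J'(2) m0 by simp
    moreover have "\<Union>(P ` J) \<subseteq> V - Q" using P(1) J(1) by blast
    ultimately show "narrow (\<Union>J') T u" using no_near J(2) by simp
  qed
  have nVQ: "narrow (V - Q) T (5 * u)"
  proof -
    let ?R = "V - Q - \<Union>I"
    \<comment> \<open>Atoms in \<open>H0\<close> lie in \<open>Q\<close> and all others lie in
      parts, so the remainder meets no atom and is narrow by \<open>no_near\<close>.\<close>
    have "?touched ?R = {}"
    proof -
      have "A \<inter> ?R = {}" if "A \<in> \<A>" for A
      proof (cases "A \<in> H0")
        case True
        then show ?thesis by (auto simp: Q_def)
      next
        case False
        then have "A \<in> A1" using that by (simp add: A1_def)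
        then have "A \<subseteq> \<Union>I" using P(1) by (auto simp: I_def)
        then show ?thesis by blast
      qed
      then show ?thesis by blast
    qed
    then have "card (?touched ?R) \<le> near h" by (simp only: card.empty)
    then have "narrow ?R T u" by (intro no_near) blast
    then have "narrow ?R T (5 * u)" by (rule narrow_mono) simp
    moreover have "narrow (\<Union>I) T (5 * u)" by (rule good_parts_narrow[OF gp])
    moreover have "\<not> touch (\<Union>I) ?R" unfolding I_def by (rule P(3))
    ultimately have "narrow (\<Union>I \<union> ?R) T (5 * u)" by (intro narrow_Un) auto
    moreover have "\<Union>I \<union> ?R = V - Q" using IV by blast
    ultimately show ?thesis by simp
  qed
  define cut where "cut A N Z \<longleftrightarrow> P A \<subseteq> N \<and> N \<subseteq> \<Union>I \<and> Z \<subseteq> \<Union>I \<and> card Z \<le> 4 * u \<and>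
      (\<forall>v\<in>N - Z. \<forall>x\<in>\<Union>I - Z. adj v x \<longrightarrow> x \<in> N) \<and> card {B \<in> I. B \<inter> N \<noteq> {}} \<le> 6 * (3 * u + 1)" for A N Z
  have "\<exists>D. cut A (fst D) (snd D)" if "A \<in> A1" for A
  proof -
    have "P A \<in> I" using that by (simp add: I_def)
    then obtain N Z where NZ: "P A \<subseteq> N" "N \<subseteq> \<Union>I" "Z \<subseteq> \<Union>I" "card Z \<le> 4 * u"
      "\<And>v x. v \<in> N - Z \<Longrightarrow> x \<in> \<Union>I - Z \<Longrightarrow> adj v x \<Longrightarrow> x \<in> N" "card {B \<in> I. B \<inter> N \<noteq> {}} \<le> 6 * (3 * u + 1)"
      by (rule good_parts_local[OF gp]) (assumption | rule that)+
    then show ?thesis unfolding cut_def by (intro exI[of _ "(N, Z)"]) simp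
  qed
  then have "\<forall>A\<in>A1. \<exists>D. cut A (fst D) (snd D)" by blast
  then obtain D where D: "\<forall>A\<in>A1. cut A (fst (D A)) (snd (D A))" by (rule bchoice[THEN exE])
  define N where "N = (\<lambda>A. fst (D A))"
  define ZZ where "ZZ = (\<lambda>A. snd (D A))"
  have N: "P A \<subseteq> N A \<and> N A \<subseteq> \<Union>I \<and> ZZ A \<subseteq> \<Union>I \<and> card (ZZ A) \<le> 4 * u \<and>
      (\<forall>v\<in>N A - ZZ A. \<forall>x\<in>\<Union>I - ZZ A. adj v x \<longrightarrow> x \<in> N A) \<and> card {B \<in> I. B \<inter> N A \<noteq> {}} \<le> 6 * (3 * u + 1)"
    if "A \<in> A1" for A
    using D that unfolding N_def ZZ_def cut_def by blast
  define Z2 where "Z2 = (\<Union>A\<in>H1. ZZ A)"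
  have "card Z2 \<le> card H1 * (4 * u)" unfolding Z2_def using N H1A by (intro card_UN_bound[OF fH1]) auto
  then have cZ2: "card Z2 \<le> (q * p) * (4 * u)" using cZ1 mult_le_mono1[of "card H1" "q * p" "4 * u"] by linarith
  have Z2V: "Z2 \<subseteq> V" using N H1A IV unfolding Z2_def by blast
  define Z where "Z = Z1 \<union> Z2"
  \<comment> \<open>The region still joined to \<open>Q\<close> or to a cut atom after deleting
    \<open>Z\<close>. What lies outside avoids \<open>Q\<close> and is narrow by \<open>nVQ\<close>;
    inside, \<open>tW\<close> bounds the number of atoms met, so the induction hypothesis becomes
    affordable.\<close>
  define W where "W = {v. \<exists>X. conn X \<and> X \<subseteq> V - Z \<and> v \<in> X \<and> X \<inter> (Q \<union> \<Union>H1) \<noteq> {}}"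
  have WV: "W \<subseteq> V - Z" unfolding W_def by blast
  have Wcl: "x \<in> W" if vx: "v \<in> W" "x \<in> V - Z" "adj v x" for v x
  proof -
    obtain X where X: "conn X" "X \<subseteq> V - Z" "v \<in> X" "X \<inter> (Q \<union> \<Union>H1) \<noteq> {}" using vx(1) unfolding W_def by blast
    have "conn (insert x X)" using X vx(3) by (intro conn_insert) (auto simp: touch_def)
    then show ?thesis using X vx(2) unfolding W_def by blast
  qed
  have QW: "Q - Z \<subseteq> W"
  proof
    fix v assume v: "v \<in> Q - Z"
    then have "conn {v} \<and> {v} \<subseteq> V - Z \<and> v \<in> {v} \<and> {v} \<inter> (Q \<union> \<Union>H1) \<noteq> {}" using QV by auto
    then show "v \<in> W" unfolding W_def by blast
  qed
  have tW: "?touched W \<subseteq> H0 \<union> H1 \<union> (\<Union>A\<in>H1. {B \<in> A1. P B \<inter> N A \<noteq> {}})"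
  proof
    fix B assume B: "B \<in> ?touched W"
    show "B \<in> H0 \<union> H1 \<union> (\<Union>A\<in>H1. {B \<in> A1. P B \<inter> N A \<noteq> {}})"
    proof (cases "B \<in> H0 \<union> H1")
      case False
      then have B1: "B \<in> A1" "B \<notin> H1" using B by (auto simp: A1_def)
      obtain v where v: "v \<in> B" "v \<in> W" using B by blast
      obtain X y where X: "conn X" "X \<subseteq> V - Z" "v \<in> X" "y \<in> X" "y \<in> Q \<union> \<Union>H1" using v(2) unfolding W_def by blast
      obtain l where l: "walk (arcs_on X) l" "l \<noteq> []" "hd l = v" "last l = y" "set l \<subseteq> X"
        by (rule conn_walk[OF X(1,3,4)])
      \<comment> \<open>The path from \<open>v\<close> is stopped at its first vertex
        \<open>z\<close> in \<open>Q\<close> or in a cut atom. If \<open>z\<close> lies in a cut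
        atom \<open>A\<close>, the path avoids \<open>Q\<close> and \<open>ZZ A\<close> and cannot
        leave \<open>N A\<close>, so the part of \<open>B\<close> meets \<open>N A\<close>. If
        \<open>z\<close> lies in \<open>Q\<close>, the path avoids the cut vertices and cut atoms,
        so by \<open>atom_cut\<close> it meets no atom of \<open>A1\<close>, whereas
        \<open>v\<close> is in one.\<close>
      have "\<exists>z\<in>set l. z \<in> Q \<union> \<Union>H1" using l X(5) last_in_set by blast
      then obtain ys z zs where ys: "l = ys @ z # zs" "z \<in> Q \<union> \<Union>H1" "\<forall>y\<in>set ys. y \<notin> Q \<union> \<Union>H1"
        using split_list_first_prop[of l "\<lambda>z. z \<in> Q \<union> \<Union>H1"] by blast
      let ?Y = "set (ys @ [z])"
      have "l = (ys @ [z]) @ zs" using ys(1) by simp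
      then have "walk (arcs_on X) (ys @ [z])" using l(1) by (metis walk_append)
      then have cY: "conn ?Y" by (rule walk_arcs_on_adj) simp
      have vY: "v \<in> ?Y" using l(3) ys(1) by (cases ys) auto
      have YX: "?Y \<subseteq> V - Z" using l(5) ys(1) X(2) by auto
      show ?thesis
      proof (cases "z \<in> \<Union>H1")
        case True
        then obtain A where zA: "z \<in> A" "A \<in> H1" by blast
        then have A1': "A \<in> A1" using H1A by blast
        note NA = N[OF A1']
        have "z \<notin> Q" using A1Q[OF A1'] zA by blast
        then have YQ: "?Y \<subseteq> V - Q - ZZ A" using YX ys(3) zA(2) unfolding Z_def Z2_def by auto
        have "z \<in> N A" using zA P(1)[OF A1'] NA by blast
        then have "?Y \<inter> N A \<noteq> {}" by auto
        then have "?Y \<subseteq> N A"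
        proof (rule conn_subset_closed[OF cY])
          fix a b assume ab: "a \<in> N A" "a \<in> ?Y" "b \<in> ?Y" "adj a b"
          have "a \<in> N A - ZZ A" using ab YQ by blast
          moreover have "b \<in> \<Union>I"
          proof (rule ccontr)
            assume "b \<notin> \<Union>I"
            then have "b \<in> V - Q - \<Union>I" using ab(3) YQ by blast
            moreover have "a \<in> \<Union>I" using ab(1) NA by blast
            ultimately show False using P(3) ab(4) unfolding touch_def I_def by blast
          qed
          then have "b \<in> \<Union>I - ZZ A" using ab(3) YQ by blast
          ultimately show "b \<in> N A" using NA ab(4) by blast
        qed
        then have "v \<in> P B \<inter> N A" using vY v(1) P(1)[OF B1(1)] by blast
        then show ?thesis using zA(2) B1(1) by blast
      next
        case False
        then have zQ: "z \<in> Q" using ys(2) by blast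
        have YH: "?Y \<inter> \<Union>H1 = {}" using ys(3) False by auto
        have "?Y \<inter> \<Union>A1 = {}"
        proof (cases "z \<in> \<Union>\<M>")
          case True
          show ?thesis by (rule Za(4)[OF cY]) (use YX YH True in \<open>auto simp: Z_def Z1_def H1_def\<close>)
        next
          case False
          then have "z \<in> \<Union>H0" using zQ by (simp add: Q_def)
          then show ?thesis by (intro Zb(4)[OF cY]) (use YX YH in \<open>auto simp: Z_def Z1_def H1_def\<close>)
        qed
        then show ?thesis using vY v(1) B1(1) by blast
      qed
    qed blast
  qed
  have cN: "card {B \<in> A1. P B \<inter> N A \<noteq> {}} \<le> 2 * near h" if "A \<in> H1" for A
  proof -
    have "card {B \<in> A1. P B \<inter> N A \<noteq> {}} = card (P ` {B \<in> A1. P B \<inter> N A \<noteq> {}})"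
      by (rule card_image[symmetric]) (rule inj_on_subset[OF Pinj], blast)
    also have "\<dots> \<le> card {X \<in> I. X \<inter> N A \<noteq> {}}"
      using fA1 by (intro card_mono) (auto simp: I_def)
    also have "\<dots> \<le> 2 * near h" using N[of A] H1A that m0 by fastforce
    finally show ?thesis .
  qed
  define n where "n = card (?touched W)"
  have "finite (\<Union>A\<in>H1. {B \<in> A1. P B \<inter> N A \<noteq> {}})" using fH1 fA1 by simp
  then have "n \<le> card (H0 \<union> H1 \<union> (\<Union>A\<in>H1. {B \<in> A1. P B \<inter> N A \<noteq> {}}))"
    unfolding n_def using tW fH0 fH1 by (intro card_mono) auto
  also have "\<dots> \<le> card H0 + card H1 + card (\<Union>A\<in>H1. {B \<in> A1. P B \<inter> N A \<noteq> {}})"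
    by (meson add_le_mono card_Un_le le_refl le_trans)
  also have "\<dots> \<le> p * near h + q * p + (q * p) * (2 * near h)"
  proof -
    have "card (\<Union>A\<in>H1. {B \<in> A1. P B \<inter> N A \<noteq> {}}) \<le> card H1 * (2 * near h)"
      by (rule card_UN_bound[OF fH1 cN])
    also have "\<dots> \<le> (q * p) * (2 * near h)" using cZ1 by (intro mult_le_mono1) simp
    finally show ?thesis using cH0 cZ1 by linarith
  qed
  also have "\<dots> = (near h + q + q * (2 * near h)) * p" by (simp add: algebra_simps)
  finally have cn: "n \<le> (near h + q + q * (2 * near h)) * p" .
  have finW: "finite W" using WV fin by (meson Diff_subset finite_subset)
  have WV': "W \<subseteq> V" using WV by blast
  have "card \<B> \<le> n" if "packing T h W \<B>" for \<B>
    unfolding n_def by (rule packing_le_touched[OF A maxA WV' that])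
  then obtain Z3 where Z3: "Z3 \<subseteq> W" "card Z3 \<le> ep_const h * n" "narrow (W - Z3) T (wd h)"
    using IH[OF finW, of n] by blast
  have "narrow (W - Z3) T (wd (Suc h))" by (rule narrow_mono[OF Z3(3)]) simp
  moreover have "narrow (V - Z - W) T (wd (Suc h))"
  proof -
    have "narrow (V - Z - W) T (5 * u)" by (rule narrow_subset[OF nVQ _ finVQ]) (use QW in blast)
    then show ?thesis by (rule narrow_mono) (simp add: u_def)
  qed
  moreover have "\<not> touch (W - Z3) (V - Z - W)" using Wcl unfolding touch_def by blast
  ultimately have "narrow ((W - Z3) \<union> (V - Z - W)) T (wd (Suc h))" by (intro narrow_Un) auto
  moreover have "(W - Z3) \<union> (V - Z - W) = V - (Z \<union> Z3)" using WV Z3(1) by blast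
  ultimately have "narrow (V - (Z \<union> Z3)) T (wd (Suc h))" by simp
  moreover have "Z \<union> Z3 \<subseteq> V" using Z1V Z2V Z3(1) WV unfolding Z_def by blast
  moreover have "card (Z \<union> Z3) \<le> ep_const (Suc h) * p"
  proof -
    have "card (Z \<union> Z3) \<le> card Z1 + card Z2 + card Z3"
      unfolding Z_def by (meson add_le_mono card_Un_le le_refl le_trans)
    also have "\<dots> \<le> q * p + (q * p) * (4 * u) + ep_const h * ((near h + q + q * (2 * near h)) * p)"
      using cZ1 cZ2 Z3(2) mult_le_mono2[OF cn, of "ep_const h"] by linarith
    also have "\<dots> = ep_const (Suc h) * p"
      by (simp add: q_def u_def Let_def algebra_simps)
    finally show ?thesis .
  qed
  ultimately show ?thesis by blast
qed

theorem ep_rank: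
  assumes "finite V" "\<And>\<B>. packing T h V \<B> \<Longrightarrow> card \<B> \<le> p"
  shows "\<exists>Z\<subseteq>V. card Z \<le> ep_const h * p \<and> narrow (V - Z) T (wd h)"
  using assms
proof (induction h arbitrary: V p)
  case 0
  \<comment> \<open>Single terminals are disjoint sets of rank 0, so there are at most
    \<open>p\<close> of them and all can be deleted.\<close>
  let ?B = "(\<lambda>x. {x}) ` (T \<inter> V)"
  have "packing T 0 V ?B" using 0(1) by (auto simp: packing_def disjoint_def)
  then have "card ?B \<le> p" by (rule 0(2))
  then have "card (T \<inter> V) \<le> ep_const 0 * p" by (simp add: card_image)
  moreover have "narrow (V - (T \<inter> V)) T (wd 0)"
  proof (rule narrow_step[OF lay_empty])
    have "T \<inter> (V - (T \<inter> V) - {}) = {}" by blast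
    then show "card (T \<inter> (V - (T \<inter> V) - {})) \<le> wd 0" by simp
  qed
  ultimately show ?case by (meson inf_le2)
next
  case (Suc h)
  show ?case by (rule ep_step[OF Suc.IH Suc.prems])
qed

end

subsection \<open>Hosting forests in sets of large rank\<close>

text \<open>Encodes acyclicity: every edge is a bridge.\<close>

definition bridged :: "('v \<Rightarrow> 'v \<Rightarrow> bool) \<Rightarrow> bool" where
  "bridged e \<longleftrightarrow> (\<forall>x y. e x y \<longrightarrow>
     (\<exists>D. x \<in> D \<and> y \<notin> D \<and> (\<forall>u\<in>D. \<forall>v. v \<notin> D \<longrightarrow> e u v \<longrightarrow> u = x \<and> v = y)))"

context sym_graph
begin

text \<open>A path from \<open>x\<close> is stopped at its first vertex in the centre or a branch.
  The branch it reaches, or an arbitrary one if it reaches the centre, is merged with the path into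
  the new centre; the other two branches survive.\<close>

lemma rk_reroot:
  assumes "rk T (Suc h) X" "x \<in> X"
  obtains C A B where "C \<union> A \<union> B \<subseteq> X" "x \<in> C" "conn C" "rk T h A" "rk T h B" "touch C A" "touch C B"
    "C \<inter> A = {}" "C \<inter> B = {}" "A \<inter> B = {}"
proof -
  note found = that
  obtain C A1 A2 A3 where C: "C \<union> A1 \<union> A2 \<union> A3 \<subseteq> X" "conn C" and r: "rk T h A1" "rk T h A2" "rk T h A3"
    and t: "touch C A1" "touch C A2" "touch C A3"
    and d: "C \<inter> A1 = {}" "C \<inter> A2 = {}" "C \<inter> A3 = {}" "A1 \<inter> A2 = {}" "A1 \<inter> A3 = {}" "A2 \<inter> A3 = {}"
    using assms(1) unfolding rk.simps by blast
  let ?U = "C \<union> A1 \<union> A2 \<union> A3"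
  have cX: "conn X" using assms(1) by (rule rk_conn)
  obtain y where y: "y \<in> C" using conn_nonempty[OF C(2)] by blast
  then have "y \<in> X" using C(1) by blast
  then obtain l where l: "walk (arcs_on X) l" "l \<noteq> []" "hd l = x" "last l = y" "set l \<subseteq> X"
    by (rule conn_walk[OF cX assms(2)])
  have "\<exists>z\<in>set l. z \<in> ?U" using l(2,4) y last_in_set by blast
  then obtain ys z zs where ys: "l = ys @ z # zs" "z \<in> ?U" "\<forall>y\<in>set ys. y \<notin> ?U"
    using split_list_first_prop[of l "\<lambda>z. z \<in> ?U"] by blast
  let ?Y = "set (ys @ [z])"
  have "l = (ys @ [z]) @ zs" using ys(1) by simp
  then have "walk (arcs_on X) (ys @ [z])" using l(1) by (metis walk_append)
  then have cY: "conn ?Y" by (rule walk_arcs_on_adj) simp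
  have xY: "x \<in> ?Y" using l(3) ys(1) by (cases ys) auto
  have YX: "?Y \<subseteq> X" using l(5) ys(1) by auto
  have out: thesis
    if A: "z \<in> C \<union> A" "conn A" "touch C A" "rk T h B1" "rk T h B2" "touch C B1" "touch C B2"
      "(C \<union> A) \<inter> (B1 \<union> B2) = {}" "B1 \<inter> B2 = {}" "A \<union> B1 \<union> B2 \<subseteq> ?U" for A B1 B2
  proof (rule found[of "C \<union> A \<union> ?Y" B1 B2])
    show "(C \<union> A \<union> ?Y) \<union> B1 \<union> B2 \<subseteq> X" using A(10) C(1) YX by blast
    show "x \<in> C \<union> A \<union> ?Y" using xY by blast
    have "conn (C \<union> A)" by (rule conn_Un) (use C A in auto)
    then show "conn (C \<union> A \<union> ?Y)" by (rule conn_Un[OF _ cY]) (use A(1) in auto)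
    show "rk T h B1" "rk T h B2" by fact+
    show "touch (C \<union> A \<union> ?Y) B1" "touch (C \<union> A \<union> ?Y) B2"
      by (rule touch_mono[OF A(6)] touch_mono[OF A(7)]; blast)+
    have "z \<notin> B1 \<union> B2" using A(1,8) by blast
    then have "?Y \<inter> (B1 \<union> B2) = {}" using ys(3) A(10) by auto
    then show "(C \<union> A \<union> ?Y) \<inter> B1 = {}" "(C \<union> A \<union> ?Y) \<inter> B2 = {}" using A(8) by blast+
    show "B1 \<inter> B2 = {}" by fact
  qed
  consider "z \<in> C \<union> A1" | "z \<in> A2" | "z \<in> A3" using ys(2) by blast
  then show thesis
  proof cases
    case 1
    show thesis by (rule out[of A1 A2 A3]) (use 1 r t d rk_conn in auto)
  next
    case 2
    show thesis by (rule out[of A2 A1 A3]) (use 2 r t d rk_conn in auto)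
  next
    case 3
    show thesis by (rule out[of A3 A1 A2]) (use 3 r t d rk_conn in auto)
  qed
qed

text \<open>Rerooting at \<open>x\<close> leaves two branches of rank one less. An edge between
  \<open>r\<close> and some \<open>c\<close> is a bridge and splits \<open>W\<close> into two
  smaller sets, which go into one branch each; the centre joins the branch set of \<open>r\<close>
  and realizes the edge. If \<open>r\<close> has no neighbour in \<open>W\<close>, it is split off
  alone. Prescribing the vertex \<open>x\<close> in the branch set of \<open>r\<close> is what
  allows the smaller models to be attached to the centre.\<close>

lemma host_forest:
  assumes e: "bridged e" "\<And>x y. e x y \<Longrightarrow> e y x"
  shows "finite W \<Longrightarrow> card W \<le> Suc n \<Longrightarrow> r \<in> W \<Longrightarrow> rk T n X \<Longrightarrow> x \<in> X \<Longrightarrow>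
    \<exists>B. x \<in> B r \<and> (\<forall>y\<in>W. B y \<subseteq> X \<and> conn (B y) \<and> B y \<inter> T \<noteq> {}) \<and>
      (\<forall>y\<in>W. \<forall>z\<in>W. y \<noteq> z \<longrightarrow> B y \<inter> B z = {} \<and> (e y z \<longrightarrow> touch (B y) (B z)))"
proof (induction n arbitrary: W r X x)
  case 0
  then have "W = {r}" using card_le_Suc0_iff_eq[of W] by auto
  then show ?case using 0 rk_conn[OF 0(4)] rk_terminal[OF 0(4)] by (intro exI[of _ "\<lambda>_. X"]) auto
next
  case (Suc n)
  show ?case
  proof (cases "W = {r}")
    case True
    then show ?thesis using Suc.prems rk_conn[OF Suc.prems(4)] rk_terminal[OF Suc.prems(4)]
      by (intro exI[of _ "\<lambda>_. X"]) auto
  next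
    case False
    have "\<exists>c D. c \<in> W \<and> c \<in> D \<and> r \<notin> D \<and> (\<forall>u\<in>D \<inter> W. \<forall>v\<in>W - D. e u v \<longrightarrow> u = c \<and> v = r)"
    proof (cases "\<exists>c\<in>W. e c r")
      case True
      then obtain c where c: "c \<in> W" "e c r" by blast
      then show ?thesis using e(1) unfolding bridged_def by (metis DiffD2 IntD1)
    next
      case no: False
      obtain c where "c \<in> W" "c \<noteq> r" using False Suc.prems(3) by blast
      then show ?thesis using no by (intro exI[of _ c] exI[of _ "- {r}"]) auto
    qed
    then obtain c D where D: "c \<in> W" "c \<in> D" "r \<notin> D"
      "\<And>u v. u \<in> D \<Longrightarrow> u \<in> W \<Longrightarrow> v \<in> W \<Longrightarrow> v \<notin> D \<Longrightarrow> e u v \<Longrightarrow> u = c \<and> v = r" by blast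
    have fW: "finite (W - D)" "finite (W \<inter> D)" using Suc.prems(1) by auto
    have "W - D \<subset> W" "W \<inter> D \<subset> W" using D(1-3) Suc.prems(3) by blast+
    then have cW: "card (W - D) \<le> Suc n" "card (W \<inter> D) \<le> Suc n"
      using Suc.prems(1,2) psubset_card_mono[of W "W - D"] psubset_card_mono[of W "W \<inter> D"] by linarith+
    obtain C A A' where C: "C \<union> A \<union> A' \<subseteq> X" "x \<in> C" "conn C" and r: "rk T n A" "rk T n A'"
      and t: "touch C A" "touch C A'" and d: "C \<inter> A = {}" "C \<inter> A' = {}" "A \<inter> A' = {}"
      by (rule rk_reroot[OF Suc.prems(4,5)])
    obtain a where a: "a \<in> A" "touch C {a}" using t(1) unfolding touch_def by blast
    obtain a' where a': "a' \<in> A'" "touch C {a'}" using t(2) unfolding touch_def by blast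
    have "r \<in> W - D" "c \<in> W \<inter> D" using D(1-3) Suc.prems(3) by blast+
    note IH1 = Suc.IH[OF fW(1) cW(1) this(1) r(1) a(1)] and IH2 = Suc.IH[OF fW(2) cW(2) this(2) r(2) a'(1)]
    obtain B where B0: "a \<in> B r \<and> (\<forall>y\<in>W - D. B y \<subseteq> A \<and> conn (B y) \<and> B y \<inter> T \<noteq> {}) \<and>
      (\<forall>y\<in>W - D. \<forall>z\<in>W - D. y \<noteq> z \<longrightarrow> B y \<inter> B z = {} \<and> (e y z \<longrightarrow> touch (B y) (B z)))"
      using IH1 by (rule exE)
    have B: "a \<in> B r" "\<And>y. y \<in> W - D \<Longrightarrow> B y \<subseteq> A \<and> conn (B y) \<and> B y \<inter> T \<noteq> {}"
      "\<And>y z. y \<in> W - D \<Longrightarrow> z \<in> W - D \<Longrightarrow> y \<noteq> z \<Longrightarrow> B y \<inter> B z = {} \<and> (e y z \<longrightarrow> touch (B y) (B z))"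
      using B0 by simp_all
    obtain B' where B'0: "a' \<in> B' c \<and> (\<forall>y\<in>W \<inter> D. B' y \<subseteq> A' \<and> conn (B' y) \<and> B' y \<inter> T \<noteq> {}) \<and>
      (\<forall>y\<in>W \<inter> D. \<forall>z\<in>W \<inter> D. y \<noteq> z \<longrightarrow> B' y \<inter> B' z = {} \<and> (e y z \<longrightarrow> touch (B' y) (B' z)))"
      using IH2 by (rule exE)
    have B': "a' \<in> B' c" "\<And>y. y \<in> W \<inter> D \<Longrightarrow> B' y \<subseteq> A' \<and> conn (B' y) \<and> B' y \<inter> T \<noteq> {}"
      "\<And>y z. y \<in> W \<inter> D \<Longrightarrow> z \<in> W \<inter> D \<Longrightarrow> y \<noteq> z \<Longrightarrow> B' y \<inter> B' z = {} \<and> (e y z \<longrightarrow> touch (B' y) (B' z))"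
      using B'0 by simp_all
    define H where "H = (\<lambda>y. if y \<in> D then B' y else if y = r then C \<union> B r else B y)"
    have HD: "H y = B' y" if "y \<in> D" for y using that by (simp add: H_def)
    have Hr: "H r = C \<union> B r" using D(3) by (simp add: H_def)
    have HW: "B y \<subseteq> H y" "H y \<subseteq> C \<union> B y" if "y \<notin> D" for y using that by (auto simp: H_def)
    have rW: "r \<in> W - D" using D(3) Suc.prems(3) by blast
    have cr: "conn (C \<union> B r)"
    proof (rule conn_Un[OF C(3)])
      show "conn (B r)" using B(2)[OF rW] by simp
      show "C \<inter> B r \<noteq> {} \<or> touch C (B r)" using touch_mono[OF a(2), of C "B r"] B(1) by auto
    qed
    have base: "H y \<subseteq> X \<and> conn (H y) \<and> H y \<inter> T \<noteq> {}" if y: "y \<in> W" for y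
    proof (cases "y \<in> D")
      case True
      then show ?thesis using HD[OF True] B'(2)[of y] y C(1) by auto
    next
      case False
      then have "conn (H y)" using cr B(2)[of y] y by (simp add: H_def)
      moreover have "H y \<subseteq> X" using HW(2)[OF False] B(2)[of y] y False C(1) by blast
      moreover have "H y \<inter> T \<noteq> {}" using HW(1)[OF False] B(2)[of y] y False by blast
      ultimately show ?thesis by simp
    qed
    have tc: "touch (H r) (H c)"
      unfolding Hr HD[OF D(2)] by (rule touch_mono[OF a'(2)]) (use B'(1) in auto)
    have cross: "H y \<inter> H z = {} \<and> (e y z \<longrightarrow> touch (H y) (H z))"
      if y: "y \<in> W" "y \<in> D" "z \<in> W" "z \<notin> D" for y z
    proof
      have "H y \<subseteq> A'" using HD[OF y(2)] B'(2)[of y] y by simp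
      moreover have "H z \<subseteq> C \<union> A" using HW(2)[OF y(4)] B(2)[of z] y by blast
      ultimately show "H y \<inter> H z = {}" using d by blast
      show "e y z \<longrightarrow> touch (H y) (H z)" using D(4)[OF y(2,1,3,4)] tc touch_sym by blast
    qed
    have "H y \<inter> H z = {} \<and> (e y z \<longrightarrow> touch (H y) (H z))"
      if y: "y \<in> W" "z \<in> W" "y \<noteq> z" for y z
    proof -
      consider "y \<in> D" "z \<in> D" | "y \<in> D" "z \<notin> D" | "y \<notin> D" "z \<in> D" | "y \<notin> D" "z \<notin> D" by blast
      then show ?thesis
      proof cases
        case 1
        then show ?thesis using B'(3)[of y z] y by (simp add: HD)
      next
        case 2
        then show ?thesis using cross y by blast
      next
        case 3
        then show ?thesis using cross[of z y] y e(2)[of y z] touch_sym[of "H y" "H z"] by (auto simp: Int_commute)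
      next
        case 4
        then have b: "B y \<inter> B z = {}" "e y z \<longrightarrow> touch (B y) (B z)" using B(3)[of y z] y by auto
        have "B y \<inter> C = {}" "B z \<inter> C = {}" using B(2)[of y] B(2)[of z] y 4 d by auto
        then have "H y \<inter> H z = {}" using b(1) y(3) 4 by (auto simp: H_def)
        moreover have "e y z \<longrightarrow> touch (H y) (H z)" using b(2) touch_mono HW(1) 4 by blast
        ultimately show ?thesis by simp
      qed
    qed
    moreover have "x \<in> H r" using Hr C(2) by simp
    ultimately show ?thesis using base by (intro exI[of _ H]) blast
  qed
qed

end

subsection \<open>Placing trees greedily\<close>

locale host_graph = sym_graph adj + F: sym_graph e
  for adj :: "'a \<Rightarrow> 'a \<Rightarrow> bool" and e :: "'v \<Rightarrow> 'v \<Rightarrow> bool" +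
  fixes R :: "'v set" and S :: "'a set"
begin

text \<open>A rooted model, within \<open>X\<close>, of the subgraph of the forest induced on
  \<open>I\<close>.\<close>

definition hosts :: "'v set \<Rightarrow> 'a set \<Rightarrow> bool" where
  "hosts I X \<longleftrightarrow> (\<exists>B. (\<forall>y\<in>I. B y \<subseteq> X \<and> conn (B y) \<and> (y \<in> R \<longrightarrow> B y \<inter> S \<noteq> {})) \<and>
     (\<forall>y\<in>I. \<forall>z\<in>I. y \<noteq> z \<longrightarrow> B y \<inter> B z = {} \<and> (e y z \<longrightarrow> touch (B y) (B z))))"

text \<open>The elements of \<open>J\<close> are tasks: copies of the trees \<open>c j\<close> that are to be placed disjointly.\<close>

definition placeable :: "('j \<Rightarrow> 'v set) \<Rightarrow> 'j set \<Rightarrow> 'a set \<Rightarrow> bool" where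
  "placeable c J V \<longleftrightarrow> (\<exists>h. (\<forall>j\<in>J. h j \<subseteq> V \<and> hosts (c j) (h j)) \<and> disjoint_family_on h J)"

text \<open>Blocking a single task suffices, because a model of the forest contains a model of each
  component.\<close>

definition blocked :: "('j \<Rightarrow> 'v set) \<Rightarrow> 'j set \<Rightarrow> nat \<Rightarrow> 'a set \<Rightarrow> bool" where
  "blocked c J b V \<longleftrightarrow> (\<exists>Z\<subseteq>V. card Z \<le> b \<and> (\<exists>j\<in>J. \<not> hosts (c j) (V - Z)))"

lemma hosts_mono: "hosts I X \<Longrightarrow> X \<subseteq> Y \<Longrightarrow> hosts I Y"
proof -
  assume "hosts I X" "X \<subseteq> Y"
  then obtain B where "\<forall>y\<in>I. B y \<subseteq> Y \<and> conn (B y) \<and> (y \<in> R \<longrightarrow> B y \<inter> S \<noteq> {})"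
     "\<forall>y\<in>I. \<forall>z\<in>I. y \<noteq> z \<longrightarrow> B y \<inter> B z = {} \<and> (e y z \<longrightarrow> touch (B y) (B z))"
    unfolding hosts_def by (auto dest: subset_trans)
  then show ?thesis unfolding hosts_def by (intro exI[of _ B] conjI)
qed

lemma hosts_rk:
  assumes "bridged e" "finite I" "card I \<le> Suc n" "rk T n X" "T = S \<or> I \<inter> R = {}"
  shows "hosts I X"
proof (cases "I = {}")
  case True
  then show ?thesis by (simp add: hosts_def)
next
  case False
  then obtain r where "r \<in> I" by blast
  obtain x where "x \<in> X" using rk_conn[OF assms(4)] conn_nonempty by blast
  obtain B where B: "x \<in> B r \<and> (\<forall>y\<in>I. B y \<subseteq> X \<and> conn (B y) \<and> B y \<inter> T \<noteq> {}) \<and>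
    (\<forall>y\<in>I. \<forall>z\<in>I. y \<noteq> z \<longrightarrow> B y \<inter> B z = {} \<and> (e y z \<longrightarrow> touch (B y) (B z)))"
    using host_forest[OF assms(1) F.adj_sym assms(2,3) \<open>r \<in> I\<close> assms(4) \<open>x \<in> X\<close>] by (rule exE)
  have "B y \<inter> S \<noteq> {}" if "y \<in> I" "y \<in> R" for y using B assms(5) that by auto
  then show ?thesis unfolding hosts_def by (intro exI[of _ B]) (simp add: B)
qed

lemma hosts_conn:
  assumes "hosts I X" "F.conn I"
  obtains U where "U \<subseteq> X" "conn U" "hosts I U" "I \<inter> R \<noteq> {} \<Longrightarrow> U \<inter> S \<noteq> {}"
proof -
  obtain B where B0: "(\<forall>y\<in>I. B y \<subseteq> X \<and> conn (B y) \<and> (y \<in> R \<longrightarrow> B y \<inter> S \<noteq> {})) \<and>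
     (\<forall>y\<in>I. \<forall>z\<in>I. y \<noteq> z \<longrightarrow> B y \<inter> B z = {} \<and> (e y z \<longrightarrow> touch (B y) (B z)))"
    using assms(1) unfolding hosts_def by (rule exE)
  have B: "\<And>y. y \<in> I \<Longrightarrow> B y \<subseteq> X \<and> conn (B y) \<and> (y \<in> R \<longrightarrow> B y \<inter> S \<noteq> {})"
    "\<And>y z. y \<in> I \<Longrightarrow> z \<in> I \<Longrightarrow> y \<noteq> z \<Longrightarrow> B y \<inter> B z = {} \<and> (e y z \<longrightarrow> touch (B y) (B z))"
    using B0 by simp_all
  let ?U = "\<Union>y\<in>I. B y"
  have "conn ?U"
    unfolding conn_def
  proof (intro conjI allI impI)
    show "?U \<noteq> {}" using F.conn_nonempty[OF assms(2)] B(1) conn_nonempty by blast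
    fix Y assume Y: "Y \<inter> ?U \<noteq> {}" and cl: "\<forall>y\<in>Y \<inter> ?U. \<forall>x\<in>?U. adj y x \<longrightarrow> x \<in> Y"
    have sub: "B y \<subseteq> Y" if y: "y \<in> I" "B y \<inter> Y \<noteq> {}" for y
      by (rule conn_subset_closed[OF _ y(2)]) (use B(1)[OF y(1)] cl y(1) in blast)+
    have "I \<subseteq> {y \<in> I. B y \<subseteq> Y}"
    proof (rule F.conn_subset_closed[OF assms(2)])
      show "I \<inter> {y \<in> I. B y \<subseteq> Y} \<noteq> {}" using Y sub by blast
      fix v u assume v: "v \<in> {y \<in> I. B y \<subseteq> Y}" "v \<in> I" "u \<in> I" "e v u"
      have "B u \<inter> Y \<noteq> {}"
      proof (cases "u = v")
        case True
        then show ?thesis using v B(1)[OF v(2)] conn_nonempty by blast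
      next
        case False
        then have "touch (B v) (B u)" using B(2)[OF v(2,3)] v(4) by auto
        then obtain a b where "a \<in> B v" "b \<in> B u" "adj a b" unfolding touch_def by blast
        then show ?thesis using cl v by blast
      qed
      then show "u \<in> {y \<in> I. B y \<subseteq> Y}" using sub v(3) by blast
    qed
    then show "?U \<subseteq> Y" by blast
  qed
  moreover have "hosts I ?U"
    unfolding hosts_def by (rule exI[of _ B]) (use B in blast)
  moreover have "?U \<subseteq> X" using B(1) by blast
  moreover have "?U \<inter> S \<noteq> {}" if "I \<inter> R \<noteq> {}" using that B(1) by blast
  ultimately show ?thesis using that by blast
qed

lemma hosts_separated:
  assumes I: "hosts I (X \<union> Y)" "F.conn I" and nt: "\<not> touch X Y"
  shows "hosts I X \<or> hosts I Y"
proof -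
  obtain U where U: "U \<subseteq> X \<union> Y" "conn U" "hosts I U" by (rule hosts_conn[OF I])
  have "U \<subseteq> X \<or> U \<subseteq> Y"
  proof (cases "U \<inter> X = {}")
    case False
    have "U \<subseteq> X" by (rule conn_subset_closed[OF U(2) False]) (use U(1) nt in \<open>auto simp: touch_def\<close>)
    then show ?thesis ..
  qed (use U(1) in blast)
  then show ?thesis using U(3) hosts_mono by blast
qed

text \<open>Take the first laid set hosting a task and let \<open>Z\<close> consist of its boundary,
  that of its predecessor and the terminals of the increment. A connected host avoiding
  \<open>Z\<close> contains an element of \<open>T\<close>, which must lie in the predecessor, and
  it cannot cross the deleted boundary; but the predecessor hosts nothing. The condition on
  \<open>T\<close> ensures that every host contains an element of \<open>T\<close>.\<close>

lemma first_host:
  assumes c: "\<And>j. j \<in> J \<Longrightarrow> F.conn (c j) \<and> (T = V \<or> T = S \<and> c j \<inter> R \<noteq> {})"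
    and Y: "lay V T w Y" "\<exists>j\<in>J. hosts (c j) Y"
  shows "\<exists>X Z. Z \<subseteq> X \<and> X \<subseteq> V \<and> bd V X \<subseteq> Z \<and> card Z \<le> 3 * w \<and> (\<exists>j\<in>J. hosts (c j) X) \<and>
    (\<forall>j\<in>J. \<not> hosts (c j) (X - Z))"
  using Y
proof (induction rule: lay.induct)
  case lay_empty
  then obtain j where j: "j \<in> J" "hosts (c j) {}" by blast
  then obtain U where "U \<subseteq> {}" "conn U" using hosts_conn c by metis
  then show ?case using conn_nonempty by blast
next
  case (lay_step X Y)
  show ?case
  proof (cases "\<exists>j\<in>J. hosts (c j) X")
    case True
    then show ?thesis by (rule lay_step.IH)
  next
    case False
    let ?Z = "bd V Y \<union> bd V X \<union> (T \<inter> (Y - X))"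
    have "card ?Z \<le> card (bd V Y) + card (bd V X) + card (T \<inter> (Y - X))"
      by (meson add_le_mono card_Un_le le_refl le_trans)
    then have "card ?Z \<le> 3 * w" using lay_step.hyps lay_bound[of V T w X] by linarith
    moreover have "?Z \<subseteq> Y" using bd_subset lay_step.hyps(2) by blast
    moreover have "\<not> hosts (c j) (Y - ?Z)" if j: "j \<in> J" for j
    proof
      assume "hosts (c j) (Y - ?Z)"
      then obtain U where U: "U \<subseteq> Y - ?Z" "conn U" "hosts (c j) U" "c j \<inter> R \<noteq> {} \<Longrightarrow> U \<inter> S \<noteq> {}"
        using hosts_conn c[OF j] by metis
      have UV: "U \<subseteq> V" using U(1) lay_step.hyps(3) by blast
      then have "U \<inter> T \<noteq> {}" using c[OF j] U(4) conn_nonempty[OF U(2)] by blast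
      then have "U \<inter> X \<noteq> {}" using U(1) by blast
      then have "U \<subseteq> X" by (rule conn_subset_closed[OF U(2)]) (use U(1) UV in \<open>auto simp: bd_def\<close>)
      then show False using False j hosts_mono[OF U(3)] by blast
    qed
    ultimately show ?thesis using lay_step by (intro exI[of _ Y] exI[of _ ?Z]) blast
  qed
qed

text \<open>The task that fits first is placed in \<open>X\<close>, the others in
  \<open>V - X\<close>. If \<open>Y\<close> blocks one of those, then \<open>Y \<union> Z\<close>
  blocks it in \<open>V\<close>: \<open>Z\<close> contains the boundary of \<open>X\<close>, so a
  connected host would lie in \<open>X - Z\<close> or in \<open>V - X - Y\<close>, and
  \<open>X - Z\<close> hosts no task of \<open>J\<close> at all.\<close>

lemma greedy_step:
  assumes c: "\<And>j. j \<in> J \<Longrightarrow> F.conn (c j) \<and> (T = V \<or> T = S \<and> c j \<inter> R \<noteq> {})"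
    and Y: "lay V T w Y" "\<exists>j\<in>J. hosts (c j) Y"
    and IH: "\<And>j X. j \<in> J \<Longrightarrow> placeable c (J - {j}) (V - X) \<or> blocked c (J - {j}) b (V - X)"
  shows "placeable c J V \<or> blocked c J (b + 3 * w) V"
proof -
  obtain X Z j where X: "Z \<subseteq> X" "X \<subseteq> V" "bd V X \<subseteq> Z" "card Z \<le> 3 * w" "j \<in> J" "hosts (c j) X"
    "\<And>j. j \<in> J \<Longrightarrow> \<not> hosts (c j) (X - Z)"
    using first_host[OF c Y] by blast
  from IH[OF X(5), of X] show ?thesis
  proof
    assume "placeable c (J - {j}) (V - X)"
    then obtain h where h: "\<And>i. i \<in> J - {j} \<Longrightarrow> h i \<subseteq> V - X \<and> hosts (c i) (h i)" "disjoint_family_on h (J - {j})"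
      unfolding placeable_def by blast
    let ?h = "h(j := X)"
    have "disjoint_family_on ?h J"
      unfolding disjoint_family_on_def
    proof (intro ballI impI)
      fix a b assume ab: "a \<in> J" "b \<in> J" "a \<noteq> b"
      show "?h a \<inter> ?h b = {}"
        using ab h(1)[of a] h(1)[of b] h(2) unfolding disjoint_family_on_def by auto
    qed
    moreover have "?h i \<subseteq> V \<and> hosts (c i) (?h i)" if "i \<in> J" for i
      using h(1)[of i] X(2,6) that by auto
    ultimately show ?thesis unfolding placeable_def by blast
  next
    assume "blocked c (J - {j}) b (V - X)"
    then obtain Y i where Y: "Y \<subseteq> V - X" "card Y \<le> b" "i \<in> J" "\<not> hosts (c i) (V - X - Y)"
      unfolding blocked_def by blast
    have "\<not> touch (X - Z) (V - X - Y)" using X(1,3) unfolding touch_def bd_def by blast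
    then have "\<not> hosts (c i) ((X - Z) \<union> (V - X - Y))"
      using hosts_separated[of "c i" "X - Z" "V - X - Y"] c[OF Y(3)] X(7)[OF Y(3)] Y(4) by blast
    moreover have "(X - Z) \<union> (V - X - Y) = V - (Y \<union> Z)" using X(1,2) Y(1) by blast
    ultimately have "\<not> hosts (c i) (V - (Y \<union> Z))" by simp
    moreover have "card (Y \<union> Z) \<le> b + 3 * w" using card_Un_le[of Y Z] Y(2) X(4) by linarith
    moreover have "Y \<union> Z \<subseteq> V" using X(1,2) Y(1) by blast
    ultimately show ?thesis unfolding blocked_def using Y(3) by blast
  qed
qed

lemma blocked_trivial: "j \<in> J \<Longrightarrow> \<not> hosts (c j) V \<Longrightarrow> blocked c J b V"
  unfolding blocked_def by (intro exI[of _ "{}"]) auto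

lemma place_narrow:
  assumes "finite J" "finite V" "narrow V S w" "\<And>j. j \<in> J \<Longrightarrow> F.conn (c j) \<and> c j \<inter> R \<noteq> {}"
  shows "placeable c J V \<or> blocked c J (card J * (3 * w)) V"
  using assms
proof (induction "card J" arbitrary: J V)
  case 0
  then have "J = {}" by simp
  then show ?case by (simp add: placeable_def disjoint_family_on_def)
next
  case (Suc n)
  show ?case
  proof (cases "\<exists>j\<in>J. hosts (c j) V")
    case True
    have "placeable c (J - {j}) (V - X) \<or> blocked c (J - {j}) (n * (3 * w)) (V - X)" if j: "j \<in> J" for j X
    proof -
      have n: "n = card (J - {j})" using Suc.hyps(2) Suc.prems(1) j by simp
      have "narrow (V - X) S w" by (rule narrow_subset[OF Suc.prems(3) _ Suc.prems(2)]) blast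
      then show ?thesis using Suc.hyps(1)[OF n, of "V - X"] Suc.prems n by auto
    qed
    then have "placeable c J V \<or> blocked c J (n * (3 * w) + 3 * w) V"
      by (intro greedy_step[of J c S V w V]) (use Suc.prems True in \<open>auto simp: narrow_def\<close>)
    then show ?thesis using Suc.hyps(2)[symmetric] by (simp add: add.commute)
  next
    case False
    obtain j where "j \<in> J" using Suc.hyps(2) by fastforce
    then show ?thesis using blocked_trivial[of j J c V] False by blast
  qed
qed

text \<open>Either there are enough disjoint sets of rank \<open>t\<close> to give each task its
  own, or \<open>ep_rank\<close> with \<open>p\<close> equal to the number of tasks leaves a narrow
  graph after a linear deletion.\<close>

lemma place_rooted:
  assumes br: "bridged e" and fin: "finite J" "finite V"
    and c: "\<And>j. j \<in> J \<Longrightarrow> F.conn (c j) \<and> finite (c j) \<and> card (c j) \<le> Suc t \<and> c j \<inter> R \<noteq> {}"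
  shows "placeable c J V \<or> blocked c J (card J * (ep_const t + 3 * wd t)) V"
proof (cases "\<exists>\<B>. packing S t V \<B> \<and> card J \<le> card \<B>")
  case True
  then obtain \<B> where B: "packing S t V \<B>" "card J \<le> card \<B>" by blast
  then have "finite \<B>" by (simp add: packing_def)
  then obtain h where h: "inj_on h J" "h ` J \<subseteq> \<B>" using card_le_inj[OF fin(1) _ B(2)] by blast
  have "disjoint_family_on h J"
    unfolding disjoint_family_on_def
  proof (intro ballI impI)
    fix i j assume "i \<in> J" "j \<in> J" "i \<noteq> j"
    then show "h i \<inter> h j = {}" using packing_disjoint[OF B(1), of "h i" "h j"] h unfolding inj_on_def by blast
  qed
  moreover have "h j \<subseteq> V \<and> hosts (c j) (h j)" if j: "j \<in> J" for j
  proof -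
    have "h j \<subseteq> V" "rk S t (h j)" using h(2) j B(1) by (auto simp: packing_def)
    then show ?thesis using hosts_rk[OF br, of "c j" t S "h j"] c[OF j] by blast
  qed
  ultimately show ?thesis unfolding placeable_def by blast
next
  case False
  then have "card \<B> \<le> card J" if "packing S t V \<B>" for \<B> using that by (meson nat_le_linear)
  then obtain Z where Z: "Z \<subseteq> V" "card Z \<le> ep_const t * card J" "narrow (V - Z) S (wd t)"
    using ep_rank[OF fin(2), of S t "card J"] by blast
  have "placeable c J (V - Z) \<or> blocked c J (card J * (3 * wd t)) (V - Z)"
    using place_narrow[OF fin(1) _ Z(3)] fin(2) c by blast
  then show ?thesis
  proof
    assume "placeable c J (V - Z)"
    then show ?thesis unfolding placeable_def by (meson Diff_subset subset_trans)
  next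
    assume "blocked c J (card J * (3 * wd t)) (V - Z)"
    then obtain Y j where Y: "Y \<subseteq> V - Z" "card Y \<le> card J * (3 * wd t)" "j \<in> J" "\<not> hosts (c j) (V - Z - Y)"
      unfolding blocked_def by blast
    have "V - Z - Y = V - (Z \<union> Y)" by blast
    moreover have "card (Z \<union> Y) \<le> card J * (ep_const t + 3 * wd t)"
      using card_Un_le[of Z Y] Z(2) Y(2) by (simp add: algebra_simps)
    ultimately show ?thesis unfolding blocked_def using Y Z(1) by (metis Diff_subset Un_least subset_trans)
  qed
qed

text \<open>While some tree is rootless, all vertices serve as terminals: either all of
  \<open>V\<close> is laid, and the tree is hosted there or blocked outright, or some laid set
  contains a set of rank \<open>t\<close> hosting it. In the hosted cases \<open>greedy_step\<close>
  removes one task, possibly a different one. Once all remaining trees have roots,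
  \<open>place_rooted\<close> finishes.\<close>

lemma place_all:
  assumes "bridged e" "finite J" "finite V"
    "\<And>j. j \<in> J \<Longrightarrow> F.conn (c j) \<and> finite (c j) \<and> card (c j) \<le> Suc t"
  shows "placeable c J V \<or> blocked c J (card J * (ep_const t + 3 * wd t + 3 * 3 ^ Suc t)) V"
  using assms(2-)
proof (induction "card J" arbitrary: J V)
  case 0
  then have "J = {}" by simp
  then show ?case by (simp add: placeable_def disjoint_family_on_def)
next
  case (Suc n)
  let ?K = "ep_const t + 3 * wd t + 3 * 3 ^ Suc t"
  have step: ?case if Y: "lay V V (3 ^ Suc t) Y" "\<exists>j\<in>J. hosts (c j) Y" for Y
  proof -
    have "placeable c (J - {j}) (V - X) \<or> blocked c (J - {j}) (n * ?K) (V - X)" if j: "j \<in> J" for j X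
    proof -
      have n: "n = card (J - {j})" using Suc.hyps(2) Suc.prems(1) j by simp
      have "finite (J - {j})" "finite (V - X)" using Suc.prems(1,2) by auto
      then show ?thesis unfolding n by (rule Suc.hyps(1)[OF n]) (rule Suc.prems(3), blast)
    qed
    then have "placeable c J V \<or> blocked c J (n * ?K + 3 * 3 ^ Suc t) V"
      using Suc.prems(3) by (intro greedy_step[OF _ Y]) auto
    moreover have "n * ?K + 3 * 3 ^ Suc t \<le> card J * ?K" using Suc.hyps(2)[symmetric] by simp
    ultimately show ?thesis unfolding blocked_def by (meson le_trans)
  qed
  show ?case
  proof (cases "\<forall>j\<in>J. c j \<inter> R \<noteq> {}")
    case True
    then have "placeable c J V \<or> blocked c J (card J * (ep_const t + 3 * wd t)) V"
      using Suc.prems(3) by (intro place_rooted[OF assms(1) Suc.prems(1,2)]) blast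
    moreover have "card J * (ep_const t + 3 * wd t) \<le> card J * ?K" by simp
    ultimately show ?thesis unfolding blocked_def by (meson le_trans)
  next
    case False
    then obtain j where j: "j \<in> J" "c j \<inter> R = {}" by blast
    show ?thesis
    proof (cases "narrow V V (3 ^ Suc t)")
      case True
      show ?thesis
      proof (cases "hosts (c j) V")
        case True
        show ?thesis by (rule step[of V]) (use \<open>narrow V V _\<close> True j(1) in \<open>auto simp: narrow_def\<close>)
      qed (use blocked_trivial[of j J c V] j(1) in blast)
    next
      case False
      then obtain X Y where X: "lay V V (3 ^ Suc t) Y" "X \<subseteq> Y" "rk V t X"
        using rk_in_lay[OF Suc.prems(2)] by blast
      have "hosts (c j) X" using hosts_rk[OF assms(1) _ _ X(3)] Suc.prems(3)[OF j(1)] j(2) by blast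
      then show ?thesis using step[OF X(1)] hosts_mono X(2) j(1) by blast
    qed
  qed
qed

end

subsection \<open>Models in graphs\<close>

text \<open>The library notion is reachability in the symmetric closure of the induced subgraph. As
  \<open>adj\<close> is symmetric, this closure is \<open>adj\<close> on \<open>B\<close>.\<close>

lemma connected_induce:
  assumes "sym_graph adj" "tail H = fst" "head H = snd"
    "\<And>x y. x \<in> B \<Longrightarrow> y \<in> B \<Longrightarrow> (x, y) \<in> arcs H \<longleftrightarrow> adj x y"
  shows "Digraph_Component.connected (H \<restriction> B) \<longleftrightarrow> sym_graph.conn adj B"
proof -
  interpret sym_graph adj by fact
  let ?r = "{(x, y). x \<in> B \<and> y \<in> B \<and> adj x y}"
  have "parcs (mk_symmetric (H \<restriction> B)) = ?r"
  proof (intro equalityI subrelI)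
    show "(x, y) \<in> ?r" if "(x, y) \<in> parcs (mk_symmetric (H \<restriction> B))" for x y
      using that assms(2-4) adj_sym by (auto simp: parcs_mk_symmetric)
  next
    fix x y assume "(x, y) \<in> ?r"
    then have "(x, y) \<in> arcs (H \<restriction> B)" using assms(2-4) by simp
    then show "(x, y) \<in> parcs (mk_symmetric (H \<restriction> B))"
      using assms(2,3) unfolding parcs_mk_symmetric by force
  qed
  then have eq: "Digraph_Component.connected (H \<restriction> B) \<longleftrightarrow> B \<noteq> {} \<and> (\<forall>u\<in>B. \<forall>v\<in>B. (u, v) \<in> rtrancl_on B ?r)"
    by (simp add: Digraph_Component.connected_def strongly_connected_def reachable_def)
  show ?thesis
  proof
    assume "Digraph_Component.connected (H \<restriction> B)"
    then have B: "B \<noteq> {}" "\<And>u v. u \<in> B \<Longrightarrow> v \<in> B \<Longrightarrow> (u, v) \<in> rtrancl_on B ?r" unfolding eq by blast+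
    show "conn B"
      unfolding conn_def
    proof (intro conjI allI impI)
      fix Y assume Y: "Y \<inter> B \<noteq> {}" "\<forall>y\<in>Y \<inter> B. \<forall>x\<in>B. adj y x \<longrightarrow> x \<in> Y"
      then obtain u where u: "u \<in> Y" "u \<in> B" by blast
      show "B \<subseteq> Y"
      proof
        fix v assume "v \<in> B"
        then have "(u, v) \<in> rtrancl_on B ?r" by (rule B(2)[OF u(2)])
        then show "v \<in> Y" by (induction rule: rtrancl_on_induct) (use u Y(2) in auto)
      qed
    qed fact
  next
    assume c: "conn B"
    have "(u, v) \<in> rtrancl_on B ?r" if uv: "u \<in> B" "v \<in> B" for u v
    proof -
      have "B \<subseteq> {v. (u, v) \<in> rtrancl_on B ?r}"
      proof (rule conn_subset_closed[OF c])
        show "B \<inter> {v. (u, v) \<in> rtrancl_on B ?r} \<noteq> {}" using uv(1) by auto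
      qed (auto intro: rtrancl_on_into_rtrancl_on)
      then show ?thesis using uv(2) by blast
    qed
    then show "Digraph_Component.connected (H \<restriction> B)" unfolding eq using conn_nonempty[OF c] by blast
  qed
qed

text \<open>Arcs of a pair graph are pairs of vertices, so zipping a vertex sequence with its tail
  lists the arcs.\<close>

lemma pcas_zip:
  assumes "walk r (x # p)"
  shows "pcas x (zip (x # p) p) (last (x # p)) \<and> pawalk_verts x (zip (x # p) p) = x # p \<and> set (zip (x # p) p) \<subseteq> r"
  using assms by (induction p arbitrary: x) auto

lemma rtrancl_distinct_walk:
  assumes "(x, y) \<in> r\<^sup>*"
  obtains p where "walk r p" "distinct p" "p \<noteq> []" "hd p = x" "last p = y"
proof -
  have "\<exists>p. walk r p \<and> distinct p \<and> p \<noteq> [] \<and> hd p = x \<and> last p = y"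
    using assms
  proof (induction rule: rtrancl_induct)
    case base
    show ?case by (intro exI[of _ "[x]"]) simp
  next
    case (step y z)
    then obtain p where p: "walk r p" "distinct p" "p \<noteq> []" "hd p = x" "last p = y" by blast
    show ?case
    proof (cases "z \<in> set p")
      case True
      then obtain a b where ab: "p = a @ z # b" by (auto dest: split_list)
      have "p = (a @ [z]) @ b" using ab by simp
      then have "walk r (a @ [z])" using p(1) by (metis walk_append)
      moreover have "hd (a @ [z]) = x" using p(4) ab by (cases a) auto
      ultimately show ?thesis using p(2) ab by (intro exI[of _ "a @ [z]"]) auto
    next
      case False
      then show ?thesis using p step(2) by (intro exI[of _ "p @ [z]"]) (auto simp: walk_append)
    qed
  qed
  then show ?thesis using that by blast
qed

text \<open>One side of the bridge is what \<open>x\<close> reaches without the edge. If it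
  contained \<open>y\<close>, a path from \<open>x\<close> to \<open>y\<close> would have at least
  three vertices, because the edge itself is removed, and the edge would close it to a cycle of
  length at least 3.\<close>

lemma undirected_forest_bridged:
  assumes F: "pair_graph F" and forest: "undirected_forest (with_proj F)"
  shows "bridged (\<lambda>x y. (x, y) \<in> parcs F)"
  unfolding bridged_def
proof (intro allI impI)
  interpret F: pair_graph F by fact
  fix x y assume xy: "(x, y) \<in> parcs F"
  have sym: "(v, u) \<in> parcs F" if "(u, v) \<in> parcs F" for u v
    using F.pair_sym_arcs that by (simp add: symmetric_def sym_def)
  let ?r = "parcs F - {(x, y), (y, x)}"
  let ?D = "{u. (x, u) \<in> ?r\<^sup>*}"
  have "y \<notin> ?D"
  proof
    assume "y \<in> ?D"
    then obtain p where p: "walk ?r p" "distinct p" "p \<noteq> []" "hd p = x" "last p = y"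
      using rtrancl_distinct_walk[of x y ?r] by blast
    then obtain q where q: "p = x # q" by (cases p) auto
    have "x \<noteq> y" using F.pair_no_loops[OF xy] by simp
    then have q2: "2 \<le> length q" using p q by (cases q; cases "tl q") auto
    have "walk (parcs F) p" by (rule walk_mono[OF p(1)]) blast
    then have "walk (parcs F) (x # q @ [x])" using sym[OF xy] p(5) q by (simp add: walk_append flip: append_Cons)
    then have w: "pcas x (zip (x # q @ [x]) (q @ [x])) x" "pawalk_verts x (zip (x # q @ [x]) (q @ [x])) = x # q @ [x]"
      "set (zip (x # q @ [x]) (q @ [x])) \<subseteq> parcs F" using pcas_zip[of "parcs F" x "q @ [x]"] by auto
    have "x \<in> pverts F" using F.in_arcsD1[OF xy] .
    moreover have "distinct (q @ [x])" using p(2) q by auto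
    ultimately have "pre_digraph.cycle (with_proj F) (zip (x # q @ [x]) (q @ [x]))"
      using w unfolding F.cycle_def F.awalk_def by auto
    moreover have "3 \<le> length (zip (x # q @ [x]) (q @ [x]))" using q2 by simp
    ultimately show False using forest unfolding undirected_forest_def by blast
  qed
  moreover have "u = x \<and> v = y" if uv: "u \<in> ?D" "v \<notin> ?D" "(u, v) \<in> parcs F" for u v
  proof -
    have "(u, v) \<notin> ?r" using uv(1,2) by (auto intro: rtrancl_into_rtrancl)
    then have "(u, v) = (x, y) \<or> (u, v) = (y, x)" using uv(3) by blast
    moreover have "v \<noteq> x" using uv(2) by auto
    ultimately show ?thesis by blast
  qed
  ultimately show "\<exists>D. x \<in> D \<and> y \<notin> D \<and> (\<forall>u\<in>D. \<forall>v. v \<notin> D \<longrightarrow> (u, v) \<in> parcs F \<longrightarrow> u = x \<and> v = y)"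
    by (intro exI[of _ ?D]) blast
qed

lemma (in sym_graph) conn_component: "conn {y. adj\<^sup>*\<^sup>* x y}"
  unfolding conn_def
proof (intro conjI allI impI)
  let ?C = "{y. adj\<^sup>*\<^sup>* x y}"
  show "?C \<noteq> {}" by blast
  fix Y assume "Y \<inter> ?C \<noteq> {}" and cl: "\<forall>y\<in>Y \<inter> ?C. \<forall>z\<in>?C. adj y z \<longrightarrow> z \<in> Y"
  then obtain y where y: "y \<in> Y" "adj\<^sup>*\<^sup>* x y" by blast
  have *: "adj\<^sup>*\<^sup>* x z \<and> (z \<in> Y \<longrightarrow> x \<in> Y)" if "adj\<^sup>*\<^sup>* x z" for z
    using that
  proof (induction rule: rtranclp_induct)
    case (step u v)
    then have "v \<in> Y \<longrightarrow> u \<in> Y" using cl adj_sym[of u v] by auto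
    then show ?case using step by auto
  qed simp
  then have "x \<in> Y" using y by blast
  show "?C \<subseteq> Y"
  proof
    fix z assume "z \<in> ?C"
    then have "adj\<^sup>*\<^sup>* x z" by simp
    then show "z \<in> Y"
    proof (induction rule: rtranclp_induct)
      case (step u v)
      then show ?case using cl rtranclp.rtrancl_into_rtrancl[of adj x u v] by blast
    qed fact
  qed
qed

lemma sym_graph_parcs: "pair_graph G \<Longrightarrow> sym_graph (\<lambda>x y. (x, y) \<in> parcs G)"
proof -
  assume "pair_graph G"
  then interpret pair_graph G .
  show ?thesis using pair_sym_arcs by unfold_locales (simp add: symmetric_def sym_def)
qed

text \<open>Used in contrapositive form: if one component has no place after the deletion, no model
  of the forest is left.\<close>

lemma hosts_if_rooted_model:
  assumes F: "pair_graph F" and G: "pair_graph G" and I: "I \<subseteq> pverts F" "R \<subseteq> pverts F"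
    and B: "rooted_model (with_proj F) R (delete_verts (with_proj G) X) (S - X) B"
  shows "host_graph.hosts (\<lambda>x y. (x, y) \<in> parcs G) (\<lambda>x y. (x, y) \<in> parcs F) R S I (pverts G - X)"
proof -
  let ?a = "\<lambda>x y. (x, y) \<in> parcs G" and ?e = "\<lambda>x y. (x, y) \<in> parcs F"
  let ?H = "delete_verts (with_proj G) X"
  interpret sym_graph ?a by (rule sym_graph_parcs[OF G])
  interpret F: sym_graph ?e by (rule sym_graph_parcs[OF F])
  interpret host_graph ?a ?e R S by unfold_locales
  have vH: "verts ?H = pverts G - X" by (simp add: delete_verts_def)
  have aH: "arcs_ends ?H \<subseteq> parcs G" by (auto simp: delete_verts_def arcs_ends_conv)
  have m: "B y \<subseteq> pverts G - X \<and> Digraph_Component.connected (?H \<restriction> B y)" if "y \<in> pverts F" for y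
    using B that unfolding rooted_model_def graph_model_def by (simp add: vH)
  have c: "conn (B y)" if y: "y \<in> pverts F" for y
  proof -
    have "Digraph_Component.connected (?H \<restriction> B y) \<longleftrightarrow> conn (B y)"
      by (rule connected_induce) (use m[OF y] in \<open>auto simp: delete_verts_def intro: sym_graph_axioms\<close>)
    then show ?thesis using m[OF y] by simp
  qed
  have d: "B y \<inter> B z = {}" if "y \<in> pverts F" "z \<in> pverts F" "y \<noteq> z" for y z
    using B that unfolding rooted_model_def graph_model_def disjoint_family_on_def by simp
  have t: "touch (B y) (B z)" if "(y, z) \<in> parcs F" for y z
  proof -
    have "\<forall>(y, z)\<in>parcs F. \<exists>u\<in>B y. \<exists>v\<in>B z. (u, v) \<in> arcs_ends ?H"
      using B unfolding rooted_model_def graph_model_def by simp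
    then have "\<exists>u\<in>B y. \<exists>v\<in>B z. (u, v) \<in> arcs_ends ?H" using that by auto
    then show ?thesis using aH unfolding touch_def by blast
  qed
  have r: "B y \<inter> S \<noteq> {}" if "y \<in> R" for y
    using B that unfolding rooted_model_def by blast
  show ?thesis unfolding hosts_def
  proof (intro exI[of _ B] conjI ballI impI)
    show "y \<in> I \<Longrightarrow> B y \<subseteq> pverts G - X" for y using m I(1) by blast
    show "y \<in> I \<Longrightarrow> conn (B y)" for y using c I(1) by blast
    show "y \<in> R \<Longrightarrow> B y \<inter> S \<noteq> {}" for y by (rule r)
    show "y \<in> I \<Longrightarrow> z \<in> I \<Longrightarrow> y \<noteq> z \<Longrightarrow> B y \<inter> B z = {}" for y z using d I(1) by blast
    show "(y, z) \<in> parcs F \<Longrightarrow> touch (B y) (B z)" for y z by (rule t)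
  qed
qed

text \<open>Task \<open>(C x, i)\<close> is the component of \<open>x\<close> in copy
  \<open>i\<close>. Edges do not leave components, so models of the components combine to a model of
  the forest.\<close>

lemma rooted_models_if_placeable:
  assumes F: "pair_graph F" and G: "pair_graph G" and R: "R \<subseteq> pverts F"
    and C: "\<And>x. x \<in> pverts F \<Longrightarrow> x \<in> C x \<and> C x \<in> \<C>" "\<And>x y. (x, y) \<in> parcs F \<Longrightarrow> C x = C y"
    and p: "host_graph.placeable (\<lambda>x y. (x, y) \<in> parcs G) (\<lambda>x y. (x, y) \<in> parcs F) R S fst
      (\<C> \<times> {..<k}) (pverts G)"
  shows "has_disjoint_rooted_models k (with_proj F) R (with_proj G) S"
proof -
  let ?a = "\<lambda>x y. (x, y) \<in> parcs G" and ?e = "\<lambda>x y. (x, y) \<in> parcs F"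
  interpret sym_graph ?a by (rule sym_graph_parcs[OF G])
  interpret F: sym_graph ?e by (rule sym_graph_parcs[OF F])
  interpret host_graph ?a ?e R S by unfold_locales
  obtain h where h: "\<forall>j\<in>\<C> \<times> {..<k}. h j \<subseteq> pverts G \<and> hosts (fst j) (h j)"
    and dh: "disjoint_family_on h (\<C> \<times> {..<k})"
    using p unfolding placeable_def by (elim exE conjE)
  let ?P = "\<lambda>j B. (\<forall>y\<in>fst j. B y \<subseteq> h j \<and> conn (B y) \<and> (y \<in> R \<longrightarrow> B y \<inter> S \<noteq> {})) \<and>
     (\<forall>y\<in>fst j. \<forall>z\<in>fst j. y \<noteq> z \<longrightarrow> B y \<inter> B z = {} \<and> (?e y z \<longrightarrow> touch (B y) (B z)))"
  have "\<forall>j\<in>\<C> \<times> {..<k}. \<exists>B. ?P j B" using h unfolding hosts_def by simp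
  then obtain M where M: "\<forall>j\<in>\<C> \<times> {..<k}. ?P j (M j)" by (rule bchoice[THEN exE])
  define B where "B = (\<lambda>i x. M (C x, i) x)"
  have hG: "h (C x, i) \<subseteq> pverts G" if "x \<in> pverts F" "i < k" for x i
    using h C(1)[OF that(1)] that(2) by simp
  have dis: "h (C x, i) \<inter> h (C y, j) = {}" if "x \<in> pverts F" "i < k" "y \<in> pverts F" "j < k" "(C x, i) \<noteq> (C y, j)"
    for x y i j
    by (rule disjoint_family_onD[OF dh]) (use C(1) that in auto)
  have P: "?P (C x, i) (M (C x, i))" if "x \<in> pverts F" "i < k" for x i
    using M C(1)[OF that(1)] that(2) by simp
  have B1: "B i x \<subseteq> h (C x, i) \<and> conn (B i x) \<and> (x \<in> R \<longrightarrow> B i x \<inter> S \<noteq> {})" if "x \<in> pverts F" "i < k" for x i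
    using P[OF that] C(1)[OF that(1)] unfolding B_def by simp
  have B2: "B i x \<inter> B i y = {} \<and> ((x, y) \<in> parcs F \<longrightarrow> touch (B i x) (B i y))"
    if x: "x \<in> pverts F" "y \<in> pverts F" "i < k" "x \<noteq> y" "C x = C y" for x y i
  proof -
    have "x \<in> C x" "y \<in> C x" using C(1) x by metis+
    then show ?thesis using P[OF x(1,3)] x(4,5) unfolding B_def by simp
  qed
  have Bd: "B i x \<inter> B j y = {}" if x: "x \<in> pverts F" "y \<in> pverts F" "i < k" "j < k" "(x, i) \<noteq> (y, j)" for x y i j
  proof (cases "(C x, i) = (C y, j)")
    case True
    then show ?thesis using B2[of x y i] x by auto
  next
    case False
    have "h (C x, i) \<inter> h (C y, j) = {}" by (rule dis[OF x(1,3,2,4) False])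
    moreover have "B i x \<subseteq> h (C x, i)" "B j y \<subseteq> h (C y, j)" using B1 x by simp_all
    ultimately show ?thesis by blast
  qed
  have in_F: "x \<in> pverts F" "y \<in> pverts F" "x \<noteq> y" if xy: "(x, y) \<in> parcs F" for x y
  proof -
    interpret F: pair_graph F by fact
    show "x \<in> pverts F" "y \<in> pverts F" "x \<noteq> y"
      using F.in_arcsD1[OF xy] F.in_arcsD2[OF xy] F.pair_no_loops[OF xy] by simp_all
  qed
  have "rooted_model (with_proj F) R (with_proj G) S (B i)" if i: "i < k" for i
    unfolding rooted_model_def graph_model_def with_proj_simps
  proof (intro conjI ballI)
    fix x assume x: "x \<in> pverts F"
    show "B i x \<subseteq> pverts G" using B1[OF x i] hG[OF x i] by blast
    show "B i x \<noteq> {}" using B1[OF x i] conn_nonempty by blast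
    have "Digraph_Component.connected (with_proj G \<restriction> B i x) \<longleftrightarrow> conn (B i x)"
      by (rule connected_induce) (auto intro: sym_graph_axioms)
    then show "Digraph_Component.connected (with_proj G \<restriction> B i x)" using B1[OF x i] by simp
  next
    show "disjoint_family_on (B i) (pverts F)" unfolding disjoint_family_on_def using Bd i by simp
    fix xy assume "xy \<in> parcs F"
    then obtain x y where xy: "xy = (x, y)" "(x, y) \<in> parcs F" by (cases xy) simp
    have "touch (B i x) (B i y)" using B2[OF in_F(1,2)[OF xy(2)] i in_F(3)[OF xy(2)] C(2)[OF xy(2)]] xy(2) by simp
    then show "case xy of (x, y) \<Rightarrow> \<exists>u\<in>B i x. \<exists>v\<in>B i y. (u, v) \<in> parcs G"
      unfolding xy(1) touch_def by simp
  next
    fix x assume "x \<in> R"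
    then show "B i x \<inter> S \<noteq> {}" using B1[of x i] R i by blast
  qed
  moreover have "disjoint_family_on (\<lambda>i. \<Union>x\<in>pverts F. B i x) {..<k}"
    unfolding disjoint_family_on_def
  proof (intro ballI impI)
    fix i j assume "i \<in> {..<k}" "j \<in> {..<k}" "i \<noteq> j"
    then have "B i x \<inter> B j y = {}" if "x \<in> pverts F" "y \<in> pverts F" for x y using Bd[of x y i j] that by simp
    then show "(\<Union>x\<in>pverts F. B i x) \<inter> (\<Union>x\<in>pverts F. B j x) = {}" by blast
  qed
  ultimately show ?thesis unfolding has_disjoint_rooted_models_def with_proj_simps by blast
qed

text \<open>The forest has at most \<open>t\<close> components with at most \<open>t\<close>
  vertices each. This makes at most \<open>t * k\<close> tasks, each costing \<open>K\<close>
  deleted vertices when a task is blocked.\<close>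

lemma forest_erdos_posa:
  assumes F: "pair_graph F" "undirected_forest (with_proj F)" "card (pverts F) = t" "R \<subseteq> pverts F"
    and G: "pair_graph G" and K: "K = ep_const t + 3 * wd t + 3 * 3 ^ Suc t"
  shows "has_disjoint_rooted_models k (with_proj F) R (with_proj G) S \<or>
    (\<exists>X \<subseteq> pverts G. card X \<le> t * K * k \<and>
      \<not> (\<exists>B. rooted_model (with_proj F) R (delete_verts (with_proj G) X) (S - X) B))"
proof -
  let ?a = "\<lambda>x y. (x, y) \<in> parcs G" and ?e = "\<lambda>x y. (x, y) \<in> parcs F"
  interpret sym_graph ?a by (rule sym_graph_parcs[OF G])
  interpret F: sym_graph ?e by (rule sym_graph_parcs[OF F(1)])
  interpret host_graph ?a ?e R S by unfold_locales
  interpret PF: pair_graph F by fact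
  interpret PG: pair_graph G by fact
  define C where "C = (\<lambda>x. {y. ?e\<^sup>*\<^sup>* x y})"
  let ?C = "C ` pverts F" and ?V = "pverts F"
  have CV: "C x \<subseteq> ?V" if "x \<in> ?V" for x
  proof
    fix y assume "y \<in> C x"
    then have "?e\<^sup>*\<^sup>* x y" by (simp add: C_def)
    then show "y \<in> ?V" by (induction rule: rtranclp_induct) (use that PF.in_arcsD2 in auto)
  qed
  have fin: "finite ?V" "finite (pverts G)" by (rule PF.pair_finite_verts, rule PG.pair_finite_verts)
  have Ce: "C x = C y" if xy: "(x, y) \<in> parcs F" for x y
  proof -
    have "?e\<^sup>*\<^sup>* x y" "?e\<^sup>*\<^sup>* y x" using xy F.adj_sym[OF xy] by (simp_all add: r_into_rtranclp)
    then show ?thesis unfolding C_def by (auto intro: rtranclp_trans)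
  qed
  have Cx: "x \<in> C x \<and> C x \<in> ?C" if "x \<in> ?V" for x using that by (simp add: C_def)
  have c: "F.conn (fst j) \<and> finite (fst j) \<and> card (fst j) \<le> Suc t" if j: "j \<in> ?C \<times> {..<k}" for j
  proof -
    obtain x where x: "x \<in> ?V" "fst j = C x" using j by auto
    have "F.conn (C x)" unfolding C_def by (rule F.conn_component)
    moreover have "finite (C x)" "card (C x) \<le> card ?V"
      using CV[OF x(1)] fin(1) by (auto intro: finite_subset card_mono)
    ultimately show ?thesis using x(2) F(3) by simp
  qed
  have "bridged ?e" by (rule undirected_forest_bridged[OF F(1,2)])
  moreover have "finite (?C \<times> {..<k})" using fin(1) by simp
  ultimately have "placeable fst (?C \<times> {..<k}) (pverts G) \<or>
      blocked fst (?C \<times> {..<k}) (card (?C \<times> {..<k}) * K) (pverts G)"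
    using fin(2) unfolding K by (rule place_all) (rule c)
  then show ?thesis
  proof
    assume "placeable fst (?C \<times> {..<k}) (pverts G)"
    then show ?thesis using rooted_models_if_placeable[OF F(1) G F(4) Cx Ce] by blast
  next
    assume "blocked fst (?C \<times> {..<k}) (card (?C \<times> {..<k}) * K) (pverts G)"
    then obtain Z j where Z: "Z \<subseteq> pverts G" "card Z \<le> card (?C \<times> {..<k}) * K" "j \<in> ?C \<times> {..<k}"
      "\<not> hosts (fst j) (pverts G - Z)" unfolding blocked_def by blast
    have "card (?C \<times> {..<k}) \<le> t * k"
      using card_image_le[OF fin(1), of C] F(3) by (simp add: card_cartesian_product)
    then have "card (?C \<times> {..<k}) * K \<le> t * k * K" by (rule mult_le_mono1)
    then have "card Z \<le> t * k * K" using Z(2) by (rule le_trans[rotated])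
    then have "card Z \<le> t * K * k" by (simp add: ac_simps)
    obtain x where "x \<in> ?V" "fst j = C x" using Z(3) by auto
    then have "fst j \<subseteq> ?V" using CV by simp
    then have "\<not> (\<exists>B. rooted_model (with_proj F) R (delete_verts (with_proj G) Z) (S - Z) B)"
      using hosts_if_rooted_model[OF F(1) G _ F(4)] Z(4) by blast
    then show ?thesis using Z(1) \<open>card Z \<le> t * K * k\<close> by blast
  qed
qed

theorem theorem2:
  shows "\<exists>g' :: nat \<Rightarrow> nat.
    \<forall>(t :: nat) (F :: 'v pair_pre_digraph) (R :: 'v set)
     (G :: 'a pair_pre_digraph) (S :: 'a set) (k :: nat).
      pair_graph F \<longrightarrow> undirected_forest (with_proj F) \<longrightarrow> card (pverts F) = t \<longrightarrow>
      R \<subseteq> pverts F \<longrightarrow> pair_graph G \<longrightarrow> S \<subseteq> pverts G \<longrightarrow> k > 0 \<longrightarrow>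
        has_disjoint_rooted_models k (with_proj F) R (with_proj G) S \<or>
        (\<exists>X \<subseteq> pverts G. card X \<le> g' t * k \<and>
           \<not> (\<exists>B. rooted_model (with_proj F) R (delete_verts (with_proj G) X) (S - X) B))"
proof (intro exI allI impI)
  fix t k :: nat and F :: "'v pair_pre_digraph" and R and G :: "'a pair_pre_digraph" and S
  assume "pair_graph F" "undirected_forest (with_proj F)" "card (pverts F) = t" "R \<subseteq> pverts F" "pair_graph G"
  then show "has_disjoint_rooted_models k (with_proj F) R (with_proj G) S \<or>
      (\<exists>X \<subseteq> pverts G. card X \<le> (\<lambda>t. t * (ep_const t + 3 * wd t + 3 * 3 ^ Suc t)) t * k \<and>
        \<not> (\<exists>B. rooted_model (with_proj F) R (delete_verts (with_proj G) X) (S - X) B))"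
    using forest_erdos_posa[OF _ _ _ _ _ refl] by simp
qed

end
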